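(* Let $I$ be a compact non-degenerate interval and let $f\colon I\to I$ be a continuous, transitive, piecewise monotone map (with finitely many pieces) of topological entropy $\log\beta$. Then $f$ is conjugate via an increasing homeomorphism $I\to[0,1]$ to exactly one map $g\colon[0,1]\to[0,1]$ of constant slope $\beta$.
   Context: A continuous map $f\colon I\to I$ is piecewise monotone if $I$ can be divided into finitely many intervals on each of which $f$ is (non-strictly) monotone. Transitive means that some point has a dense trajectory. A map $g\colon[0,1]\to[0,1]$ has constant slope $\beta$ if it is piecewise affine with finitely many pieces and $|g'(x)|=\beta$ at every $x$ where $g$ is differentiable. $f$ is conjugate to $g$ via an increasing homeomorphism $\psi\colon I\to[0,1]$ if $\psi\circ f=g\circ\psi$. *)

theory Defs
  imports "HOL-Analysis.Analysis" "HOL-Library.Disjoint_Sets"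
begin

text \<open>
  All notions below concern a self-map of a set \<open>S\<close> that is represented by a total HOL function;
  only the values on \<open>S\<close> matter, provided \<open>f\<close> maps \<open>S\<close> into itself.
\<close>

subsection \<open>Topological entropy (Bowen--Dinaburg)\<close>

definition separated :: "('a::metric_space \<Rightarrow> 'a) \<Rightarrow> nat \<Rightarrow> real \<Rightarrow> 'a set \<Rightarrow> bool" where
  "separated f n \<epsilon> E \<longleftrightarrow>
     (\<forall>x\<in>E. \<forall>y\<in>E. x \<noteq> y \<longrightarrow> (\<exists>k<n. dist ((f ^^ k) x) ((f ^^ k) y) > \<epsilon>))"

text \<open>
  The entropy is \<open>lim\<^bsub>\<epsilon>\<rightarrow>0\<^esub> limsup\<^bsub>n\<rightarrow>\<infinity>\<^esub> (1/n) ln s(n,\<epsilon>)\<close>, where \<open>s(n,\<epsilon>)\<close> is the maximal cardinality of an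
  \<open>(n,\<epsilon>)\<close>-separated subset of \<open>S\<close>. The limit in \<open>\<epsilon>\<close> is a supremum by monotonicity, and the supremum
  over \<open>E\<close> equals \<open>(1/n) ln s(n,\<epsilon>)\<close>. The set \<open>E = {}\<close> is harmless, because \<open>ln 0 = 0 = ln 1\<close> in HOL.
  Values are extended reals, since the entropy of a continuous map may be infinite.
\<close>

definition topological_entropy :: "'a::metric_space set \<Rightarrow> ('a \<Rightarrow> 'a) \<Rightarrow> ereal" where
  "topological_entropy S f =
     (SUP \<epsilon>\<in>{0::real<..}. limsup (\<lambda>n.
        SUP E\<in>{E. E \<subseteq> S \<and> finite E \<and> separated f n \<epsilon> E}. ereal (ln (real (card E)) / real n)))"

subsection \<open>Transitivity, piecewise monotonicity, constant slope, conjugacy\<close>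

definition transitive_map :: "'a::topological_space set \<Rightarrow> ('a \<Rightarrow> 'a) \<Rightarrow> bool" where
  "transitive_map S f \<longleftrightarrow> (\<exists>x\<in>S. S \<subseteq> closure (range (\<lambda>n. (f ^^ n) x)))"

text \<open>Intervals may be open, closed or half-open, and may be single points.\<close>

definition interval_division :: "real set \<Rightarrow> real set set \<Rightarrow> bool" where
  "interval_division S P \<longleftrightarrow> finite P \<and> partition_on S P \<and> (\<forall>J\<in>P. is_interval J)"

definition piecewise_monotone :: "real set \<Rightarrow> (real \<Rightarrow> real) \<Rightarrow> bool" where
  "piecewise_monotone S f \<longleftrightarrow>
     (\<exists>P. interval_division S P \<and> (\<forall>J\<in>P. mono_on J f \<or> antimono_on J f))"

definition piecewise_affine :: "real set \<Rightarrow> (real \<Rightarrow> real) \<Rightarrow> bool" where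
  "piecewise_affine S g \<longleftrightarrow>
     (\<exists>P. interval_division S P \<and> (\<forall>J\<in>P. \<exists>c d. \<forall>x\<in>J. g x = c * x + d))"

text \<open>The derivative is taken within \<open>S\<close>, i.e. one-sided at the end points of an interval \<open>S\<close>.\<close>

definition constant_slope :: "real set \<Rightarrow> (real \<Rightarrow> real) \<Rightarrow> real \<Rightarrow> bool" where
  "constant_slope S g \<beta> \<longleftrightarrow> piecewise_affine S g \<and>
     (\<forall>x\<in>S. \<forall>D. (g has_real_derivative D) (at x within S) \<longrightarrow> \<bar>D\<bar> = \<beta>)"

definition increasing_homeomorphism :: "real set \<Rightarrow> real set \<Rightarrow> (real \<Rightarrow> real) \<Rightarrow> bool" where
  "increasing_homeomorphism S T \<psi> \<longleftrightarrow> (\<exists>\<phi>. homeomorphism S T \<psi> \<phi>) \<and> strict_mono_on S \<psi>"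

definition conjugate_via ::
  "real set \<Rightarrow> (real \<Rightarrow> real) \<Rightarrow> (real \<Rightarrow> real) \<Rightarrow> (real \<Rightarrow> real) \<Rightarrow> bool" where
  "conjugate_via S f g \<psi> \<longleftrightarrow> (\<forall>x\<in>S. \<psi> (f x) = g (\<psi> x))"

end

theory Submission imports Defs begin

text \<open>
  Let \<open>T\<close> be a finite set cutting \<open>[a,b]\<close> into intervals on which \<open>f\<close> is injective, and let \<open>growth\<close> be the
  exponential growth rate of the number of laps, the intervals into which the preimages of \<open>T\<close> of order
  less than \<open>n\<close> cut \<open>[a,b]\<close>. Transitivity produces a horseshoe, so \<open>growth > 1\<close>. Counting the \<open>n\<close>-th
  preimages of \<open>T\<close> in a set with weights \<open>t\<^sup>n\<close>, normalising and letting \<open>t\<close> tend to \<open>1 / growth\<close> gives a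
  finitely additive set function that \<open>f\<close> scales by \<open>growth\<close>; its distribution function \<open>\<psi>\<close> is the
  conjugacy to a map of constant slope. Since \<open>f\<close> is \<open>growth\<close>-Lipschitz in the coordinate \<open>\<psi>\<close>, its entropy is
  at most \<open>ln growth\<close>; conversely a small Bowen ball of length \<open>m * k\<close> meets at most \<open>3\<^sup>m\<close> laps, so the entropy
  is at least \<open>ln growth - ln 3 / k\<close> for every \<open>k\<close>.

  For uniqueness, let \<open>\<psi>\<close> and \<open>\<theta>\<close> be two conjugacies to maps of slope \<open>\<beta> > 1\<close>, and let \<open>m\<close> be the infimum of the
  ratios of their increments. The difference \<open>\<theta> - m * \<psi>\<close> is monotone and is again scaled by \<open>\<beta>\<close>. If it
  were not constant, its increments would dominate a positive multiple of those of \<open>\<psi>\<close>, contradicting the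
  choice of \<open>m\<close>: an interval of \<open>\<psi>\<close>-length \<open>l\<close> has \<open>O(l * \<beta>\<^sup>n)\<close> laps for large \<open>n\<close>, so most of it
  consists of laps whose image under \<open>f\<^sup>n\<close> has \<open>\<psi>\<close>-length bounded below.
\<close>

subsection \<open>Transitive interval maps\<close>

text \<open>Everything about a conjugacy that matters here is visible in its increments, so
  conjugacies are handled as slope functions: continuous monotone functions whose increments over
  uncut intervals are scaled by a constant. Strictness is left out of the notion, because the
  difference formed in the uniqueness proof may be constant; transitivity restores it, since a flat
  interval forces constancy. Transitivity also excludes flat pieces of \<open>f\<close>, which is
  why laps carry injectivity.

  Two target maps may break at different points, hence the results are proved for an arbitrary
  finite \<open>T\<close>, which is enlarged at the end.

  Both lap estimates lose a constant factor: 3 in the entropy bound, 2 in the count of laps inside a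
  short interval. Blocks of \<open>k\<close> steps make the loss harmless: \<open>ln 3 / k\<close>
  tends to 0, and \<open>c ^ k > 4\<close> outweighs 2.

  The inequality \<open>growth > 1\<close> is what makes single points massless and the distribution
  function continuous, so the horseshoe has to precede the limit construction.\<close>

lemma cut_induct [consumes 2, case_names uncut split]:
  fixes C :: "real set"
  assumes "finite C" "u < v"
    and uncut: "\<And>x y. u \<le> x \<Longrightarrow> x < y \<Longrightarrow> y \<le> v \<Longrightarrow> C \<inter> {x<..<y} = {} \<Longrightarrow> P x y"
    and split: "\<And>x w y. u \<le> x \<Longrightarrow> x < w \<Longrightarrow> w < y \<Longrightarrow> y \<le> v \<Longrightarrow> w \<in> C \<Longrightarrow> P x w \<Longrightarrow> P w y \<Longrightarrow> P x y"
  shows "P u v"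
proof -
  \<comment> \<open>Induction on the number of cut points strictly inside the interval: cut points
    at its ends do not count, so splitting leaves fewer on both sides.\<close>
  have "u \<le> x \<Longrightarrow> x < y \<Longrightarrow> y \<le> v \<Longrightarrow> P x y" for x y
  proof (induction "card (C \<inter> {x<..<y})" arbitrary: x y rule: less_induct)
    case less
    show ?case
    proof (cases "C \<inter> {x<..<y} = {}")
      case True
      then show ?thesis using less uncut by blast
    next
      case False
      then obtain w where w: "w \<in> C" "x < w" "w < y" by auto
      have "card (C \<inter> {x<..<w}) < card (C \<inter> {x<..<y})" "card (C \<inter> {w<..<y}) < card (C \<inter> {x<..<y})"
        using w \<open>finite C\<close> by (auto intro!: psubset_card_mono)
      then show ?thesis using less w by (intro split[of x w y]) auto
    qed
  qed
  then show ?thesis using \<open>u < v\<close> by simp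
qed

text \<open>The orientation is left open so that increasing and decreasing laps are treated alike.
  The open image is recorded as well because cuts are counted in open intervals.\<close>

lemma inj_continuous_image_interval:
  fixes g :: "real \<Rightarrow> real"
  assumes "u < v" "continuous_on {u..v} g" "inj_on g {u..v}"
  obtains p q where "p < q" "(p = g u \<and> q = g v) \<or> (p = g v \<and> q = g u)"
    "g ` {u..v} = {p..q}" "g ` {u<..<v} = {p<..<q}"
proof -
  have seg: "closed_segment u v = {u..v}" "open_segment u v = {u<..<v}"
    using \<open>u < v\<close> by (auto simp: closed_segment_eq_real_ivl open_segment_eq_real_ivl)
  have im: "g ` {u..v} = closed_segment (g u) (g v)" "g ` {u<..<v} = open_segment (g u) (g v)"
    using continuous_injective_image_segment_1[of u v g] continuous_injective_image_open_segment_1[of u v g]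
      assms seg by auto
  have ne: "g u \<noteq> g v" using assms by (auto simp: inj_on_eq_iff)
  show ?thesis
  proof (cases "g u < g v")
    case True
    then show ?thesis using im
      by (intro that[of "g u" "g v"]) (auto simp: closed_segment_eq_real_ivl open_segment_eq_real_ivl)
  next
    case False
    then show ?thesis using im ne
      by (intro that[of "g v" "g u"]) (auto simp: closed_segment_eq_real_ivl open_segment_eq_real_ivl)
  qed
qed

lemma card_separated_le:
  fixes X :: "real set"
  assumes "finite X" "X \<subseteq> {c..d}" "c \<le> d" "\<delta> > 0"
    and sep: "\<And>x y. x \<in> X \<Longrightarrow> y \<in> X \<Longrightarrow> x < y \<Longrightarrow> \<delta> \<le> y - x"
  shows "real (card X) \<le> (d - c) / \<delta> + 1"
proof -
  \<comment> \<open>Cells of length \<open>\<delta>\<close>: points at least \<open>\<delta>\<close>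
    apart fall into different cells.\<close>
  define h where "h = (\<lambda>x. \<lfloor>(x - c) / \<delta>\<rfloor>)"
  have less: "h x < h y" if "x \<in> X" "y \<in> X" "x < y" for x y
  proof -
    have "(x - c) / \<delta> + 1 \<le> (y - c) / \<delta>"
      using divide_right_mono[of \<delta> "y - x" \<delta>] sep[OF that] \<open>\<delta> > 0\<close> by (simp add: diff_divide_distrib)
    then show ?thesis unfolding h_def by linarith
  qed
  have inj: "inj_on h X" using less by (intro linorder_inj_onI) force+
  have "h ` X \<subseteq> {0..\<lfloor>(d - c) / \<delta>\<rfloor>}"
  proof (safe)
    fix x assume "x \<in> X"
    then have "0 \<le> (x - c) / \<delta>" "(x - c) / \<delta> \<le> (d - c) / \<delta>"
      using assms(2,4) by (auto simp: divide_right_mono)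
    then show "h x \<in> {0..\<lfloor>(d - c) / \<delta>\<rfloor>}" by (simp add: h_def floor_mono)
  qed
  then have "card X \<le> card {0..\<lfloor>(d - c) / \<delta>\<rfloor>}"
    by (intro card_inj_on_le[OF inj]) auto
  also have "\<dots> = nat (\<lfloor>(d - c) / \<delta>\<rfloor> + 1)" by simp
  finally have "card X \<le> nat (\<lfloor>(d - c) / \<delta>\<rfloor> + 1)" .
  moreover have "0 \<le> \<lfloor>(d - c) / \<delta>\<rfloor>" using assms(3,4) by simp
  ultimately have "int (card X) \<le> \<lfloor>(d - c) / \<delta>\<rfloor> + 1" by linarith
  then show ?thesis by linarith
qed

lemma funpow_split: "m \<le> k \<Longrightarrow> (f ^^ k) x = (f ^^ (k - m)) ((f ^^ m) x)"
  using funpow_add[of "k - m" m f] by simp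

locale interval_map =
  fixes a b :: real and f :: "real \<Rightarrow> real"
  assumes less: "a < b" and maps: "f \<in> {a..b} \<rightarrow> {a..b}" and cont: "continuous_on {a..b} f"
begin

lemma iter_in: "x \<in> {a..b} \<Longrightarrow> (f ^^ n) x \<in> {a..b}"
  using maps by (induction n) auto

lemma continuous_iter: "continuous_on {a..b} (f ^^ n)"
proof (induction n)
  case (Suc n)
  then show ?case
    using iter_in continuous_on_compose[of "{a..b}" "f ^^ n" f] continuous_on_subset[OF cont]
    by (auto simp: image_subset_iff)
qed (simp add: id_def)

lemma continuous_iter_sub: "a \<le> u \<Longrightarrow> v \<le> b \<Longrightarrow> continuous_on {u..v} (f ^^ n)"
  by (rule continuous_on_subset[OF continuous_iter]) auto

end

locale transitive_interval_map = interval_map +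
  assumes trans: "transitive_map {a..b} f"
begin

text \<open>An open interval is infinite and stays open when finitely many points are removed, so a
  dense orbit cannot meet it only finitely often.\<close>

lemma dense_orbit_obtain:
  obtains x0 where "x0 \<in> {a..b}"
    "\<And>c d. a \<le> c \<Longrightarrow> c < d \<Longrightarrow> d \<le> b \<Longrightarrow> infinite {n. (f ^^ n) x0 \<in> {c<..<d}}"
proof -
  obtain x0 where x0: "x0 \<in> {a..b}" "{a..b} \<subseteq> closure (range (\<lambda>n. (f ^^ n) x0))"
    using trans unfolding transitive_map_def by blast
  have "infinite {n. (f ^^ n) x0 \<in> {c<..<d}}" if "a \<le> c" "c < d" "d \<le> b" for c d
  proof
    assume "finite {n. (f ^^ n) x0 \<in> {c<..<d}}"
    then have fin: "finite ((\<lambda>n. (f ^^ n) x0) ` {n. (f ^^ n) x0 \<in> {c<..<d}})" (is "finite ?R") by simp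
    have "{c<..<d} \<subseteq> ?R"
    proof
      fix y assume y: "y \<in> {c<..<d}"
      show "y \<in> ?R"
      proof (rule ccontr)
        assume "y \<notin> ?R"
        have "open ({c<..<d} - ?R)" using fin by (intro open_Diff finite_imp_closed) auto
        moreover have "y \<in> {c<..<d} - ?R" using y \<open>y \<notin> ?R\<close> by auto
        moreover have "y \<in> closure (range (\<lambda>n. (f ^^ n) x0))" using x0 y that by auto
        ultimately have "({c<..<d} - ?R) \<inter> range (\<lambda>n. (f ^^ n) x0) \<noteq> {}"
          using open_Int_closure_eq_empty by blast
        then show False by auto
      qed
    qed
    then have "finite {c<..<d}" using fin finite_subset by blast
    then show False using \<open>c < d\<close> by (simp add: infinite_Ioo)
  qed
  then show ?thesis using that x0 by blast
qed

text \<open>A single orbit visits both intervals infinitely often; the visit to the target is chosen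
  more than \<open>N\<close> steps after one to the source.\<close>

lemma topologically_transitive:
  assumes "a \<le> u" "u < v" "v \<le> b" "a \<le> c" "c < d" "d \<le> b"
  obtains n x where "n > N" "x \<in> {u<..<v}" "(f ^^ n) x \<in> {c<..<d}"
proof -
  obtain x0 where x0: "x0 \<in> {a..b}"
    "\<And>c d. a \<le> c \<Longrightarrow> c < d \<Longrightarrow> d \<le> b \<Longrightarrow> infinite {n. (f ^^ n) x0 \<in> {c<..<d}}"
    using dense_orbit_obtain by blast
  obtain m where m: "(f ^^ m) x0 \<in> {u<..<v}"
    using x0(2)[of u v] assms not_finite_existsD by auto
  obtain k where k: "k > m + N" "(f ^^ k) x0 \<in> {c<..<d}"
    using x0(2)[of c d] assms unfolding infinite_nat_iff_unbounded by auto
  then have "(f ^^ (k - m)) ((f ^^ m) x0) = (f ^^ k) x0"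
    by (intro funpow_split[symmetric]) auto
  then show ?thesis using that[of "k - m" "(f ^^ m) x0"] k m by auto
qed

lemma no_invariant_interval:
  assumes "a \<le> u" "u < v" "v \<le> b" "f ` {u..v} \<subseteq> {u..v}"
  shows "u = a \<and> v = b"
proof (rule ccontr)
  assume *: "\<not> (u = a \<and> v = b)"
  have inv: "(f ^^ n) x \<in> {u..v}" if "x \<in> {u..v}" for n x
  proof (induction n)
    case (Suc n)
    then show ?case using assms(4) by (simp add: image_subset_iff)
  qed (use that in simp)
  have "a < u \<or> v < b" using * assms by auto
  then obtain c d where cd: "a \<le> c" "c < d" "d \<le> b" "{c<..<d} \<inter> {u..v} = {}"
  proof
    assume "a < u" then show ?thesis using assms by (intro that[of a u]) auto
  next
    assume "v < b" then show ?thesis using assms by (intro that[of v b]) auto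
  qed
  then obtain n x where "x \<in> {u<..<v}" "(f ^^ n) x \<in> {c<..<d}"
    using topologically_transitive[OF assms(1-3), of c d 0] by blast
  then show False using inv[of x n] cd by auto
qed

lemma iterates_of_interval_dense:
  assumes "a \<le> u" "u < v" "v \<le> b" "open U" "x \<in> U" "x \<in> {a..b}"
  obtains n y where "y \<in> {u<..<v}" "(f ^^ n) y \<in> U"
proof -
  obtain e where e: "e > 0" "ball x e \<subseteq> U" using assms openE by blast
  define c d where "c = max a (x - e)" and "d = min b (x + e)"
  have "a \<le> c" "c < d" "d \<le> b" using less e assms by (auto simp: c_def d_def)
  then obtain n y where "y \<in> {u<..<v}" "(f ^^ n) y \<in> {c<..<d}"
    using topologically_transitive[OF assms(1-3), of c d 0] by blast
  moreover have "{c<..<d} \<subseteq> U" using e by (auto simp: c_def d_def dist_real_def subset_iff)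
  ultimately show ?thesis using that by blast
qed

text \<open>The values of \<open>\<phi>\<close> on the intervals \<open>f\<^sup>i [u,v]\<close> are periodic in \<open>i\<close>, because \<open>[u,v]\<close> meets one of its
  images; so \<open>\<phi>\<close> takes finitely many values on a dense set.\<close>

lemma constant_if_locally_constant:
  fixes \<phi> :: "real \<Rightarrow> real"
  assumes "continuous_on {a..b} \<phi>"
    and lip: "\<And>x y. x \<in> {a..b} \<Longrightarrow> y \<in> {a..b} \<Longrightarrow> \<bar>\<phi> (f x) - \<phi> (f y)\<bar> \<le> C * \<bar>\<phi> x - \<phi> y\<bar>"
    and uv: "a \<le> u" "u < v" "v \<le> b" and const: "\<And>x. x \<in> {u..v} \<Longrightarrow> \<phi> x = c"
    and xy: "x \<in> {a..b}" "y \<in> {a..b}"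
  shows "\<phi> x = \<phi> y"
proof -
  obtain p z where p: "p > 0" "z \<in> {u<..<v}" "(f ^^ p) z \<in> {u<..<v}"
    using topologically_transitive[of u v u v 0] uv by auto
  have eq: "\<phi> ((f ^^ i) x) = \<phi> ((f ^^ i) y)" if "x \<in> {u..v}" "y \<in> {u..v}" for i x y
  proof (induction i)
    case 0
    then show ?case using const that by simp
  next
    case (Suc i)
    have "x \<in> {a..b}" "y \<in> {a..b}" using that uv by auto
    then show ?case using lip[of "(f ^^ i) x" "(f ^^ i) y"] Suc iter_in by simp
  qed
  have per: "\<phi> ((f ^^ (i + p)) z) = \<phi> ((f ^^ i) z)" for i
    using eq[of "(f ^^ p) z" z i] p by (simp add: funpow_add)
  define V where "V = (\<lambda>i. \<phi> ((f ^^ i) z)) ` {..<p}"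
  have inV: "\<phi> ((f ^^ i) z) \<in> V" for i
  proof (induction i rule: less_induct)
    case (less i)
    show ?case
    proof (cases "i < p")
      case False
      then show ?thesis using less[of "i - p"] per[of "i - p"] p by auto
    qed (auto simp: V_def)
  qed
  have finV: "finite V" by (simp add: V_def)
  have "\<phi> w \<in> V" if "w \<in> {a..b}" for w
  proof (rule ccontr)
    assume "\<phi> w \<notin> V"
    have "open (- V)" using finV by (intro open_Compl finite_imp_closed)
    then obtain A where A: "open A" "A \<inter> {a..b} = \<phi> -` (- V) \<inter> {a..b}"
      using assms(1) continuous_on_open_invariant[of "{a..b}" \<phi>] by meson
    have "w \<in> \<phi> -` (- V) \<inter> {a..b}" using that \<open>\<phi> w \<notin> V\<close> by simp
    then have "w \<in> A" by (metis A(2) IntD1)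
    then obtain n y where y: "y \<in> {u<..<v}" "(f ^^ n) y \<in> A"
      using iterates_of_interval_dense[OF uv A(1) _ \<open>w \<in> {a..b}\<close>] by blast
    have "(f ^^ n) y \<in> {a..b}" using y uv iter_in by auto
    then have "(f ^^ n) y \<in> \<phi> -` (- V)" using y(2) by (metis A(2) IntD1 IntI)
    then have "\<phi> ((f ^^ n) y) \<notin> V" by simp
    moreover have "\<phi> ((f ^^ n) y) = \<phi> ((f ^^ n) z)" using y p by (intro eq) auto
    ultimately show False using inV by simp
  qed
  then have "\<phi> ` {a..b} \<subseteq> V" by blast
  moreover note finV
  moreover have "connected (\<phi> ` {a..b})" using assms(1) by (intro connected_continuous_image) auto
  ultimately have "\<phi> ` {a..b} = {} \<or> (\<exists>c. \<phi> ` {a..b} = {c})"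
    using connected_finite_iff_sing[of "\<phi> ` {a..b}"] finite_subset by blast
  then show ?thesis using xy by (metis image_eqI empty_iff singletonD)
qed

text \<open>If \<open>f ^^ n\<close> were constant on an interval, two visits of the dense orbit to
  it would merge \<open>n\<close> steps later. The orbit would then be eventually periodic, hence
  finite, and would miss an open interval.\<close>

lemma nonconstant_iter:
  assumes uv: "a \<le> u" "u < v" "v \<le> b"
  shows "\<exists>x\<in>{u..v}. \<exists>y\<in>{u..v}. (f ^^ n) x \<noteq> (f ^^ n) y"
proof (rule ccontr)
  assume "\<not> ?thesis"
  then have const: "\<And>x y. x \<in> {u..v} \<Longrightarrow> y \<in> {u..v} \<Longrightarrow> (f ^^ n) x = (f ^^ n) y" by blast
  obtain x0 where x0: "x0 \<in> {a..b}"
    "\<And>c d. a \<le> c \<Longrightarrow> c < d \<Longrightarrow> d \<le> b \<Longrightarrow> infinite {n. (f ^^ n) x0 \<in> {c<..<d}}"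
    using dense_orbit_obtain by blast
  obtain i where i: "(f ^^ i) x0 \<in> {u<..<v}"
    using x0(2)[of u v] uv not_finite_existsD by auto
  obtain j where j: "j > i" "(f ^^ j) x0 \<in> {u<..<v}"
    using x0(2)[of u v] uv unfolding infinite_nat_iff_unbounded by auto
  have "(f ^^ n) ((f ^^ i) x0) = (f ^^ n) ((f ^^ j) x0)" using i j by (intro const) auto
  then have eq: "(f ^^ (n + i)) x0 = (f ^^ (n + j)) x0" by (simp add: funpow_add)
  define R where "R = (\<lambda>k. (f ^^ k) x0) ` {..<n + j}"
  have "(f ^^ k) x0 \<in> R" for k
  proof (induction k rule: less_induct)
    case (less k)
    show ?case
    proof (cases "k < n + j")
      case False
      then have "(f ^^ k) x0 = (f ^^ (k - (n + j))) ((f ^^ (n + j)) x0)"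
        by (intro funpow_split) auto
      also have "\<dots> = (f ^^ (k - (n + j))) ((f ^^ (n + i)) x0)" by (simp only: eq)
      also have "\<dots> = (f ^^ (k - (n + j) + (n + i))) x0" by (simp add: funpow_add)
      also have "\<dots> \<in> R" using False j less by auto
      finally show ?thesis .
    qed (auto simp: R_def)
  qed
  moreover have "finite R" by (simp add: R_def)
  ultimately have "\<And>k. (f ^^ k) x0 \<in> R" and "finite R" by auto
  have "infinite ({a<..<b} - R)" using less \<open>finite R\<close> by (simp add: infinite_Ioo)
  then obtain y where "y \<in> {a<..<b} - R" using infinite_imp_nonempty by blast
  moreover have "open ({a<..<b} - R)" using \<open>finite R\<close> by (intro open_Diff finite_imp_closed) auto
  ultimately obtain e where e: "e > 0" "ball y e \<subseteq> {a<..<b} - R" using openE by blast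
  define d where "d = min (y + e / 2) b"
  have "y \<in> {a<..<b}" using e by (metis Diff_iff centre_in_ball subsetD)
  then have yd: "a \<le> y" "y < d" "d \<le> b" "{y<..<d} \<subseteq> ball y e"
    using e by (auto simp: d_def dist_real_def)
  obtain k where "(f ^^ k) x0 \<in> {y<..<d}"
    using x0(2)[OF yd(1-3)] not_finite_existsD by auto
  then show False using yd e \<open>\<And>k. (f ^^ k) x0 \<in> R\<close> by blast
qed

text \<open>The image of the whole interval is forward invariant, so
  \<open>no_invariant_interval\<close> applies once \<open>nonconstant_iter\<close> shows that it is
  not a point.\<close>

lemma surj: "f ` {a..b} = {a..b}"
proof -
  have "\<exists>u v. f ` {a..b} = {u..v} \<and> u \<le> v" using less cont
    by (metis continuous_image_closed_interval less_imp_le)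
  then obtain u v where uv: "f ` {a..b} = {u..v}" "u \<le> v" by blast
  then have "{u..v} \<subseteq> {a..b}" using maps by (metis funcset_image)
  then have sub: "a \<le> u" "v \<le> b" using uv(2) by auto
  have "u \<noteq> v"
  proof
    assume "u = v"
    then have "x \<in> {a..b} \<Longrightarrow> f x = u" for x using uv by auto
    then show False using nonconstant_iter[of a b 1] less by auto
  qed
  then have "u < v" using uv by simp
  moreover have "f ` {u..v} \<subseteq> {u..v}" using sub uv by (metis atLeastatMost_subset_iff image_mono)
  ultimately show ?thesis using no_invariant_interval[of u v] sub uv by auto
qed

end

subsection \<open>Lap numbers\<close>

text \<open>Only injectivity between cuts is demanded, so every finite superset of \<open>T\<close>
  qualifies again.\<close>

locale cut_interval_map = transitive_interval_map +
  fixes T :: "real set"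
  assumes finite_T: "finite T"
    and inj_uncut: "\<And>u v. a \<le> u \<Longrightarrow> u < v \<Longrightarrow> v \<le> b \<Longrightarrow> T \<inter> {u<..<v} = {} \<Longrightarrow> inj_on f {u..v}"
begin

definition cuts :: "nat \<Rightarrow> real set" where
  "cuts n = {x \<in> {a..b}. \<exists>i<n. (f ^^ i) x \<in> T}"

definition laps :: "nat \<Rightarrow> real \<Rightarrow> real \<Rightarrow> nat" where
  "laps n u v = Suc (card (cuts n \<inter> {u<..<v}))"

lemma cuts_add: "cuts (m + n) = cuts m \<union> {x \<in> {a..b}. (f ^^ m) x \<in> cuts n}"
proof (intro set_eqI iffI)
  fix x assume x: "x \<in> cuts (m + n)"
  then obtain i where i: "i < m + n" "(f ^^ i) x \<in> T" and xI: "x \<in> {a..b}" by (auto simp: cuts_def)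
  show "x \<in> cuts m \<union> {x \<in> {a..b}. (f ^^ m) x \<in> cuts n}"
  proof (cases "i < m")
    case True
    then show ?thesis using i xI by (auto simp: cuts_def)
  next
    case False
    then have "(f ^^ (i - m)) ((f ^^ m) x) \<in> T" using i funpow_split[of m i f x] by simp
    then have "(f ^^ m) x \<in> cuts n" using iter_in[OF xI, of m] i False by (auto simp: cuts_def intro!: exI[of _ "i - m"])
    then show ?thesis using xI by simp
  qed
next
  fix x assume "x \<in> cuts m \<union> {x \<in> {a..b}. (f ^^ m) x \<in> cuts n}"
  then consider "x \<in> cuts m" | "x \<in> {a..b}" "(f ^^ m) x \<in> cuts n" by blast
  then show "x \<in> cuts (m + n)"
  proof cases
    case 1
    then obtain i where "x \<in> {a..b}" "i < m" "(f ^^ i) x \<in> T" by (auto simp: cuts_def)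
    then show ?thesis by (auto simp: cuts_def intro!: exI[of _ i])
  next
    case 2
    then obtain i where "i < n" "(f ^^ i) ((f ^^ m) x) \<in> T" by (auto simp: cuts_def)
    then have "m + i < m + n" "(f ^^ (m + i)) x \<in> T" using funpow_add[of i m f] by (simp_all add: add.commute)
    then show ?thesis using 2 unfolding cuts_def by blast
  qed
qed

lemma cuts_Suc_0: "cuts (Suc 0) = T \<inter> {a..b}"
  by (auto simp: cuts_def)

lemma cuts_0: "cuts 0 = {}"
  by (auto simp: cuts_def)

lemma finite_preimage: "finite S \<Longrightarrow> finite {x \<in> {a..b}. (f ^^ n) x \<in> S}"
proof (induction n arbitrary: S)
  case (Suc n)
  have "v \<le> b \<longrightarrow> a \<le> u \<longrightarrow> finite {x \<in> {u..v}. f x \<in> S}" if "u < v" for u v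
    using finite_T that
  proof (induction rule: cut_induct)
    case (uncut x y)
    show ?case
    proof (intro impI)
      assume "y \<le> b" "a \<le> x"
      then have "inj_on f {x..y}" using uncut inj_uncut by blast
      then have "finite (f -` S \<inter> {x..y})" using Suc.prems by (rule finite_vimage_IntI[rotated])
      then show "finite {z \<in> {x..y}. f z \<in> S}" by (rule rev_finite_subset) auto
    qed
  next
    case (split x w y)
    have eq: "{z \<in> {x..y}. f z \<in> S} = {z \<in> {x..w}. f z \<in> S} \<union> {z \<in> {w..y}. f z \<in> S}" using split by auto
    show ?case unfolding eq using split by auto
  qed
  then have fin: "finite {x \<in> {a..b}. f x \<in> S}" using less by simp
  have "{x \<in> {a..b}. (f ^^ Suc n) x \<in> S} = {x \<in> {a..b}. (f ^^ n) x \<in> {x \<in> {a..b}. f x \<in> S}}"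
    using iter_in by auto
  then show ?case using Suc.IH[OF fin] by simp
qed auto

lemma finite_cuts: "finite (cuts n)"
proof -
  have "cuts n = (\<Union>i<n. {x \<in> {a..b}. (f ^^ i) x \<in> T})" by (auto simp: cuts_def)
  then show ?thesis using finite_preimage[OF finite_T] by simp
qed

lemma laps_split:
  assumes "w \<in> cuts n" "u < w" "w < v"
  shows "laps n u v = laps n u w + laps n w v"
proof -
  have "cuts n \<inter> {u<..<v} = insert w (cuts n \<inter> {u<..<w} \<union> cuts n \<inter> {w<..<v})"
    using assms by auto
  moreover have "card (insert w (cuts n \<inter> {u<..<w} \<union> cuts n \<inter> {w<..<v})) =
      Suc (card (cuts n \<inter> {u<..<w} \<union> cuts n \<inter> {w<..<v}))"
    using finite_cuts by (intro card_insert_disjoint) auto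
  moreover have "card (cuts n \<inter> {u<..<w} \<union> cuts n \<inter> {w<..<v}) =
      card (cuts n \<inter> {u<..<w}) + card (cuts n \<inter> {w<..<v})"
    using finite_cuts by (intro card_Un_disjoint) auto
  ultimately show ?thesis by (simp add: laps_def)
qed

lemma iter_image: "a \<le> u \<Longrightarrow> v \<le> b \<Longrightarrow> (f ^^ n) ` {u..v} \<subseteq> {a..b}"
  using iter_in[of _ n] by (simp add: image_subset_iff)

lemma inj_on_iter:
  assumes "a \<le> u" "u < v" "v \<le> b" "cuts n \<inter> {u<..<v} = {}"
  shows "inj_on (f ^^ n) {u..v}"
  using assms(4)
proof (induction n)
  case (Suc n)
  have un: "cuts n \<inter> {u<..<v} = {}" "{x \<in> {a..b}. (f ^^ n) x \<in> T} \<inter> {u<..<v} = {}"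
  proof -
    have "cuts n \<subseteq> cuts (Suc n)" "{x \<in> {a..b}. (f ^^ n) x \<in> T} \<subseteq> cuts (Suc n)"
      by (force simp: cuts_def less_Suc_eq)+
    then show "cuts n \<inter> {u<..<v} = {}" "{x \<in> {a..b}. (f ^^ n) x \<in> T} \<inter> {u<..<v} = {}"
      using Suc.prems by blast+
  qed
  then have inj: "inj_on (f ^^ n) {u..v}" using Suc by blast
  obtain p q where pq: "p < q" and "(p = (f ^^ n) u \<and> q = (f ^^ n) v) \<or> (p = (f ^^ n) v \<and> q = (f ^^ n) u)"
    and im: "(f ^^ n) ` {u..v} = {p..q}" "(f ^^ n) ` {u<..<v} = {p<..<q}"
    by (rule inj_continuous_image_interval[OF \<open>u < v\<close> continuous_iter_sub[OF assms(1,3)] inj])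
  have "{p..q} \<subseteq> {a..b}" using iter_image[OF assms(1,3), of n] im(1) by simp
  then have "a \<le> p" "q \<le> b" using \<open>p < q\<close> by auto
  moreover have "T \<inter> {p<..<q} = {}"
  proof -
    have "(f ^^ n) x \<notin> T" if "x \<in> {u<..<v}" for x
    proof -
      have "x \<in> {a..b}" using that assms by auto
      then show ?thesis using un(2) that by blast
    qed
    then show ?thesis unfolding im(2)[symmetric] by auto
  qed
  ultimately have "inj_on f ((f ^^ n) ` {u..v})" using inj_uncut pq im(1) by simp
  then show ?case using comp_inj_on[OF inj] by (simp add: o_def)
qed auto

text \<open>Without cuts of order \<open>m\<close>, \<open>f ^^ m\<close> is injective on the
  interval and carries cuts of order \<open>m + n\<close> to cuts of order \<open>n\<close>. Lapwise
  estimates read lengths and lap counts off the image by means of this lemma.\<close>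

lemma uncut_image:
  assumes uv: "a \<le> u" "u < v" "v \<le> b" "cuts m \<inter> {u<..<v} = {}"
  obtains p q where "p < q" "a \<le> p" "q \<le> b"
    "(p = (f ^^ m) u \<and> q = (f ^^ m) v) \<or> (p = (f ^^ m) v \<and> q = (f ^^ m) u)"
    "(f ^^ m) ` {u..v} = {p..q}" "(f ^^ m) ` {u<..<v} = {p<..<q}"
    "\<forall>n. laps (m + n) u v = laps n p q"
proof -
  note inj = inj_on_iter[OF uv]
  obtain p q where pq: "p < q" "(p = (f ^^ m) u \<and> q = (f ^^ m) v) \<or> (p = (f ^^ m) v \<and> q = (f ^^ m) u)"
      "(f ^^ m) ` {u..v} = {p..q}" "(f ^^ m) ` {u<..<v} = {p<..<q}"
    by (rule inj_continuous_image_interval[OF \<open>u < v\<close> continuous_iter_sub[OF uv(1,3)] inj])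
  have "{p..q} \<subseteq> {a..b}" using iter_image[OF uv(1,3), of m] pq(3) by simp
  then have ab: "a \<le> p" "q \<le> b" using \<open>p < q\<close> by auto
  have "laps (m + n) u v = laps n p q" for n
  proof -
    have "(f ^^ m) ` (cuts (m + n) \<inter> {u<..<v}) = cuts n \<inter> {p<..<q}"
    proof -
      have "cuts (m + n) \<inter> {u<..<v} = {x \<in> {u<..<v}. (f ^^ m) x \<in> cuts n}"
        using uv by (auto simp: cuts_add)
      then show ?thesis unfolding pq(4)[symmetric] by auto
    qed
    moreover have "inj_on (f ^^ m) (cuts (m + n) \<inter> {u<..<v})"
      by (rule inj_on_subset[OF inj]) auto
    ultimately show ?thesis unfolding laps_def by (metis card_image)
  qed
  then show ?thesis using that pq ab by blast
qed

lemma laps_pos: "0 < laps n u v"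
  by (simp add: laps_def)

lemma laps_mono: "a \<le> u \<Longrightarrow> v \<le> b \<Longrightarrow> laps n u v \<le> laps n a b"
  using finite_cuts by (auto simp: laps_def intro!: card_mono)

lemma laps_uncut: "cuts n \<inter> {u<..<v} = {} \<Longrightarrow> laps n u v = 1"
  by (simp add: laps_def)

text \<open>Each lap of order \<open>m\<close> is mapped injectively into \<open>{a..b}\<close>,
  where the next \<open>n\<close> steps produce at most \<open>laps n a b\<close> pieces.\<close>

lemma laps_add_le:
  assumes "a \<le> u" "u < v" "v \<le> b"
  shows "laps (m + n) u v \<le> laps m u v * laps n a b"
proof -
  have "a \<le> u \<longrightarrow> v \<le> b \<longrightarrow> laps (m + n) u v \<le> laps m u v * laps n a b"
    using finite_cuts[of m] \<open>u < v\<close>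
  proof (induction rule: cut_induct)
    case (uncut x y)
    show ?case
    proof (intro impI)
      assume "a \<le> x" "y \<le> b"
      then obtain p q where "a \<le> p" "q \<le> b" "laps (m + n) x y = laps n p q"
        using uncut_image[OF \<open>a \<le> x\<close> uncut(2) \<open>y \<le> b\<close> uncut(4)] by (smt (verit))
      then show "laps (m + n) x y \<le> laps m x y * laps n a b"
        using laps_mono laps_uncut[OF uncut(4)] by simp
    qed
  next
    case (split x w y)
    have "w \<in> cuts (m + n)" using split by (auto simp: cuts_add)
    then show ?case using split laps_split[of w m x y] laps_split[of w "m + n" x y]
      by (auto simp: algebra_simps)
  qed
  then show ?thesis using assms by simp
qed

lemma card_preimage_le_laps:
  assumes "a \<le> u" "u < v" "v \<le> b"
  shows "card {x \<in> {u..v}. (f ^^ n) x = c} \<le> laps n u v"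
proof -
  have "a \<le> u \<longrightarrow> v \<le> b \<longrightarrow> card {x \<in> {u..v}. (f ^^ n) x = c} \<le> laps n u v"
    using finite_cuts[of n] \<open>u < v\<close>
  proof (induction rule: cut_induct)
    case (uncut x y)
    show ?case
    proof (intro impI)
      assume "a \<le> x" "y \<le> b"
      then have "inj_on (f ^^ n) {x..y}" using inj_on_iter uncut by blast
      then have "\<exists>z. {w \<in> {x..y}. (f ^^ n) w = c} \<subseteq> {z}" unfolding inj_on_def by blast
      then have "card {w \<in> {x..y}. (f ^^ n) w = c} \<le> 1" by (metis card_mono finite.emptyI finite_insert is_singletonI is_singleton_altdef)
      then show "card {w \<in> {x..y}. (f ^^ n) w = c} \<le> laps n x y"
        using laps_pos[of n x y] by linarith
    qed
  next
    case (split x w y)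
    have eq: "{z \<in> {x..y}. (f ^^ n) z = c} = {z \<in> {x..w}. (f ^^ n) z = c} \<union> {z \<in> {w..y}. (f ^^ n) z = c}"
      using split by auto
    have "card {z \<in> {x..y}. (f ^^ n) z = c} \<le>
        card {z \<in> {x..w}. (f ^^ n) z = c} + card {z \<in> {w..y}. (f ^^ n) z = c}"
      unfolding eq by (rule card_Un_le)
    then show ?case using split laps_split[of w n x y] by auto
  qed
  then show ?thesis using assms by simp
qed

text \<open>By submultiplicativity (Fekete) this is the limit of the roots. In the form of an
  infimum it bounds every lap number from below at once, see \<open>growth_power_le\<close>.\<close>

definition growth :: real where
  "growth = (INF n\<in>{1..}. root n (real (laps n a b)))"

lemma bdd_below_root_laps: "bdd_below ((\<lambda>n. root n (real (laps n a b))) ` {1..})"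
  by (intro bdd_belowI[of _ 0]) (auto intro!: real_root_ge_zero)

lemma growth_ge:
  assumes "\<And>n. n \<ge> 1 \<Longrightarrow> c \<le> root n (real (laps n a b))"
  shows "c \<le> growth"
  unfolding growth_def using assms by (intro cINF_greatest) auto

lemma growth_power_le: "growth ^ n \<le> real (laps n a b)"
proof (cases "n = 0")
  case True
  then show ?thesis using laps_pos[of 0 a b] by (simp add: Suc_leI)
next
  case False
  have "0 \<le> growth" by (rule growth_ge) (auto intro!: real_root_ge_zero)
  moreover have "growth \<le> root n (real (laps n a b))"
    unfolding growth_def using False by (intro cINF_lower bdd_below_root_laps) auto
  ultimately have "growth ^ n \<le> root n (real (laps n a b)) ^ n" by (intro power_mono)
  then show ?thesis using False by simp
qed

lemma laps_mult_le: "laps (m * n) a b \<le> laps n a b ^ m"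
proof (induction m)
  case 0
  then show ?case using laps_uncut[of 0 a b] by (simp add: cuts_0)
next
  case (Suc m)
  have "laps (Suc m * n) a b \<le> laps n a b * laps (m * n) a b"
    using laps_add_le[of a b n "m * n"] less by simp
  also have "\<dots> \<le> laps n a b * laps n a b ^ m" using Suc by simp
  finally show ?case by simp
qed

text \<open>The two branches double the number of preimages of a point at each return, and
  \<open>f ^^ n\<close> has at most one preimage of a point in each lap.\<close>

lemma horseshoe_growth:
  assumes "J \<subseteq> {a..b}" "J1 \<subseteq> J" "J2 \<subseteq> J" "J1 \<inter> J2 = {}" "J \<noteq> {}"
    and m: "m1 > 0" "m2 > 0" "J \<subseteq> (f ^^ m1) ` J1" "J \<subseteq> (f ^^ m2) ` J2"
  shows "growth > 1"
proof -
  have cover: "J \<subseteq> (f ^^ (m * Suc i)) ` K" if "J \<subseteq> (f ^^ m) ` K" "K \<subseteq> J" for m i K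
  proof (induction i)
    case (Suc i)
    have "J \<subseteq> (f ^^ (m * Suc i)) ` J" using Suc that by blast
    also have "\<dots> \<subseteq> (f ^^ (m * Suc i)) ` ((f ^^ m) ` K)" using that by blast
    also have "\<dots> = (f ^^ (m * Suc (Suc i))) ` K"
      using funpow_add[of "m * Suc i" m f] by (simp add: image_comp add.commute)
    finally show ?case .
  qed (use that in simp)
  \<comment> \<open>The return times may differ; their product is a return time for both
    branches.\<close>
  define N where "N = m1 * m2"
  have "N > 0" using m by (simp add: N_def)
  have c1: "J \<subseteq> (f ^^ N) ` J1" using cover[of m1 J1 "m2 - 1"] assms by (simp add: N_def)
  have c2: "J \<subseteq> (f ^^ N) ` J2" using cover[of m2 J2 "m1 - 1"] assms by (simp add: N_def mult.commute)
  have "\<forall>x\<in>J. \<exists>y\<in>J1. (f ^^ N) y = x" using c1 by (auto simp: image_def)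
  then obtain s1 where s1: "\<And>x. x \<in> J \<Longrightarrow> s1 x \<in> J1 \<and> (f ^^ N) (s1 x) = x" by metis
  have "\<forall>x\<in>J. \<exists>y\<in>J2. (f ^^ N) y = x" using c2 by (auto simp: image_def)
  then obtain s2 where s2: "\<And>x. x \<in> J \<Longrightarrow> s2 x \<in> J2 \<and> (f ^^ N) (s2 x) = x" by metis
  obtain c where "c \<in> J" using assms by blast
  define X where "X = (\<lambda>q. {x \<in> J. (f ^^ (q * N)) x = c})"
  have finX: "finite (X q)" for q
  proof -
    have "X q \<subseteq> {x \<in> {a..b}. (f ^^ (q * N)) x \<in> {c}}" using assms by (auto simp: X_def)
    then show ?thesis using finite_preimage[of "{c}" "q * N"] finite_subset by blast
  qed
  have X: "2 ^ q \<le> card (X q)" for q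
  proof (induction q)
    case 0
    have "X 0 = {c}" using \<open>c \<in> J\<close> by (auto simp: X_def)
    then show ?case by simp
  next
    case (Suc q)
    have sub: "s1 ` X q \<union> s2 ` X q \<subseteq> X (Suc q)"
    proof -
      have *: "s x \<in> X (Suc q)" if "x \<in> X q" "s x \<in> J" "(f ^^ N) (s x) = x" for s x
        using that by (simp add: X_def add.commute[of N] funpow_add)
      have "s1 x \<in> X (Suc q)" "s2 x \<in> X (Suc q)" if "x \<in> X q" for x
      proof -
        have "x \<in> J" using that by (simp add: X_def)
        then have "s1 x \<in> J" "(f ^^ N) (s1 x) = x" "s2 x \<in> J" "(f ^^ N) (s2 x) = x"
          using s1[of x] s2[of x] assms(2,3) by auto
        then show "s1 x \<in> X (Suc q)" "s2 x \<in> X (Suc q)" using * that by auto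
      qed
      then show ?thesis by blast
    qed
    have inj: "inj_on s1 (X q)" "inj_on s2 (X q)"
      using s1 s2 by (auto intro!: inj_on_inverseI[where g = "f ^^ N"] simp: X_def)
    have "X q \<subseteq> J" by (auto simp: X_def)
    then have "s1 ` X q \<subseteq> J1" "s2 ` X q \<subseteq> J2" using s1 s2 by blast+
    then have "s1 ` X q \<inter> s2 ` X q = {}" using assms(4) by blast
    then have "card (s1 ` X q \<union> s2 ` X q) = card (X q) + card (X q)"
      using finX inj by (simp add: card_Un_disjoint card_image)
    then have "2 * card (X q) \<le> card (X (Suc q))" using card_mono[OF finX sub] by simp
    then show ?case using Suc by simp
  qed
  \<comment> \<open>There are at least \<open>2 ^ n\<close> laps of order \<open>N * n\<close>;
    through \<open>laps_mult_le\<close> this bounds the root at every \<open>n\<close>, as the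
    infimum requires.\<close>
  have "2 powr (1 / N) \<le> growth"
  proof (rule growth_ge)
    fix n :: nat assume "n \<ge> 1"
    have "2 ^ n \<le> card (X n)" by (rule X)
    also have "\<dots> \<le> card {x \<in> {a..b}. (f ^^ (n * N)) x = c}"
    proof (rule card_mono)
      show "finite {x \<in> {a..b}. (f ^^ (n * N)) x = c}" using finite_preimage[of "{c}" "n * N"] by simp
      show "X n \<subseteq> {x \<in> {a..b}. (f ^^ (n * N)) x = c}" using assms by (auto simp: X_def)
    qed
    also have "\<dots> \<le> laps (N * n) a b"
      using card_preimage_le_laps[of a b "n * N" c] less by (simp add: mult.commute)
    also have "\<dots> \<le> laps n a b ^ N" by (rule laps_mult_le)
    finally have "2 ^ n \<le> laps n a b ^ N" .
    then have "(2::real) ^ n \<le> real (laps n a b) ^ N" by (metis of_nat_le_iff of_nat_numeral of_nat_power)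
    then have "((2::real) ^ n) powr (1 / (real n * N)) \<le> (real (laps n a b) ^ N) powr (1 / (real n * N))"
      by (intro powr_mono2) auto
    moreover have "((2::real) ^ n) powr (1 / (real n * N)) = 2 powr (1 / N)"
      using \<open>n \<ge> 1\<close> \<open>N > 0\<close> by (simp add: powr_powr flip: powr_realpow)
    moreover have "(real (laps n a b) ^ N) powr (1 / (real n * N)) = root n (real (laps n a b))"
      using \<open>n \<ge> 1\<close> \<open>N > 0\<close> laps_pos[of n a b]
      by (simp add: powr_powr root_powr_inverse flip: powr_realpow)
    ultimately show "2 powr (1 / N) \<le> root n (real (laps n a b))" by simp
  qed
  moreover have "1 < 2 powr (1 / real N)" using \<open>N > 0\<close> by simp
  ultimately show ?thesis by linarith
qed

end

subsection \<open>Horseshoes\<close>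

context transitive_interval_map
begin

text \<open>A local form of transitivity, needed because \<open>f\<^sup>2\<close> need not be transitive on \<open>[a,b]\<close>.\<close>

definition transitive_on :: "nat \<Rightarrow> real \<Rightarrow> real \<Rightarrow> bool" where
  "transitive_on k c d \<longleftrightarrow> (f ^^ k) ` {c..d} \<subseteq> {c..d} \<and>
     (\<forall>u v c' d'. c \<le> u \<longrightarrow> u < v \<longrightarrow> v \<le> d \<longrightarrow> c \<le> c' \<longrightarrow> c' < d' \<longrightarrow> d' \<le> d \<longrightarrow>
        (\<exists>n. \<exists>x\<in>{u<..<v}. (f ^^ (k * n)) x \<in> {c'<..<d'}))"

lemma transitive_onD:
  assumes "transitive_on k c d" "c \<le> u" "u < v" "v \<le> d" "c \<le> c'" "c' < d'" "d' \<le> d"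
  shows "\<exists>n. \<exists>x\<in>{u<..<v}. (f ^^ (k * n)) x \<in> {c'<..<d'}"
  using assms unfolding transitive_on_def by blast

lemma iter_mult_invariant:
  assumes "(f ^^ k) ` S \<subseteq> S" "x \<in> S"
  shows "(f ^^ (k * n)) x \<in> S"
proof (induction n)
  case (Suc n)
  then show ?case using assms(1) by (simp add: funpow_add image_subset_iff)
qed (use assms in simp)

lemma transitive_on_no_invariant:
  assumes "transitive_on k c d" "c \<le> u" "u < v" "v \<le> d" "(f ^^ k) ` {u..v} \<subseteq> {u..v}"
  shows "u = c \<and> v = d"
proof (rule ccontr)
  assume "\<not> (u = c \<and> v = d)"
  then have "c < u \<or> v < d" using assms by auto
  then obtain c' d' where cd: "c \<le> c'" "c' < d'" "d' \<le> d" "{c'<..<d'} \<inter> {u..v} = {}"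
  proof
    assume "c < u" then show ?thesis using assms by (intro that[of c u]) auto
  next
    assume "v < d" then show ?thesis using assms by (intro that[of v d]) auto
  qed
  then obtain n x where x: "x \<in> {u<..<v}" "(f ^^ (k * n)) x \<in> {c'<..<d'}"
    using transitive_onD[OF assms(1-4) cd(1-3)] by blast
  then have "(f ^^ (k * n)) x \<in> {u..v}" by (intro iter_mult_invariant[OF assms(5)]) auto
  then show False using x cd by auto
qed

text \<open>With \<open>c = 1\<close> it finds fixed points, with \<open>c = 0\<close> prescribed
  values.\<close>

lemma iter_ivt:
  assumes "a \<le> u" "u \<le> v" "v \<le> b"
    and "(f ^^ n) u - c * u \<le> y \<and> y \<le> (f ^^ n) v - c * v \<or> (f ^^ n) v - c * v \<le> y \<and> y \<le> (f ^^ n) u - c * u"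
  obtains w where "u \<le> w" "w \<le> v" "(f ^^ n) w - c * w = y"
proof -
  have "continuous_on {u..v} (\<lambda>w. (f ^^ n) w - c * w)"
    using continuous_iter_sub[of u v n] assms by (intro continuous_intros) auto
  then show ?thesis
    using IVT'[of "\<lambda>w. (f ^^ n) w - c * w" u y v] IVT2'[of "\<lambda>w. (f ^^ n) w - c * w" v y u] assms that by blast
qed

lemma image_ivt:
  assumes "x \<in> {a..b}" "y \<in> {a..b}" "f x \<le> c" "c \<le> f y"
  shows "\<exists>w. min x y \<le> w \<and> w \<le> max x y \<and> f w = c"
proof -
  have c: "continuous_on {min x y..max x y} f"
    by (rule continuous_on_subset[OF cont]) (use assms in auto)
  show ?thesis
  proof (cases "x \<le> y")
    case True
    then show ?thesis using IVT'[of f x c y] assms c by (auto simp: min_def max_def)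
  next
    case False
    then show ?thesis using IVT2'[of f x c y] assms c by (auto simp: min_def max_def)
  qed
qed

text \<open>Without an interior fixed point, \<open>f ^^ k\<close> would move all interior points to
  the same side, and one half of \<open>{c..d}\<close> would be invariant.\<close>

lemma transitive_on_fixed_point:
  assumes tr: "transitive_on k c d" and cd: "a \<le> c" "c < d" "d \<le> b"
  obtains z where "c < z" "z < d" "(f ^^ k) z = z"
proof (rule ccontr)
  assume "\<not> thesis"
  then have no: "\<And>z. c < z \<Longrightarrow> z < d \<Longrightarrow> (f ^^ k) z \<noteq> z" using that by blast
  have inv: "\<And>x. x \<in> {c..d} \<Longrightarrow> (f ^^ k) x \<in> {c..d}"
    using tr unfolding transitive_on_def by blast
  define m where "m = (c + d) / 2"
  have m: "c < m" "m < d" using cd by (auto simp: m_def)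
  show False
  proof (cases "(f ^^ k) m > m")
    case True
    have "(f ^^ k) y \<ge> y" if y: "y \<in> {m..d}" for y
    proof (rule ccontr)
      assume "\<not> (f ^^ k) y \<ge> y"
      then obtain w where w: "m \<le> w" "w \<le> y" "(f ^^ k) w - 1 * w = 0"
        using iter_ivt[of m y k 1 0] True y m cd by auto
      then have "w \<noteq> d" using \<open>\<not> (f ^^ k) y \<ge> y\<close> y by auto
      then show False using no[of w] w m y by auto
    qed
    then have "(f ^^ k) ` {m..d} \<subseteq> {m..d}" using inv m by fastforce
    then show False using transitive_on_no_invariant[OF tr, of m d] m by auto
  next
    case False
    then have "(f ^^ k) m < m" using no[of m] m by auto
    have "(f ^^ k) y \<le> y" if y: "y \<in> {c..m}" for y
    proof (rule ccontr)
      assume "\<not> (f ^^ k) y \<le> y"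
      then obtain w where w: "y \<le> w" "w \<le> m" "(f ^^ k) w - 1 * w = 0"
        using iter_ivt[of y m k 1 0] \<open>(f ^^ k) m < m\<close> y m cd by auto
      then have "w \<noteq> c" using \<open>\<not> (f ^^ k) y \<le> y\<close> y by auto
      then show False using no[of w] w m y by auto
    qed
    then have "(f ^^ k) ` {c..m} \<subseteq> {c..m}" using inv m by fastforce
    then show False using transitive_on_no_invariant[OF tr, of c m] m by auto
  qed
qed

text \<open>All iterates under \<open>f ^^ k\<close> of an interval containing the fixed point
  \<open>z\<close> are connected and contain \<open>z\<close>; transitivity makes one of them reach
  beyond \<open>y\<close>.\<close>

lemma transitive_on_spread:
  assumes tr: "transitive_on k c d" and cd: "a \<le> c" "d \<le> b"
    and z: "(f ^^ k) z = z" "p \<le> z" "z \<le> q" and pq: "c \<le> p" "p < q" "q \<le> d"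
    and y: "c < y" "y < d"
  shows "\<exists>n. {min y z..max y z} \<subseteq> (f ^^ (k * n)) ` {p..q}"
proof -
  have fz: "(f ^^ (k * n)) z = z" for n
    using iter_mult_invariant[of k "{z}" z n] z by simp
  have conn: "connected ((f ^^ (k * n)) ` {p..q})" for n
    using continuous_iter_sub[of p q "k * n"] cd pq by (intro connected_continuous_image) auto
  have sub: "{min w z..max w z} \<subseteq> (f ^^ (k * n)) ` {p..q}" if "x \<in> {p..q}" "(f ^^ (k * n)) x = w" for n x w
  proof -
    have mem: "w \<in> (f ^^ (k * n)) ` {p..q}" "z \<in> (f ^^ (k * n)) ` {p..q}"
      using that z fz[of n] by (auto simp: image_iff intro: bexI[of _ z])
    then show ?thesis
      using connected_contains_Icc[OF conn[of n], of w z] connected_contains_Icc[OF conn[of n], of z w]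
      by (cases "w \<le> z") (simp_all add: min_def max_def)
  qed
  show ?thesis
  proof (cases "y < z")
    case True
    obtain n x where x: "x \<in> {p<..<q}" "(f ^^ (k * n)) x \<in> {c<..<y}"
      using transitive_onD[OF tr pq, of c y] y by auto
    have "{min y z..max y z} \<subseteq> {min ((f ^^ (k * n)) x) z..max ((f ^^ (k * n)) x) z}" using x True by auto
    also have "\<dots> \<subseteq> (f ^^ (k * n)) ` {p..q}" using x by (intro sub[of x]) auto
    finally show ?thesis by blast
  next
    case False
    obtain n x where x: "x \<in> {p<..<q}" "(f ^^ (k * n)) x \<in> {y<..<d}"
      using transitive_onD[OF tr pq, of y d] y by auto
    have "{min y z..max y z} \<subseteq> {min ((f ^^ (k * n)) x) z..max ((f ^^ (k * n)) x) z}" using x False by auto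
    also have "\<dots> \<subseteq> (f ^^ (k * n)) ` {p..q}" using x by (intro sub[of x]) auto
    finally show ?thesis by blast
  qed
qed

lemma iter_image_nondegenerate:
  assumes "a \<le> u" "u < v" "v \<le> b"
  obtains p q where "p < q" "(f ^^ n) ` {u..v} = {p..q}"
proof -
  obtain p q where pq: "(f ^^ n) ` {u..v} = {p..q}"
    using continuous_image_closed_interval[OF _ continuous_iter_sub[OF assms(1,3)], of n] assms(2) by auto
  obtain x y where "x \<in> {u..v}" "y \<in> {u..v}" "(f ^^ n) x \<noteq> (f ^^ n) y"
    using nonconstant_iter[OF assms] by blast
  then have "(f ^^ n) x \<in> {p..q}" "(f ^^ n) y \<in> {p..q}" "(f ^^ n) x \<noteq> (f ^^ n) y" using pq by blast+
  then have "p < q" by auto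
  then show ?thesis using that pq by blast
qed

definition has_horseshoe :: bool where
  "has_horseshoe \<longleftrightarrow> (\<exists>J J1 J2 m1 m2. J \<subseteq> {a..b} \<and> J1 \<subseteq> J \<and> J2 \<subseteq> J \<and> J1 \<inter> J2 = {} \<and> J \<noteq> {} \<and>
     m1 > 0 \<and> m2 > 0 \<and> J \<subseteq> (f ^^ m1) ` J1 \<and> J \<subseteq> (f ^^ m2) ` J2)"

text \<open>A small interval at \<open>z\<close> spreads over the segment between \<open>y\<close>
  and \<open>z\<close> because \<open>z\<close> is fixed. A small interval at \<open>y\<close> does
  so too, since its image after \<open>k * i\<close> steps is a nondegenerate interval containing
  \<open>z\<close>.\<close>

lemma horseshoe_if_preimage:
  assumes tr: "transitive_on k c d" and cd: "a \<le> c" "d \<le> b" and "k > 0" "i > 0"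
    and z: "(f ^^ k) z = z" "c < z" "z < d"
    and y: "(f ^^ (k * i)) y = z" "c < y" "y < d" "y \<noteq> z"
  shows has_horseshoe
proof -
  define J where "J = {min y z..max y z}"
  have "\<exists>p1 q1 p2 q2. p1 < q1 \<and> p2 < q2 \<and> y \<in> {p1..q1} \<and> z \<in> {p2..q2} \<and> {p1..q1} \<subseteq> J \<and> {p2..q2} \<subseteq> J
      \<and> {p1..q1} \<inter> {p2..q2} = {}"
  proof (cases "y < z")
    case True
    \<comment> \<open>The outer thirds of the segment serve as the two disjoint intervals.\<close>
    define h where "h = (z - y) / 3"
    have h: "z = y + 3 * h" "h > 0" using True by (simp_all add: h_def field_simps)
    then have "J = {y..y + 3 * h}" by (simp add: J_def)
    then show ?thesis using h
      by (intro exI[of _ y] exI[of _ "y + h"] exI[of _ "z - h"] exI[of _ z]) simp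
  next
    case False
    define h where "h = (y - z) / 3"
    have h: "y = z + 3 * h" "h > 0" using False y(4) by (simp_all add: h_def field_simps)
    then have "J = {z..z + 3 * h}" by (simp add: J_def)
    then show ?thesis using h
      by (intro exI[of _ "y - h"] exI[of _ y] exI[of _ z] exI[of _ "z + h"]) simp
  qed
  then obtain p1 q1 p2 q2 where pq: "p1 < q1" "p2 < q2" "y \<in> {p1..q1}" "z \<in> {p2..q2}"
    "{p1..q1} \<subseteq> J" "{p2..q2} \<subseteq> J" "{p1..q1} \<inter> {p2..q2} = {}" by blast
  have Jcd: "J \<subseteq> {c..d}" using y z by (auto simp: J_def)
  have sub: "c \<le> p1" "q1 \<le> d" "c \<le> p2" "q2 \<le> d" 
    using order_trans[OF pq(5) Jcd] order_trans[OF pq(6) Jcd] pq(1,2) by simp_all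
  have inv: "(f ^^ k) ` {c..d} \<subseteq> {c..d}" using tr unfolding transitive_on_def by blast
  have "a \<le> p1" "q1 \<le> b" using sub cd by auto
  obtain p q where im: "p < q" "(f ^^ (k * i)) ` {p1..q1} = {p..q}"
    by (rule iter_image_nondegenerate[OF \<open>a \<le> p1\<close> pq(1) \<open>q1 \<le> b\<close>])
  have "{p1..q1} \<subseteq> {c..d}" using sub by simp
  then have "(f ^^ (k * i)) ` {p1..q1} \<subseteq> {c..d}"
    using iter_mult_invariant[OF inv] by (blast intro: image_subsetI)
  then have "{p..q} \<subseteq> {c..d}" using im(2) by simp
  then have "c \<le> p" "q \<le> d" using im(1) by auto
  moreover have "z \<in> {p..q}" using y(1) pq(3) im(2) by blast
  ultimately obtain n1 where "J \<subseteq> (f ^^ (k * n1)) ` {p..q}"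
    using transitive_on_spread[OF tr cd z(1), of p q y] im(1) y unfolding J_def by auto
  then have c1: "J \<subseteq> (f ^^ (k * n1 + k * i)) ` {p1..q1}"
    unfolding im(2)[symmetric] by (simp add: funpow_add image_comp)
  obtain n2 where n2: "J \<subseteq> (f ^^ (k * n2)) ` {p2..q2}"
    using transitive_on_spread[OF tr cd z(1), of p2 q2 y] pq sub y unfolding J_def by auto
  \<comment> \<open>Return times must be positive; at time 0 the interval at \<open>z\<close> would
    contain its disjoint partner.\<close>
  have "n2 \<noteq> 0"
  proof
    assume "n2 = 0"
    then have "J \<subseteq> {p2..q2}" using n2 by simp
    then show False using pq by blast
  qed
  show ?thesis unfolding has_horseshoe_def
  proof (rule exI[of _ J], rule exI[of _ "{p1..q1}"], rule exI[of _ "{p2..q2}"],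
      rule exI[of _ "k * n1 + k * i"], rule exI[of _ "k * n2"], intro conjI)
    show "J \<subseteq> {a..b}" using Jcd cd by auto
    show "J \<noteq> {}" by (simp add: J_def)
    show "0 < k * n1 + k * i" "0 < k * n2" using \<open>n2 \<noteq> 0\<close> \<open>k > 0\<close> \<open>i > 0\<close> by simp_all
  qed (fact pq c1 n2)+
qed

lemma transitive_on_1: "transitive_on 1 a b"
  unfolding transitive_on_def
proof (intro conjI allI impI)
  show "(f ^^ 1) ` {a..b} \<subseteq> {a..b}" using iter_in[of _ 1] by (simp add: image_subset_iff)
  fix u v c d assume "a \<le> u" "u < v" "v \<le> b" "a \<le> c" "c < d" "d \<le> b"
  then show "\<exists>n. \<exists>x\<in>{u<..<v}. (f ^^ (1 * n)) x \<in> {c<..<d}"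
    using topologically_transitive[of u v c d 0] by (metis mult_1)
qed

text \<open>Either an interior fixed point \<open>z\<close> has another interior preimage under some iterate, or \<open>f\<close>
  swaps \<open>[a,z]\<close> and \<open>[z,b]\<close>; in the latter case \<open>f\<^sup>2\<close> is transitive on \<open>[a,z]\<close> and fixes \<open>z\<close>, which
  excludes a second swap.\<close>

lemma horseshoe:
  shows has_horseshoe
proof -
  obtain z where z: "a < z" "z < b" "f z = z"
    using transitive_on_fixed_point[OF transitive_on_1 _ less] by auto
  show ?thesis
  proof (cases "\<exists>y i. a < y \<and> y < b \<and> y \<noteq> z \<and> i > 0 \<and> (f ^^ i) y = z")
    case True
    then obtain y i where "a < y" "y < b" "y \<noteq> z" "i > 0" "(f ^^ i) y = z" by blast
    then show ?thesis
      using horseshoe_if_preimage[OF transitive_on_1, of i z y] z by simp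
  next
    case False
    then have no: "y \<in> {a..b} \<Longrightarrow> i > 0 \<Longrightarrow> (f ^^ i) y = z \<Longrightarrow> y \<noteq> z \<Longrightarrow> y = a \<or> y = b" for y i
      by (metis atLeastAtMost_iff order_le_less)
    \<comment> \<open>A second preimage \<open>x\<close> of \<open>z\<close> would have to be an
      endpoint. By surjectivity it has a preimage \<open>w\<close>, and \<open>w\<close> a preimage
      \<open>v\<close>; both also end up at \<open>z\<close>, so \<open>x\<close>, \<open>w\<close>
      and \<open>v\<close> would be three distinct endpoints.\<close>
    have pre: "x = z" if x: "x \<in> {a..b}" "f x = z" for x
    proof (rule ccontr)
      assume "x \<noteq> z"
      have 1: "x = a \<or> x = b" using no[of x 1] x \<open>x \<noteq> z\<close> by simp
      obtain w where w: "w \<in> {a..b}" "f w = x" using surj x by (metis imageE)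
      have "w \<noteq> z" "w \<noteq> x" using w z x \<open>x \<noteq> z\<close> by auto
      then have 2: "w = a \<or> w = b" using no[of w 2] w x by (simp add: numeral_2_eq_2)
      obtain v where v: "v \<in> {a..b}" "f v = w" using surj w by (metis imageE)
      have "v \<noteq> z" "v \<noteq> x" "v \<noteq> w" using v w z x \<open>x \<noteq> z\<close> \<open>w \<noteq> z\<close> \<open>w \<noteq> x\<close> by auto
      moreover have "v = a \<or> v = b" using no[of v 3] v w x \<open>v \<noteq> z\<close> by (simp add: numeral_3_eq_3)
      ultimately show False using 1 2 \<open>w \<noteq> x\<close> by auto
    qed
    \<comment> \<open>Since \<open>z\<close> is its own only preimage, \<open>f\<close> stays on one
      side of \<open>z\<close> throughout \<open>{z..b}\<close>; the upper side would make
      \<open>{z..b}\<close> invariant.\<close>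
    have right: "f x \<le> z" if x: "x \<in> {z..b}" for x
    proof (rule ccontr)
      assume "\<not> f x \<le> z"
      have "f y \<ge> z" if y: "y \<in> {z..b}" for y
      proof (rule ccontr)
        assume "\<not> f y \<ge> z"
        have "\<exists>w. min x y \<le> w \<and> w \<le> max x y \<and> f w = z"
          using image_ivt[of y x z] x y z \<open>\<not> f x \<le> z\<close> \<open>\<not> f y \<ge> z\<close>
          unfolding min.commute[of x y] max.commute[of x y] by auto
        then obtain w where "min x y \<le> w" "w \<le> max x y" "f w = z" by auto
        moreover have "a \<le> min x y" "max x y \<le> b" using x y z(1,2) by simp_all
        ultimately have "w \<in> {a..b}" "f w = z" "min x y \<le> w" "w \<le> max x y" by auto
        then have "w = z" "min x y \<le> z" "z \<le> max x y" using pre[of w] by simp_all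
        have "x \<noteq> z" "y \<noteq> z" using z(3) \<open>\<not> f x \<le> z\<close> \<open>\<not> f y \<ge> z\<close> by auto
        with \<open>min x y \<le> z\<close> show False using x y by (simp add: min_le_iff_disj)
      qed
      then have "f ` {z..b} \<subseteq> {z..b}" using maps z by force
      then show False using no_invariant_interval[of z b] z by auto
    qed
    have left: "f x \<ge> z" if x: "x \<in> {a..z}" for x
    proof (rule ccontr)
      assume "\<not> f x \<ge> z"
      have "f y \<le> z" if y: "y \<in> {a..z}" for y
      proof (rule ccontr)
        assume "\<not> f y \<le> z"
        have "\<exists>w. min x y \<le> w \<and> w \<le> max x y \<and> f w = z"
          using image_ivt[of x y z] x y z \<open>\<not> f x \<ge> z\<close> \<open>\<not> f y \<le> z\<close> by auto
        then obtain w where "min x y \<le> w" "w \<le> max x y" "f w = z" by auto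
        moreover have "a \<le> min x y" "max x y \<le> b" using x y z(1,2) by simp_all
        ultimately have "w \<in> {a..b}" "f w = z" "min x y \<le> w" "w \<le> max x y" by auto
        then have "w = z" "min x y \<le> z" "z \<le> max x y" using pre[of w] by simp_all
        have "x \<noteq> z" "y \<noteq> z" using z(3) \<open>\<not> f x \<ge> z\<close> \<open>\<not> f y \<le> z\<close> by auto
        with \<open>z \<le> max x y\<close> show False using x y by (simp add: le_max_iff_disj)
      qed
      then have "f ` {a..z} \<subseteq> {a..z}" using maps z by force
      then show False using no_invariant_interval[of a z] z by auto
    qed
    have inv2: "(f ^^ 2) ` {a..z} \<subseteq> {a..z}"
    proof -
      have "f (f x) \<in> {a..z}" if "x \<in> {a..z}" for x
      proof -
        have "x \<in> {a..b}" using that z by auto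
        then have "f x \<in> {z..b}" using left[OF that] iter_in[of x 1] by simp
        then show ?thesis using right[of "f x"] iter_in[of x 2] \<open>x \<in> {a..b}\<close> by (simp add: numeral_2_eq_2)
      qed
      then show ?thesis by (auto simp: numeral_2_eq_2)
    qed
    have tr2: "transitive_on 2 a z"
      unfolding transitive_on_def
    proof (intro conjI allI impI)
      show "(f ^^ 2) ` {a..z} \<subseteq> {a..z}" by (rule inv2)
      fix u v c d assume *: "a \<le> u" "u < v" "v \<le> z" "a \<le> c" "c < d" "d \<le> z"
      then have "v \<le> b" "d \<le> b" using z by auto
      then obtain n x where x: "x \<in> {u<..<v}" "(f ^^ n) x \<in> {c<..<d}"
        using topologically_transitive[OF *(1,2) _ *(4,5), of 0] by blast
      \<comment> \<open>Odd iterates send \<open>{a..z}\<close> into \<open>{z..b}\<close>, so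
        \<open>{c<..<d}\<close>, which lies below \<open>z\<close>, can be hit at even times
        only.\<close>
      have "even n"
      proof (rule ccontr)
        assume "odd n"
        then obtain m where m: "n = Suc (2 * m)" by (auto elim: oddE)
        have "(f ^^ (2 * m)) x \<in> {a..z}" using x * by (intro iter_mult_invariant[OF inv2]) auto
        then have "(f ^^ n) x \<ge> z" using left m by simp
        then show False using x * by auto
      qed
      then obtain m where "n = 2 * m" by (rule evenE)
      then show "\<exists>n. \<exists>x\<in>{u<..<v}. (f ^^ (2 * n)) x \<in> {c<..<d}" using x by blast
    qed
    obtain z' where z': "a < z'" "z' < z" "(f ^^ 2) z' = z'"
      using transitive_on_fixed_point[OF tr2] z by auto
    \<comment> \<open>Somewhere on \<open>{z'..z}\<close> the map \<open>f ^^ 2\<close> drops below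
      \<open>z'\<close>, yet it fixes \<open>z\<close>. Hence it takes the value \<open>z'\<close>
      at a further point \<open>w\<close>, and \<open>z'\<close> instead of \<open>z\<close>
      provides the horseshoe.\<close>
    have "\<not> (f ^^ 2) ` {z'..z} \<subseteq> {z'..z}"
      using transitive_on_no_invariant[OF tr2, of z' z] z' by auto
    then obtain x where x: "x \<in> {z'..z}" "(f ^^ 2) x < z'"
      using inv2 z' by (fastforce simp: image_subset_iff)
    have "(f ^^ 2) z = z" using z by (simp add: numeral_2_eq_2)
    then obtain w where w: "x \<le> w" "w \<le> z" "(f ^^ 2) w - 0 * w = z'"
      using iter_ivt[of x z 2 0 z'] x z z' by auto
    have "w \<noteq> z'" "w \<noteq> z" using w x z' \<open>(f ^^ 2) z = z\<close> by auto
    then show ?thesis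
      using horseshoe_if_preimage[OF tr2, of 1 z' w] z z' w x by simp
  qed
qed

end

context cut_interval_map
begin

lemma growth_gt_1: "growth > 1"
  using horseshoe horseshoe_growth unfolding has_horseshoe_def by blast

end

subsection \<open>The conformal distribution function\<close>

text \<open>Tychonoff's theorem for a cube. The index type will be that of all sets of reals, where
  sequential compactness fails; therefore a finer filter \<open>G\<close> replaces a
  subsequence.\<close>

lemma cluster_functional:
  fixes \<Lambda> :: "'t \<Rightarrow> 'i \<Rightarrow> real"
  assumes "F \<noteq> bot" and bounded: "\<forall>\<^sub>F t in F. \<forall>A. \<Lambda> t A \<in> {0..1}"
  shows "\<exists>L G. G \<noteq> bot \<and> G \<le> filtermap \<Lambda> F \<and> (\<forall>A. ((\<lambda>\<phi>. \<phi> A) \<longlongrightarrow> L A) G)"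
proof -
  define K :: "('i \<Rightarrow> real) set" where "K = PiE UNIV (\<lambda>_. {0..1})"
  have "compactin (product_topology (\<lambda>_. euclidean) UNIV) K"
    unfolding K_def compactin_PiE by simp
  then have "compact K" by (simp add: euclidean_product_topology)
  moreover have "filtermap \<Lambda> F \<noteq> bot" using assms by (simp add: filtermap_bot_iff)
  moreover have "eventually (\<lambda>\<phi>. \<phi> \<in> K) (filtermap \<Lambda> F)"
    using bounded by (simp add: eventually_filtermap K_def PiE_iff)
  ultimately obtain L where L: "inf (nhds L) (filtermap \<Lambda> F) \<noteq> bot"
    unfolding compact_filter by blast
  have "((\<lambda>\<phi>. \<phi> A) \<longlongrightarrow> L A) (nhds L)" for A
  proof (rule topological_tendstoI)
    fix U assume U: "open U" "L A \<in> U"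
    have "open ((\<lambda>\<phi> :: 'i \<Rightarrow> real. \<phi> A) -` U)" by (rule open_vimage[OF U(1)]) simp
    then show "\<forall>\<^sub>F \<phi> in nhds L. \<phi> A \<in> U"
      unfolding eventually_nhds using U(2) by (intro exI[of _ "(\<lambda>\<phi>. \<phi> A) -` U"]) auto
  qed
  then have "((\<lambda>\<phi>. \<phi> A) \<longlongrightarrow> L A) (inf (nhds L) (filtermap \<Lambda> F))" for A
    by (rule tendsto_mono[rotated]) simp
  then show ?thesis using L by (metis inf_le2)
qed

context cut_interval_map
begin

section \<open>Preimage counts and their generating series\<close>

definition hits :: "nat \<Rightarrow> real set \<Rightarrow> nat" where
  "hits n A = card {x \<in> A \<inter> {a..b}. (f ^^ n) x \<in> T}"

lemma finite_hits: "finite {x \<in> A \<inter> {a..b}. (f ^^ n) x \<in> T}"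
  by (rule finite_subset[OF _ finite_preimage[OF finite_T, of n]]) auto

lemma hits_Un: "A \<inter> B = {} \<Longrightarrow> hits n (A \<union> B) = hits n A + hits n B"
proof -
  assume "A \<inter> B = {}"
  have "{x \<in> (A \<union> B) \<inter> {a..b}. (f ^^ n) x \<in> T} =
      {x \<in> A \<inter> {a..b}. (f ^^ n) x \<in> T} \<union> {x \<in> B \<inter> {a..b}. (f ^^ n) x \<in> T}" by blast
  then show ?thesis unfolding hits_def using \<open>A \<inter> B = {}\<close>
    by (simp only:) (rule card_Un_disjoint[OF finite_hits finite_hits], blast)
qed

lemma hits_le: "hits n A \<le> hits n {a..b}"
  unfolding hits_def by (rule card_mono[OF finite_hits]) blast

lemma hits_singleton: "hits n {x} \<le> 1"
proof -
  have "{y \<in> {x} \<inter> {a..b}. (f ^^ n) y \<in> T} \<subseteq> {x}" by blast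
  then show ?thesis unfolding hits_def using card_mono[of "{x}"] by fastforce
qed

text \<open>This shift of the index by one is what becomes the factor \<open>growth\<close> in the
  limit.\<close>

lemma hits_image:
  assumes "inj_on f A" "A \<subseteq> {a..b}"
  shows "hits n (f ` A) = hits (Suc n) A"
proof -
  have eq: "f ` {x \<in> A \<inter> {a..b}. (f ^^ Suc n) x \<in> T} = {y \<in> f ` A \<inter> {a..b}. (f ^^ n) y \<in> T}"
  proof (intro set_eqI iffI)
    fix y assume "y \<in> f ` {x \<in> A \<inter> {a..b}. (f ^^ Suc n) x \<in> T}"
    then obtain x where x: "x \<in> A" "x \<in> {a..b}" "(f ^^ Suc n) x \<in> T" "y = f x" by blast
    then have "y \<in> {a..b}" using iter_in[of x 1] by simp
    moreover have "(f ^^ n) y \<in> T" using x by (simp add: funpow_swap1)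
    ultimately show "y \<in> {y \<in> f ` A \<inter> {a..b}. (f ^^ n) y \<in> T}" using x by blast
  next
    fix y assume "y \<in> {y \<in> f ` A \<inter> {a..b}. (f ^^ n) y \<in> T}"
    then obtain x where x: "x \<in> A" "(f ^^ n) y \<in> T" "y = f x" by blast
    then have "(f ^^ Suc n) x \<in> T" by (simp add: funpow_swap1)
    then show "y \<in> f ` {x \<in> A \<inter> {a..b}. (f ^^ Suc n) x \<in> T}" using x assms(2) by blast
  qed
  have "inj_on f {x \<in> A \<inter> {a..b}. (f ^^ Suc n) x \<in> T}"
    by (rule inj_on_subset[OF assms(1)]) blast
  then show ?thesis unfolding hits_def eq[symmetric] by (rule card_image)
qed

lemma card_cuts_le: "card (cuts n) \<le> laps n a b + 1"
proof -
  have "cuts n \<subseteq> (cuts n \<inter> {a<..<b}) \<union> {a,b}" by (auto simp: cuts_def)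
  then have "card (cuts n) \<le> card ((cuts n \<inter> {a<..<b}) \<union> {a,b})"
    using finite_cuts by (intro card_mono) auto
  also have "\<dots> \<le> card (cuts n \<inter> {a<..<b}) + card {a,b}" by (rule card_Un_le)
  also have "card {a,b} \<le> 2" by (simp add: card_insert_if)
  finally show ?thesis by (simp add: laps_def)
qed

text \<open>Cuts at the endpoints \<open>a\<close> and \<open>b\<close> are not seen by
  \<open>laps\<close>; as \<open>laps\<close> is at least 1, the factor 2 absorbs them.\<close>

lemma hits_le_laps: "hits n A \<le> 2 * laps (Suc n) a b"
proof -
  have "hits n A \<le> card (cuts (Suc n))"
    unfolding hits_def by (rule card_mono[OF finite_cuts]) (auto simp: cuts_def)
  then show ?thesis using card_cuts_le[of "Suc n"] laps_pos[of "Suc n" a b] by linarith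
qed

lemma laps_le_sum_hits: "laps n a b \<le> 1 + (\<Sum>i<n. hits i {a..b})"
proof -
  have eq: "cuts n = (\<Union>i<n. {x \<in> {a..b} \<inter> {a..b}. (f ^^ i) x \<in> T})" by (auto simp: cuts_def)
  have "card (cuts n) \<le> (\<Sum>i<n. hits i {a..b})"
    unfolding eq hits_def by (rule card_UN_le) simp
  moreover have "card (cuts n \<inter> {a<..<b}) \<le> card (cuts n)" using finite_cuts by (intro card_mono) auto
  ultimately show ?thesis by (simp add: laps_def)
qed

text \<open>As \<open>growth\<close> is an infimum, some \<open>m\<close> has
  \<open>root m (laps m a b) * t < 1\<close>. Division with remainder by \<open>m\<close> and
  submultiplicativity then compare the series with a geometric one.\<close>

lemma summable_laps:
  assumes "0 < t" "t * growth < 1"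
  shows "summable (\<lambda>n. real (laps n a b) * t ^ n)"
proof -
  have "growth < 1 / t" using assms by (simp add: field_simps)
  then obtain m where m: "m \<ge> 1" "root m (real (laps m a b)) < 1 / t"
    unfolding growth_def using cInf_lessD[of "(\<lambda>n. root n (real (laps n a b))) ` {1..}" "1 / t"] by auto
  define q where "q = real (laps m a b) * t ^ m"
  define s where "s = root m q"
  have q: "q > 0" using laps_pos[of m a b] assms by (simp add: q_def)
  have s_eq: "s = root m (real (laps m a b)) * t"
    using m assms by (simp add: s_def q_def real_root_mult real_root_power_cancel)
  then have s: "0 < s" "s < 1" "s ^ m = q"
  proof -
    show "0 < s" "s ^ m = q" using m(1) q by (simp_all add: s_def)
    show "s < 1" unfolding s_eq using m(2) assms(1) by (simp add: field_simps)
  qed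
  \<comment> \<open>\<open>K\<close> covers all remainders modulo \<open>m\<close>; the factor
    \<open>1 / q\<close> below comes from replacing \<open>s ^ i\<close> by the smaller
    \<open>s ^ m = q\<close>.\<close>
  define K where "K = (\<Sum>i<m. real (laps i a b) * t ^ i)"
  have "0 \<le> K" using assms by (simp add: K_def sum_nonneg)
  have bound: "real (laps n a b) * t ^ n \<le> K / q * s ^ n" for n
  proof -
    define i where "i = n mod m"
    have n: "n = (n div m) * m + i" by (simp add: i_def)
    have i: "i < m" using m by (simp add: i_def)
    have "laps n a b \<le> laps ((n div m) * m) a b * laps i a b"
      using laps_add_le[of a b "(n div m) * m" i] less n by simp
    also have "\<dots> \<le> laps m a b ^ (n div m) * laps i a b" using laps_mult_le by simp
    finally have "real (laps n a b) \<le> real (laps m a b) ^ (n div m) * real (laps i a b)"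
      by (metis of_nat_le_iff of_nat_mult of_nat_power)
    then have "real (laps n a b) * t ^ n \<le> real (laps m a b) ^ (n div m) * real (laps i a b) * t ^ n"
      using assms by (intro mult_right_mono) auto
    also have "\<dots> = real (laps m a b) ^ (n div m) * real (laps i a b) * ((t ^ m) ^ (n div m) * t ^ i)"
      by (subst (2) n) (simp only: power_add power_mult mult.commute[of "n div m" m])
    also have "\<dots> = q ^ (n div m) * (real (laps i a b) * t ^ i)"
      by (simp add: q_def power_mult_distrib)
    also have "\<dots> \<le> q ^ (n div m) * K"
      using i assms q unfolding K_def
      by (intro mult_left_mono member_le_sum) auto
    also have "q ^ (n div m) = s ^ (m * (n div m))" using s by (simp add: power_mult)
    also have "\<dots> = s ^ n / s ^ i"
      using s n by (metis less_numeral_extra(3) mult.commute nonzero_mult_div_cancel_right power_add power_not_zero)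
    also have "\<dots> \<le> s ^ n / s ^ m"
      using s i by (intro divide_left_mono power_decreasing) auto
    finally show ?thesis using s \<open>0 \<le> K\<close> by (simp add: field_simps mult_right_mono)
  qed
  have "summable (\<lambda>n. K / q * s ^ n)" using s by (intro summable_mult summable_geometric) auto
  then show ?thesis
    by (rule summable_comparison_test'[where N = 0]) (use bound assms in auto)
qed

definition hit_series :: "real \<Rightarrow> real set \<Rightarrow> real" where
  "hit_series t A = (\<Sum>n. real (hits n A) * t ^ n)"

lemma summable_hits:
  assumes "0 < t" "t * growth < 1"
  shows "summable (\<lambda>n. real (hits n A) * t ^ n)"
proof -
  have "summable (\<lambda>n. real (laps (Suc n) a b) * t ^ Suc n)"
    using summable_laps[OF assms] by (rule summable_Suc_iff[THEN iffD2])
  then have sm: "summable (\<lambda>n. 2 / t * (real (laps (Suc n) a b) * t ^ Suc n))" by (rule summable_mult)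
  have "norm (real (hits n A) * t ^ n) \<le> 2 / t * (real (laps (Suc n) a b) * t ^ Suc n)" for n
  proof -
    have "real (hits n A) \<le> 2 * real (laps (Suc n) a b)" using hits_le_laps[of n A] by linarith
    then have "real (hits n A) * t ^ n \<le> 2 * real (laps (Suc n) a b) * t ^ n"
      using assms by (intro mult_right_mono) auto
    then show ?thesis using assms by simp
  qed
  then show ?thesis by (intro summable_comparison_test'[OF sm, of 0]) auto
qed

lemma hit_series_nonneg: "0 < t \<Longrightarrow> t * growth < 1 \<Longrightarrow> 0 \<le> hit_series t A"
  unfolding hit_series_def by (intro suminf_nonneg summable_hits) auto

lemma hit_series_le: "0 < t \<Longrightarrow> t * growth < 1 \<Longrightarrow> hit_series t A \<le> hit_series t {a..b}"
  unfolding hit_series_def using hits_le[of _ A]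
  by (intro suminf_le summable_hits) (auto intro!: mult_right_mono)

lemma hit_series_Un:
  assumes "0 < t" "t * growth < 1" "A \<inter> B = {}"
  shows "hit_series t (A \<union> B) = hit_series t A + hit_series t B"
  unfolding hit_series_def hits_Un[OF assms(3)] of_nat_add distrib_right
  by (rule suminf_add[symmetric]; rule summable_hits[OF assms(1,2)])

text \<open>A bound that stays finite as \<open>t\<close> tends to \<open>1 / growth < 1\<close>, so
  points lose all weight after normalisation.\<close>

lemma hit_series_singleton:
  assumes "0 < t" "t < 1" "t * growth < 1"
  shows "hit_series t {x} \<le> 1 / (1 - t)"
proof -
  have "hit_series t {x} \<le> (\<Sum>n. t ^ n)"
    unfolding hit_series_def
  proof (intro suminf_le summable_hits assms)
    fix n show "real (hits n {x}) * t ^ n \<le> t ^ n"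
      using hits_singleton[of n x] assms by (intro mult_left_le_one_le) auto
  qed (use assms in auto)
  then show ?thesis using assms by (simp add: suminf_geometric)
qed

text \<open>Exact scaling by \<open>1 / t\<close> up to the defect \<open>hits 0 A\<close>, which
  does not depend on \<open>t\<close> and disappears when divided by a divergent total.\<close>

lemma hit_series_image:
  assumes "0 < t" "t * growth < 1" "inj_on f A" "A \<subseteq> {a..b}"
  shows "t * hit_series t (f ` A) = hit_series t A - real (hits 0 A)"
proof -
  have "hit_series t A = (\<Sum>n. real (hits (Suc n) A) * t ^ Suc n) + real (hits 0 A)"
    unfolding hit_series_def using suminf_split_head[OF summable_hits[OF assms(1,2), of A]] by simp
  also have "(\<Sum>n. real (hits (Suc n) A) * t ^ Suc n) = (\<Sum>n. t * (real (hits n (f ` A)) * t ^ n))"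
    using hits_image[OF assms(3,4)] by (simp add: mult_ac)
  also have "\<dots> = t * hit_series t (f ` A)"
    unfolding hit_series_def by (rule suminf_mult[OF summable_hits[OF assms(1,2)]])
  finally show ?thesis by simp
qed

text \<open>Submultiplicativity of the lap numbers makes \<open>\<Sum> hits n * t\<^sup>n\<close> diverge at its radius of convergence.\<close>

lemma not_summable_hits: "\<not> summable (\<lambda>n. real (hits n {a..b}) * (1 / growth) ^ n)"
proof
  define r where "r = 1 / growth"
  have r: "0 < r" "r < 1" "growth * r = 1" using growth_gt_1 by (auto simp: r_def)
  assume "summable (\<lambda>n. real (hits n {a..b}) * (1 / growth) ^ n)"
  then have "summable (\<lambda>n. norm (real (hits n {a..b}) * r ^ n))" using r by (simp add: r_def)
  moreover have "summable (\<lambda>n. norm (r ^ n))" using r by (simp add: summable_geometric)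
  \<comment> \<open>The Cauchy product with the geometric series has the coefficients
    \<open>r ^ n\<close> times the number of hits up to time \<open>n\<close>. They would tend to 0,
    although \<open>growth_power_le\<close> and \<open>laps_le_sum_hits\<close> keep them away from
    0.\<close>
  ultimately have "summable (\<lambda>n. \<Sum>i\<le>n. real (hits i {a..b}) * r ^ i * r ^ (n - i))"
    by (rule summable_Cauchy_product)
  then have "(\<lambda>n. \<Sum>i\<le>n. real (hits i {a..b}) * r ^ i * r ^ (n - i)) \<longlonglongrightarrow> 0"
    by (rule summable_LIMSEQ_zero)
  then have "(\<lambda>n. \<Sum>i\<le>n. real (hits i {a..b}) * r ^ n) \<longlonglongrightarrow> 0"
    by (simp add: mult.assoc flip: power_add)
  then have lim: "(\<lambda>n. r * r ^ n + r * (\<Sum>i\<le>n. real (hits i {a..b}) * r ^ n)) \<longlonglongrightarrow> r * 0 + r * 0"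
    using r by (intro tendsto_add tendsto_mult tendsto_const LIMSEQ_power_zero) auto
  have "1 \<le> r * r ^ n + r * (\<Sum>i\<le>n. real (hits i {a..b}) * r ^ n)" for n
  proof -
    have "1 = (growth * r) ^ Suc n" using r by simp
    also have "\<dots> = growth ^ Suc n * r ^ Suc n" by (rule power_mult_distrib)
    also have "\<dots> \<le> real (laps (Suc n) a b) * r ^ Suc n"
      using r growth_power_le[of "Suc n"] by (intro mult_right_mono) auto
    also have "\<dots> \<le> (1 + (\<Sum>i\<le>n. real (hits i {a..b}))) * r ^ Suc n"
    proof (intro mult_right_mono)
      have "real (laps (Suc n) a b) \<le> real (1 + (\<Sum>i<Suc n. hits i {a..b}))"
        using laps_le_sum_hits[of "Suc n"] of_nat_le_iff by blast
      then show "real (laps (Suc n) a b) \<le> 1 + (\<Sum>i\<le>n. real (hits i {a..b}))"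
        by (simp add: lessThan_Suc_atMost)
    qed (use r in auto)
    also have "\<dots> = r * r ^ n + r * (\<Sum>i\<le>n. real (hits i {a..b}) * r ^ n)"
      by (simp add: algebra_simps sum_distrib_left)
    finally show ?thesis .
  qed
  then have "1 \<le> r * 0 + r * 0" using LIMSEQ_le_const[OF lim] by blast
  then show False by simp
qed

lemma eventually_subcritical: "\<forall>\<^sub>F t in at_left (1 / growth). 0 < t \<and> t < 1 \<and> t * growth < 1"
proof -
  have "0 < 1 / growth" using growth_gt_1 by simp
  then have "\<forall>\<^sub>F t in at_left (1 / growth). t \<in> {0<..<1 / growth}" by (rule eventually_at_left_real)
  then show ?thesis
  proof eventually_elim
    case (elim t)
    then have "t * growth < 1" using growth_gt_1 by (simp add: field_simps)
    moreover have "1 / growth < 1" using growth_gt_1 by simp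
    ultimately show ?case using elim by auto
  qed
qed

text \<open>Some partial sum at the critical value exceeds \<open>M\<close>; it is continuous in
  \<open>t\<close> and is dominated by the series, whose terms are nonnegative.\<close>

lemma hit_series_at_top: "filterlim (\<lambda>t. hit_series t {a..b}) at_top (at_left (1 / growth))"
  unfolding filterlim_at_top
proof
  fix M :: real
  define r where "r = 1 / growth"
  have "r > 0" using growth_gt_1 by (simp add: r_def)
  have "\<exists>n. (\<Sum>i<n. real (hits i {a..b}) * r ^ i) > M"
  proof (rule ccontr)
    assume "\<not> ?thesis"
    then have "summable (\<lambda>n. real (hits n {a..b}) * r ^ n)"
      using \<open>r > 0\<close> by (intro summableI_nonneg_bounded[of _ M]) (auto simp: not_less)
    then show False using not_summable_hits by (simp add: r_def)
  qed
  then obtain n where n: "(\<Sum>i<n. real (hits i {a..b}) * r ^ i) > M" by blast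
  have "((\<lambda>t. \<Sum>i<n. real (hits i {a..b}) * t ^ i) \<longlongrightarrow> (\<Sum>i<n. real (hits i {a..b}) * r ^ i)) (at_left r)"
    by (intro tendsto_intros)
  then have "\<forall>\<^sub>F t in at_left r. (\<Sum>i<n. real (hits i {a..b}) * t ^ i) > M"
    using n by (rule order_tendstoD)
  then show "\<forall>\<^sub>F t in at_left (1 / growth). M \<le> hit_series t {a..b}"
    using eventually_subcritical unfolding r_def
  proof eventually_elim
    case (elim t)
    have "(\<Sum>i<n. real (hits i {a..b}) * t ^ i) \<le> hit_series t {a..b}"
      unfolding hit_series_def using elim by (intro sum_le_suminf summable_hits) auto
    then show ?case using elim by simp
  qed
qed

text \<open>The Milnor--Thurston limit of the normalised hit series. Compactness of \<open>[0,1]\<close> to the power of all sets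
  gives a simultaneous limit along a filter, and finite additivity of the limit suffices: the bound
  \<open>\<psi> v - \<psi> u \<le> (1 / growth)\<^sup>n\<close> on uncut intervals already yields continuity.\<close>

lemma conformal_charge_exists:
  "\<exists>L :: real set \<Rightarrow> real. (\<forall>A. 0 \<le> L A) \<and> L {a..b} = 1 \<and> (\<forall>x. L {x} = 0) \<and>
    (\<forall>A B. A \<inter> B = {} \<longrightarrow> L (A \<union> B) = L A + L B) \<and>
    (\<forall>A. inj_on f A \<longrightarrow> A \<subseteq> {a..b} \<longrightarrow> L (f ` A) = growth * L A)"
proof -
  define F where "F = at_left (1 / growth)"
  define \<Lambda> where "\<Lambda> = (\<lambda>t A. hit_series t A / hit_series t {a..b})"
  have top: "filterlim (\<lambda>t. hit_series t {a..b}) at_top F" unfolding F_def by (rule hit_series_at_top)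
  have ev: "\<forall>\<^sub>F t in F. (0 < t \<and> t < 1 \<and> t * growth < 1) \<and> hit_series t {a..b} > 0"
  proof (rule eventually_conj)
    show "\<forall>\<^sub>F t in F. 0 < t \<and> t < 1 \<and> t * growth < 1" unfolding F_def by (rule eventually_subcritical)
    show "\<forall>\<^sub>F t in F. hit_series t {a..b} > 0" using top by (simp add: filterlim_at_top_dense)
  qed
  have "F \<noteq> bot" by (simp add: F_def trivial_limit_at_left_real)
  moreover have "\<forall>\<^sub>F t in F. \<forall>A. \<Lambda> t A \<in> {0..1}"
    using ev by eventually_elim (auto simp: \<Lambda>_def hit_series_nonneg hit_series_le divide_le_eq_1)
  ultimately obtain G L where G: "G \<noteq> bot" "G \<le> filtermap \<Lambda> F" and L: "\<And>A. ((\<lambda>\<phi>. \<phi> A) \<longlongrightarrow> L A) G"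
    using cluster_functional[of F \<Lambda>] by blast
  \<comment> \<open>Since \<open>G\<close> refines the image of \<open>F\<close>, the limit of
    \<open>h (\<Lambda> t)\<close> along \<open>F\<close> must be the value of \<open>h\<close> at
    the cluster point. Each property of \<open>L\<close> is such an instance, except
    nonnegativity.\<close>
  have lim: "h L' = c" if "((\<lambda>t. h (\<Lambda> t)) \<longlongrightarrow> c) F" "((\<lambda>\<phi>. h \<phi>) \<longlongrightarrow> h L') G"
    for h :: "(real set \<Rightarrow> real) \<Rightarrow> real" and c L'
  proof -
    have "((\<lambda>\<phi>. h \<phi>) \<longlongrightarrow> c) (filtermap \<Lambda> F)" using that(1) by (simp add: filterlim_filtermap)
    then have "((\<lambda>\<phi>. h \<phi>) \<longlongrightarrow> c) G" using G(2) by (rule tendsto_mono[rotated])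
    then show ?thesis using tendsto_unique[OF G(1)] that(2) by blast
  qed
  have limv: "L A = c" if "((\<lambda>t. \<Lambda> t A) \<longlongrightarrow> c) F" for A c
    by (rule lim[of "\<lambda>\<phi>. \<phi> A"]) (use that L in auto)
  show ?thesis
  proof (intro exI[of _ L] conjI allI impI)
    fix A
    have "\<forall>\<^sub>F \<phi> in filtermap \<Lambda> F. 0 \<le> \<phi> A"
      unfolding eventually_filtermap using ev
      by eventually_elim (auto simp: \<Lambda>_def hit_series_nonneg)
    then have "\<forall>\<^sub>F \<phi> in G. 0 \<le> \<phi> A" using G(2) by (rule filter_leD[rotated])
    then show "0 \<le> L A" using tendsto_lowerbound[OF L] G(1) by blast
  next
    show "L {a..b} = 1"
    proof (rule limv, rule tendsto_eventually)
      show "\<forall>\<^sub>F t in F. \<Lambda> t {a..b} = 1" using ev by eventually_elim (simp add: \<Lambda>_def)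
    qed
  next
    fix x
    show "L {x} = 0"
    proof (rule limv)
      have "((\<lambda>t. (1 / (1 - t)) / hit_series t {a..b}) \<longlongrightarrow> 0) F"
      proof (rule tendsto_divide_0)
        show "((\<lambda>t. 1 / (1 - t)) \<longlongrightarrow> 1 / (1 - 1 / growth)) F"
          unfolding F_def using growth_gt_1 by (intro tendsto_intros) auto
        show "LIM t F. hit_series t {a..b} :> at_infinity"
          using top by (rule filterlim_at_top_imp_at_infinity)
      qed
      then show "((\<lambda>t. \<Lambda> t {x}) \<longlongrightarrow> 0) F"
      proof (rule Lim_null_comparison[rotated])
        show "\<forall>\<^sub>F t in F. norm (\<Lambda> t {x}) \<le> (1 / (1 - t)) / hit_series t {a..b}"
          using ev
        proof eventually_elim
          case (elim t)
          then have "0 \<le> hit_series t {x}" "hit_series t {x} \<le> 1 / (1 - t)"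
            by (auto intro: hit_series_nonneg hit_series_singleton)
          then have "norm (\<Lambda> t {x}) = hit_series t {x} / hit_series t {a..b}" using elim by (simp add: \<Lambda>_def)
          also have "\<dots> \<le> (1 / (1 - t)) / hit_series t {a..b}"
            using elim \<open>hit_series t {x} \<le> 1 / (1 - t)\<close> by (intro divide_right_mono) auto
          finally show ?case .
        qed
      qed
    qed
  next
    fix A B :: "real set" assume "A \<inter> B = {}"
    have "L (A \<union> B) - L A - L B = 0"
    proof (rule lim[where h = "\<lambda>\<phi>. \<phi> (A \<union> B) - \<phi> A - \<phi> B"])
      show "((\<lambda>t. \<Lambda> t (A \<union> B) - \<Lambda> t A - \<Lambda> t B) \<longlongrightarrow> 0) F"
      proof (rule tendsto_eventually)
        show "\<forall>\<^sub>F t in F. \<Lambda> t (A \<union> B) - \<Lambda> t A - \<Lambda> t B = 0"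
          using ev by eventually_elim (simp add: \<Lambda>_def hit_series_Un \<open>A \<inter> B = {}\<close> add_divide_distrib)
      qed
    qed (intro tendsto_intros L)
    then show "L (A \<union> B) = L A + L B" by simp
  next
    fix A assume A: "inj_on f A" "A \<subseteq> {a..b}"
    have "L (f ` A) - growth * L A = 0"
    proof (rule lim[where h = "\<lambda>\<phi>. \<phi> (f ` A) - growth * \<phi> A"])
      have lim0: "((\<lambda>t. \<bar>1 / t - growth\<bar> + (real (hits 0 A) / t) / hit_series t {a..b}) \<longlongrightarrow> \<bar>1 / (1 / growth) - growth\<bar> + 0) F"
      proof (intro tendsto_add tendsto_rabs tendsto_diff tendsto_const)
        show "((\<lambda>t. 1 / t) \<longlongrightarrow> 1 / (1 / growth)) F"
          unfolding F_def using growth_gt_1 by (intro tendsto_intros) auto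
        show "((\<lambda>t. (real (hits 0 A) / t) / hit_series t {a..b}) \<longlongrightarrow> 0) F"
        proof (rule tendsto_divide_0)
          show "((\<lambda>t. real (hits 0 A) / t) \<longlongrightarrow> real (hits 0 A) / (1 / growth)) F"
            unfolding F_def using growth_gt_1 by (intro tendsto_intros) auto
          show "LIM t F. hit_series t {a..b} :> at_infinity"
            using top by (rule filterlim_at_top_imp_at_infinity)
        qed
      qed
      show "((\<lambda>t. \<Lambda> t (f ` A) - growth * \<Lambda> t A) \<longlongrightarrow> 0) F"
      proof (rule Lim_null_comparison)
        show "((\<lambda>t. \<bar>1 / t - growth\<bar> + (real (hits 0 A) / t) / hit_series t {a..b}) \<longlongrightarrow> 0) F"
          using lim0 growth_gt_1 by simp
        show "\<forall>\<^sub>F t in F. norm (\<Lambda> t (f ` A) - growth * \<Lambda> t A)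
            \<le> \<bar>1 / t - growth\<bar> + (real (hits 0 A) / t) / hit_series t {a..b}"
          using ev
        proof eventually_elim
          case (elim t)
          define D where "D = hit_series t {a..b}"
          have D: "D > 0" and t: "0 < t" "t * growth < 1" using elim by (auto simp: D_def)
          have eq: "hit_series t A = real (hits 0 A) + t * hit_series t (f ` A)"
            using hit_series_image[OF t A] by simp
          \<comment> \<open>The first error vanishes because \<open>1 / t\<close> tends to
            \<open>growth\<close>, the second because the total \<open>D\<close> diverges.\<close>
          have "\<Lambda> t (f ` A) - growth * \<Lambda> t A = (1 / t - growth) * \<Lambda> t A - (real (hits 0 A) / t) / D"
            using t D unfolding \<Lambda>_def D_def[symmetric] eq by (simp add: field_simps)
          also have "norm \<dots> \<le> \<bar>(1 / t - growth) * \<Lambda> t A\<bar> + \<bar>(real (hits 0 A) / t) / D\<bar>"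
            unfolding real_norm_def by (rule abs_triangle_ineq4)
          also have "\<bar>(1 / t - growth) * \<Lambda> t A\<bar> \<le> \<bar>1 / t - growth\<bar>"
          proof -
            have "0 \<le> \<Lambda> t A" "\<Lambda> t A \<le> 1"
              using D t hit_series_nonneg hit_series_le unfolding \<Lambda>_def D_def by (auto simp: divide_le_eq_1)
            then show ?thesis by (simp add: abs_mult mult_left_le)
          qed
          also have "\<bar>(real (hits 0 A) / t) / D\<bar> = (real (hits 0 A) / t) / D" using t D by simp
          finally show ?case by (simp add: D_def)
        qed
      qed
    qed (intro tendsto_intros L)
    then show "L (f ` A) = growth * L A" by simp
  qed
qed

text \<open>Neither strictness nor normalisation is built in, so that
  \<open>\<theta> - m * \<psi>\<close> qualifies when it is monotone, even if it is constant. The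
  absolute value makes the orientation of \<open>f\<close> irrelevant.\<close>

definition slope_function :: "real \<Rightarrow> (real \<Rightarrow> real) \<Rightarrow> bool" where
  "slope_function c \<phi> \<longleftrightarrow> continuous_on {a..b} \<phi> \<and> mono_on {a..b} \<phi> \<and>
     (\<forall>u v. a \<le> u \<longrightarrow> u < v \<longrightarrow> v \<le> b \<longrightarrow> T \<inter> {u<..<v} = {} \<longrightarrow> \<bar>\<phi> (f v) - \<phi> (f u)\<bar> = c * (\<phi> v - \<phi> u))"

lemma slope_functionD:
  assumes "slope_function c \<phi>"
  shows "continuous_on {a..b} \<phi>"
    and "a \<le> u \<Longrightarrow> u \<le> v \<Longrightarrow> v \<le> b \<Longrightarrow> \<phi> u \<le> \<phi> v"
    and "a \<le> u \<Longrightarrow> u < v \<Longrightarrow> v \<le> b \<Longrightarrow> T \<inter> {u<..<v} = {} \<Longrightarrow> \<bar>\<phi> (f v) - \<phi> (f u)\<bar> = c * (\<phi> v - \<phi> u)"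
  using assms unfolding slope_function_def mono_on_def by auto

lemma slope_function_lipschitz:
  assumes \<phi>: "slope_function c \<phi>" and xy: "x \<in> {a..b}" "y \<in> {a..b}"
  shows "\<bar>\<phi> (f x) - \<phi> (f y)\<bar> \<le> c * \<bar>\<phi> x - \<phi> y\<bar>"
proof -
  have *: "\<bar>\<phi> (f v) - \<phi> (f u)\<bar> \<le> c * (\<phi> v - \<phi> u)" if uv: "u < v" "a \<le> u" "v \<le> b" for u v
  proof -
    have "a \<le> u \<longrightarrow> v \<le> b \<longrightarrow> \<bar>\<phi> (f v) - \<phi> (f u)\<bar> \<le> c * (\<phi> v - \<phi> u)"
      using finite_T \<open>u < v\<close>
    proof (induction rule: cut_induct)
      case (uncut x y)
      then show ?case using slope_functionD(3)[OF \<phi>] by simp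
    next
      case (split x w y)
      then show ?case by (auto simp: right_diff_distrib)
    qed
    then show ?thesis using uv by simp
  qed
  have **: "\<bar>\<phi> (f v) - \<phi> (f u)\<bar> \<le> c * \<bar>\<phi> v - \<phi> u\<bar>" if uv: "u < v" "a \<le> u" "v \<le> b" for u v
    using *[OF uv] slope_functionD(2)[OF \<phi>, of u v] uv by simp
  show ?thesis
    using **[of x y] **[of y x] xy by (cases x y rule: linorder_cases) (auto simp: abs_minus_commute)
qed

lemma slope_function_lipschitz_iter:
  assumes \<phi>: "slope_function c \<phi>" and "0 \<le> c" and xy: "x \<in> {a..b}" "y \<in> {a..b}"
  shows "\<bar>\<phi> ((f ^^ n) x) - \<phi> ((f ^^ n) y)\<bar> \<le> c ^ n * \<bar>\<phi> x - \<phi> y\<bar>"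
proof (induction n)
  case (Suc n)
  have "\<bar>\<phi> ((f ^^ Suc n) x) - \<phi> ((f ^^ Suc n) y)\<bar> \<le> c * \<bar>\<phi> ((f ^^ n) x) - \<phi> ((f ^^ n) y)\<bar>"
    using slope_function_lipschitz[OF \<phi> iter_in[OF xy(1), of n] iter_in[OF xy(2), of n]] by simp
  also have "\<dots> \<le> c * (c ^ n * \<bar>\<phi> x - \<phi> y\<bar>)" using Suc \<open>0 \<le> c\<close> by (rule mult_left_mono)
  finally show ?case by (simp add: mult_ac)
qed simp

text \<open>By the Lipschitz bound, \<open>constant_if_locally_constant\<close> applies: a flat
  interval would make \<open>\<phi>\<close> constant.\<close>

lemma slope_function_strict_mono:
  assumes \<phi>: "slope_function c \<phi>" and "\<phi> a < \<phi> b"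
  shows "strict_mono_on {a..b} \<phi>"
proof (rule strict_mono_onI)
  fix u v assume uv: "u \<in> {a..b}" "v \<in> {a..b}" "u < v"
  have "\<phi> u \<noteq> \<phi> v"
  proof
    assume eq: "\<phi> u = \<phi> v"
    have const: "\<phi> x = \<phi> u" if "x \<in> {u..v}" for x
      using slope_functionD(2)[OF \<phi>, of u x] slope_functionD(2)[OF \<phi>, of x v] eq that uv by auto
    have "a \<le> u" "v \<le> b" "a \<in> {a..b}" "b \<in> {a..b}" using uv less by auto
    then have "\<phi> a = \<phi> b"
      using constant_if_locally_constant[OF slope_functionD(1)[OF \<phi>] slope_function_lipschitz[OF \<phi>]
          _ uv(3) _ const] by blast
    then show False using assms by simp
  qed
  then show "\<phi> u < \<phi> v" using slope_functionD(2)[OF \<phi>, of u v] uv by auto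
qed

lemma slope_function_uncut:
  assumes \<phi>: "slope_function c \<phi>" and uv: "a \<le> u" "u < v" "v \<le> b" "cuts n \<inter> {u<..<v} = {}"
  shows "\<bar>\<phi> ((f ^^ n) v) - \<phi> ((f ^^ n) u)\<bar> = c ^ n * (\<phi> v - \<phi> u)"
  using uv(4)
proof (induction n)
  case 0
  then show ?case using slope_functionD(2)[OF \<phi>, of u v] uv by simp
next
  case (Suc n)
  have "cuts n \<subseteq> cuts (Suc n)" using cuts_add[of n 1] by auto
  then have un: "cuts n \<inter> {u<..<v} = {}" using Suc.prems by blast
  obtain p q where pq: "p < q" "a \<le> p" "q \<le> b"
    "(p = (f ^^ n) u \<and> q = (f ^^ n) v) \<or> (p = (f ^^ n) v \<and> q = (f ^^ n) u)"
    and im: "(f ^^ n) ` {u..v} = {p..q}" "(f ^^ n) ` {u<..<v} = {p<..<q}"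
    and laps: "\<forall>m. laps (n + m) u v = laps m p q"
    by (rule uncut_image[OF uv(1-3) un])
  have "laps (Suc 0) p q = 1" using laps[rule_format, of 1] laps_uncut[OF Suc.prems] by simp
  then have "card (cuts (Suc 0) \<inter> {p<..<q}) = 0" by (simp add: laps_def)
  then have "cuts (Suc 0) \<inter> {p<..<q} = {}" using finite_cuts[of "Suc 0"] by simp
  then have "T \<inter> {a..b} \<inter> {p<..<q} = {}" by (simp add: cuts_Suc_0)
  moreover have "{p<..<q} \<subseteq> {a..b}" using pq by auto
  ultimately have "T \<inter> {p<..<q} = {}" by blast
  then have "\<bar>\<phi> (f q) - \<phi> (f p)\<bar> = c * (\<phi> q - \<phi> p)"
    using slope_functionD(3)[OF \<phi>] pq by blast
  moreover have "\<phi> q - \<phi> p = c ^ n * (\<phi> v - \<phi> u)"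
    using Suc.IH[OF un] slope_functionD(2)[OF \<phi>, of p q] pq by (auto simp: abs_if split: if_splits)
  ultimately show ?case using pq(4) by (auto simp: abs_minus_commute mult.assoc)
qed

lemma growth_slope_function_exists:
  obtains \<psi> where "slope_function growth \<psi>" "\<psi> a = 0" "\<psi> b = 1"
proof -
  obtain L :: "real set \<Rightarrow> real" where L: "\<And>A. 0 \<le> L A" "L {a..b} = 1" "\<And>x. L {x} = 0"
    "\<And>A B. A \<inter> B = {} \<Longrightarrow> L (A \<union> B) = L A + L B"
    "\<And>A. inj_on f A \<Longrightarrow> A \<subseteq> {a..b} \<Longrightarrow> L (f ` A) = growth * L A"
    using conformal_charge_exists by blast
  have L_mono: "L A \<le> L B" if "A \<subseteq> B" for A B
  proof -
    have "L B = L A + L (B - A)" using L(4)[of A "B - A"] that by (simp add: Un_absorb1)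
    then show ?thesis using L(1)[of "B - A"] by simp
  qed
  \<comment> \<open>The empty set and points have charge 0, so \<open>\<psi> a = 0\<close>, and
    increments are charges of open intervals.\<close>
  define \<psi> where "\<psi> = (\<lambda>x. L {a..<x})"
  have open_eq: "L {u<..<v} = \<psi> v - \<psi> u" if "a \<le> u" "u < v" for u v
  proof -
    have "{a..<v} = {a..<u} \<union> ({u} \<union> {u<..<v})" using that by auto
    then have "\<psi> v = L {a..<u} + L ({u} \<union> {u<..<v})"
      unfolding \<psi>_def by (simp only:) (rule L(4), auto)
    also have "L ({u} \<union> {u<..<v}) = L {u} + L {u<..<v}" by (rule L(4)) auto
    finally show ?thesis using L(3) by (simp add: \<psi>_def)
  qed
  have mono: "\<psi> u \<le> \<psi> v" if "u \<le> v" for u v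
    unfolding \<psi>_def using that by (intro L_mono) auto
  have iter_eq: "L ((f ^^ n) ` A) = growth ^ n * L A" if "inj_on (f ^^ n) A" "A \<subseteq> {a..b}" for n A
    using that
  proof (induction n)
    case (Suc n)
    have "inj_on (f \<circ> (f ^^ n)) A" using Suc.prems by (simp add: o_def)
    then have "inj_on (f ^^ n) A" "inj_on f ((f ^^ n) ` A)"
      using inj_on_imageI inj_on_imageI2 by blast+
    moreover have "(f ^^ n) ` A \<subseteq> {a..b}" using iter_in[of _ n] Suc.prems(2) by blast
    ultimately show ?case using L(5)[of "(f ^^ n) ` A"] Suc by (simp add: image_comp)
  qed simp
  have small: "\<psi> v - \<psi> u \<le> (1 / growth) ^ n"
    if uv: "a \<le> u" "u < v" "v \<le> b" "cuts n \<inter> {u<..<v} = {}" for u v n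
  proof -
    have inj: "inj_on (f ^^ n) {u<..<v}" by (rule inj_on_subset[OF inj_on_iter[OF uv]]) auto
    have "{u<..<v} \<subseteq> {a..b}" using uv by auto
    then have "growth ^ n * (\<psi> v - \<psi> u) = L ((f ^^ n) ` {u<..<v})" 
      using iter_eq[OF inj] open_eq uv by simp
    also have "\<dots> \<le> L {a..b}" 
      using iter_in[of _ n] \<open>{u<..<v} \<subseteq> {a..b}\<close> by (intro L_mono) blast
    finally show ?thesis using L(2) growth_gt_1 by (simp add: field_simps power_divide)
  qed
  have "continuous_on {a..b} \<psi>"
    unfolding continuous_on_iff
  proof (intro ballI allI impI)
    fix x e :: real assume x: "x \<in> {a..b}" and "0 < e"
    obtain n where n: "(1 / growth) ^ n < e"
      using real_arch_pow_inv[OF \<open>0 < e\<close>, of "1 / growth"] growth_gt_1 by auto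
    \<comment> \<open>The point \<open>x\<close> is removed: it may be a cut itself, but only cuts
      strictly between \<open>x\<close> and the nearby point matter.\<close>
    define D where "D = cuts n - {x}"
    have "finite D" "x \<notin> D" using finite_cuts by (auto simp: D_def)
    then obtain d where d: "d > 0" "\<And>y. y \<in> D \<Longrightarrow> d \<le> dist x y"
      using finite_set_avoid[of D x] by metis
    show "\<exists>d>0. \<forall>x'\<in>{a..b}. dist x' x < d \<longrightarrow> dist (\<psi> x') (\<psi> x) < e"
    proof (intro exI[of _ d] conjI ballI impI)
      fix y assume y: "y \<in> {a..b}" "dist y x < d"
      have no: "cuts n \<inter> {min x y<..<max x y} = {}"
      proof -
        have "w \<notin> cuts n" if "w \<in> {min x y<..<max x y}" for w
        proof
          assume "w \<in> cuts n"
          then have "w \<in> D" using that by (auto simp: D_def min_def max_def split: if_splits)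
          then show False using d(2)[of w] that y by (auto simp: dist_real_def min_def max_def split: if_splits)
        qed
        then show ?thesis by blast
      qed
      show "dist (\<psi> y) (\<psi> x) < e"
      proof (cases x y rule: linorder_cases)
        case less
        then show ?thesis using small[of x y n] no n x y mono[of x y] by (simp add: dist_real_def)
      next
        case greater
        then show ?thesis using small[of y x n] no n x y mono[of y x] by (simp add: dist_real_def)
      qed (use \<open>0 < e\<close> in simp)
    qed (fact d)
  qed
  moreover have "\<bar>\<psi> (f v) - \<psi> (f u)\<bar> = growth * (\<psi> v - \<psi> u)"
    if uv: "a \<le> u" "u < v" "v \<le> b" "T \<inter> {u<..<v} = {}" for u v
  proof -
    note inj = inj_uncut[OF uv]
    have c: "continuous_on {u..v} f" by (rule continuous_on_subset[OF cont]) (use uv in auto)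
    obtain p q where pq: "p < q" "(p = f u \<and> q = f v) \<or> (p = f v \<and> q = f u)"
      "f ` {u..v} = {p..q}" "f ` {u<..<v} = {p<..<q}"
      by (rule inj_continuous_image_interval[OF uv(2) c inj])
    have "u \<in> {a..b}" "v \<in> {a..b}" using uv by auto
    then have "a \<le> f u" "a \<le> f v" using iter_in[of _ 1] by auto
    then have "a \<le> p" using pq(2) by auto
    have inj': "inj_on f {u<..<v}" by (rule inj_on_subset[OF inj]) auto
    have "{u<..<v} \<subseteq> {a..b}" using uv by auto
    then have "\<psi> q - \<psi> p = growth * (\<psi> v - \<psi> u)"
      using L(5)[OF inj'] open_eq[OF \<open>a \<le> p\<close> pq(1)] open_eq[OF uv(1,2)] pq(4) by simp
    then show ?thesis using pq(1,2) mono[of p q] by (auto simp: abs_if)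
  qed
  ultimately have "slope_function growth \<psi>"
    unfolding slope_function_def mono_on_def using mono by blast
  moreover have "\<psi> a = 0" using L(4)[of "{}" "{}"] by (simp add: \<psi>_def)
  moreover have "\<psi> b = 1"
  proof -
    have "{a..b} = {a..<b} \<union> {b}" using less by auto
    then have "L {a..b} = L {a..<b} + L {b}" by (simp only:) (rule L(4), auto)
    then show ?thesis using L(2,3) by (simp add: \<psi>_def)
  qed
  ultimately show ?thesis using that by blast
qed

end

subsection \<open>Entropy\<close>

lemma finite_gap:
  fixes C :: "real set"
  assumes "finite C"
  obtains \<epsilon> where "\<epsilon> > 0" "\<And>p q. p \<in> C \<Longrightarrow> q \<in> C \<Longrightarrow> p < q \<Longrightarrow> \<epsilon> < q - p"
proof -
  define D where "D = (\<lambda>(p, q). q - p) ` {(p, q) \<in> C \<times> C. p < q}"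
  have "finite {(p, q) \<in> C \<times> C. p < q}"
    by (rule finite_subset[of _ "C \<times> C"]) (use assms in auto)
  then have fin: "finite D" unfolding D_def by (rule finite_imageI)
  \<comment> \<open>The 1 keeps \<open>Min\<close> meaningful when \<open>C\<close> has fewer than
    two points; halving makes the inequality strict.\<close>
  define \<epsilon> where "\<epsilon> = Min (insert 1 D) / 2"
  have "0 < Min (insert 1 D)" using fin by (auto simp: Min_gr_iff D_def)
  moreover have "Min (insert 1 D) \<le> q - p" if "p \<in> C" "q \<in> C" "p < q" for p q
    using fin that by (intro Min_le) (auto simp: D_def)
  ultimately have "\<epsilon> > 0" "\<And>p q. p \<in> C \<Longrightarrow> q \<in> C \<Longrightarrow> p < q \<Longrightarrow> \<epsilon> < q - p"
    unfolding \<epsilon>_def by fastforce+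
  then show ?thesis by (rule that)
qed

context cut_interval_map
begin

text \<open>This is uniform continuity of the inverse of \<open>\<phi>\<close> on the compact image,
  in contrapositive form.\<close>

lemma slope_function_uniformly_expands:
  assumes \<phi>: "slope_function c \<phi>" and ab: "\<phi> a < \<phi> b" and "\<epsilon> > 0"
  obtains \<delta> where "\<delta> > 0"
    "\<And>x y. x \<in> {a..b} \<Longrightarrow> y \<in> {a..b} \<Longrightarrow> \<epsilon> \<le> \<bar>x - y\<bar> \<Longrightarrow> \<delta> \<le> \<bar>\<phi> x - \<phi> y\<bar>"
proof -
  define g where "g = inv_into {a..b} \<phi>"
  have "inj_on \<phi> {a..b}"
    using slope_function_strict_mono[OF \<phi> ab] by (rule strict_mono_on_imp_inj_on)
  then have g: "g (\<phi> x) = x" if "x \<in> {a..b}" for x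
    using that by (simp add: g_def)
  have "continuous_on (\<phi> ` {a..b}) g"
    using slope_functionD(1)[OF \<phi>] g by (intro continuous_on_inv) auto
  moreover have "compact (\<phi> ` {a..b})"
    using slope_functionD(1)[OF \<phi>] by (intro compact_continuous_image) auto
  ultimately have "uniformly_continuous_on (\<phi> ` {a..b}) g" by (rule compact_uniformly_continuous)
  then obtain \<delta> where \<delta>: "\<delta> > 0"
    "\<And>s t. s \<in> \<phi> ` {a..b} \<Longrightarrow> t \<in> \<phi> ` {a..b} \<Longrightarrow> dist t s < \<delta> \<Longrightarrow> dist (g t) (g s) < \<epsilon>"
    unfolding uniformly_continuous_on_def using \<open>\<epsilon> > 0\<close> by meson
  show ?thesis
  proof
    fix x y assume xy: "x \<in> {a..b}" "y \<in> {a..b}" "\<epsilon> \<le> \<bar>x - y\<bar>"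
    show "\<delta> \<le> \<bar>\<phi> x - \<phi> y\<bar>"
    proof (rule ccontr)
      assume "\<not> \<delta> \<le> \<bar>\<phi> x - \<phi> y\<bar>"
      then have "dist (g (\<phi> x)) (g (\<phi> y)) < \<epsilon>" using \<delta>(2)[of "\<phi> y" "\<phi> x"] xy by (simp add: dist_real_def)
      then show False using g xy by (simp add: dist_real_def)
    qed
  qed (fact \<delta>)
qed

text \<open>In the coordinate \<open>\<psi>\<close> distances grow at most by the factor
  \<open>c\<close> per step, so points separated before time \<open>n\<close> start at least
  \<open>\<delta> / c ^ n\<close> apart in an interval of length 1.\<close>

lemma card_separated_le_slope:
  assumes \<psi>: "slope_function c \<psi>" "\<psi> a = 0" "\<psi> b = 1" and "c > 1" "\<epsilon> > 0"
  obtains K where "K \<ge> 1"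
    "\<And>n E. E \<subseteq> {a..b} \<Longrightarrow> finite E \<Longrightarrow> separated f n \<epsilon> E \<Longrightarrow> real (card E) \<le> K * c ^ n"
proof -
  have ab: "\<psi> a < \<psi> b" using \<psi> by simp
  obtain \<delta> where \<delta>: "\<delta> > 0"
    "\<And>x y. x \<in> {a..b} \<Longrightarrow> y \<in> {a..b} \<Longrightarrow> \<epsilon> \<le> \<bar>x - y\<bar> \<Longrightarrow> \<delta> \<le> \<bar>\<psi> x - \<psi> y\<bar>"
    using slope_function_uniformly_expands[OF \<psi>(1) ab \<open>\<epsilon> > 0\<close>] by blast
  have inj: "inj_on \<psi> {a..b}"
    using slope_function_strict_mono[OF \<psi>(1) ab] by (rule strict_mono_on_imp_inj_on)
  have "real (card E) \<le> (1 / \<delta> + 1) * c ^ n"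
    if E: "E \<subseteq> {a..b}" "finite E" "separated f n \<epsilon> E" for n E
  proof -
    have "real (card (\<psi> ` E)) \<le> (1 - 0) / (\<delta> / c ^ n) + 1"
    proof (rule card_separated_le)
      show "\<psi> ` E \<subseteq> {0..1}"
        using slope_functionD(2)[OF \<psi>(1), of a] slope_functionD(2)[OF \<psi>(1), of _ b] \<psi>(2,3) E(1) by force
      show "0 < \<delta> / c ^ n" using \<delta> \<open>c > 1\<close> by simp
      fix s t assume "s \<in> \<psi> ` E" "t \<in> \<psi> ` E" "s < t"
      then obtain x y where xy: "x \<in> E" "y \<in> E" "x \<noteq> y" "s = \<psi> x" "t = \<psi> y" by blast
      then obtain k where k: "k < n" "\<epsilon> < dist ((f ^^ k) x) ((f ^^ k) y)"
        using E(3) unfolding separated_def by blast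
      have I: "x \<in> {a..b}" "y \<in> {a..b}" using xy E by auto
      have "\<delta> \<le> \<bar>\<psi> ((f ^^ k) x) - \<psi> ((f ^^ k) y)\<bar>"
        using \<delta>(2)[OF iter_in[OF I(1)] iter_in[OF I(2)]] k by (simp add: dist_real_def)
      also have "\<dots> \<le> c ^ k * \<bar>\<psi> x - \<psi> y\<bar>"
        using \<open>c > 1\<close> by (intro slope_function_lipschitz_iter[OF \<psi>(1) _ I]) simp
      also have "\<dots> \<le> c ^ n * \<bar>\<psi> x - \<psi> y\<bar>"
        using k \<open>c > 1\<close> by (intro mult_right_mono power_increasing) auto
      finally show "\<delta> / c ^ n \<le> t - s"
        using \<open>s < t\<close> xy \<open>c > 1\<close> by (simp add: field_simps)
    qed (use E in auto)
    also have "card (\<psi> ` E) = card E" by (rule card_image[OF inj_on_subset[OF inj E(1)]])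
    also have "(1 - 0) / (\<delta> / c ^ n) + 1 = 1 / \<delta> * c ^ n + 1" by simp
    also have "\<dots> \<le> 1 / \<delta> * c ^ n + c ^ n" using \<open>c > 1\<close> by (simp add: one_le_power)
    finally show ?thesis by (simp add: distrib_right)
  qed
  then show ?thesis using that[of "1 / \<delta> + 1"] \<delta>(1) by simp
qed

lemma topological_entropy_le_slope:
  assumes \<psi>: "slope_function c \<psi>" "\<psi> a = 0" "\<psi> b = 1" and "c > 1"
  shows "topological_entropy {a..b} f \<le> ereal (ln c)"
  unfolding topological_entropy_def
proof (rule SUP_least)
  fix \<epsilon> :: real assume "\<epsilon> \<in> {0<..}"
  then obtain K where K: "K \<ge> 1"
    "\<And>n E. E \<subseteq> {a..b} \<Longrightarrow> finite E \<Longrightarrow> separated f n \<epsilon> E \<Longrightarrow> real (card E) \<le> K * c ^ n"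
    using card_separated_le_slope[OF \<psi> \<open>c > 1\<close>, of \<epsilon>] by auto
  define u where "u = (\<lambda>n. SUP E\<in>{E. E \<subseteq> {a..b} \<and> finite E \<and> separated f n \<epsilon> E}. ereal (ln (real (card E)) / real n))"
  have "u n \<le> ereal (ln c + ln K / real n)" if "n \<ge> 1" for n
    unfolding u_def
  proof (rule SUP_least)
    fix E assume "E \<in> {E. E \<subseteq> {a..b} \<and> finite E \<and> separated f n \<epsilon> E}"
    then have "real (card E) \<le> K * c ^ n" using K by blast
    moreover have "1 \<le> K * c ^ n" using K(1) \<open>c > 1\<close> by (meson less_imp_le mult_ge1_I one_le_power)
    \<comment> \<open>For empty \<open>E\<close> the left side is \<open>ln 0 = 0\<close>, hence the
      need for \<open>1 \<le> K * c ^ n\<close>.\<close>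
    ultimately have "ln (real (card E)) \<le> ln (K * c ^ n)" by (cases "card E = 0") auto
    also have "\<dots> = ln K + real n * ln c" using K(1) \<open>c > 1\<close> by (simp add: ln_mult ln_realpow)
    finally have "ln (real (card E)) / real n \<le> (ln K + real n * ln c) / real n" by (rule divide_right_mono) simp
    then show "ereal (ln (real (card E)) / real n) \<le> ereal (ln c + ln K / real n)"
      using that by (simp add: add_divide_distrib add.commute)
  qed
  then have "\<forall>\<^sub>F n in sequentially. u n \<le> ereal (ln c + ln K / real n)"
    unfolding eventually_sequentially by blast
  then have "limsup u \<le> limsup (\<lambda>n. ereal (ln c + ln K / real n))" by (rule Limsup_mono)
  also have "\<dots> = ereal (ln c)"
  proof (rule lim_imp_Limsup)
    have "(\<lambda>n. ln c + ln K / real n) \<longlonglongrightarrow> ln c + 0"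
      by (intro tendsto_add tendsto_const lim_const_over_n)
    then show "(\<lambda>n. ereal (ln c + ln K / real n)) \<longlonglongrightarrow> ereal (ln c)" by simp
  qed simp
  finally show "limsup (\<lambda>n. SUP E\<in>{E. E \<subseteq> {a..b} \<and> finite E \<and> separated f n \<epsilon> E}. ereal (ln (real (card E)) / real n))
      \<le> ereal (ln c)" unfolding u_def .
qed

section \<open>Lower bound for the entropy by itineraries\<close>

lemma lap_representatives:
  obtains Y where "Y \<subseteq> {a<..<b}" "finite Y" "card Y = laps n a b"
    "\<And>y y'. y \<in> Y \<Longrightarrow> y' \<in> Y \<Longrightarrow> y < y' \<Longrightarrow> cuts n \<inter> {y<..<y'} \<noteq> {}"
proof -
  have *: "\<exists>Y. Y \<subseteq> {u<..<v} \<and> finite Y \<and> card Y = laps n u v \<and>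
      (\<forall>y\<in>Y. \<forall>y'\<in>Y. y < y' \<longrightarrow> cuts n \<inter> {y<..<y'} \<noteq> {})" if "u < v" for u v
    using finite_cuts[of n] that
  proof (induction rule: cut_induct)
    case (uncut x y)
    then show ?case using laps_uncut[OF uncut(4)] by (intro exI[of _ "{(x + y) / 2}"]) auto
  next
    case (split x w y)
    then obtain Y Z where Y: "Y \<subseteq> {x<..<w}" "finite Y" "card Y = laps n x w"
        "\<forall>y\<in>Y. \<forall>y'\<in>Y. y < y' \<longrightarrow> cuts n \<inter> {y<..<y'} \<noteq> {}"
      and Z: "Z \<subseteq> {w<..<y}" "finite Z" "card Z = laps n w y"
        "\<forall>y\<in>Z. \<forall>y'\<in>Z. y < y' \<longrightarrow> cuts n \<inter> {y<..<y'} \<noteq> {}" by blast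
    have "Y \<inter> Z = {}" using Y(1) Z(1) by fastforce
    then have "card (Y \<union> Z) = laps n x y"
      using Y Z laps_split[OF split(5,2,3)] by (simp add: card_Un_disjoint)
    moreover have "cuts n \<inter> {p<..<q} \<noteq> {}" if pq: "p \<in> Y \<union> Z" "q \<in> Y \<union> Z" "p < q" for p q
    proof -
      consider "p \<in> Y" "q \<in> Y" | "p \<in> Z" "q \<in> Z" | "p < w" "w < q" | "q < w" "w < p"
        using pq(1,2) Y(1) Z(1) by fastforce
      then show ?thesis
      proof cases
        case 3
        then show ?thesis using split(5) by auto
      qed (use Y(4) Z(4) pq in auto)
    qed
    moreover have "Y \<union> Z \<subseteq> {x<..<y}" using Y(1) Z(1) split(2,3) by fastforce
    ultimately show ?case using Y(2) Z(2) by (intro exI[of _ "Y \<union> Z"]) auto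
  qed
  show ?thesis using *[OF less] that by blast
qed

text \<open>Counting the cuts to the left numbers the laps of order \<open>k\<close>, sampled every
  \<open>k\<close> steps. Integers allow subtracting 1, and the restriction to \<open>{..<m}\<close>
  places itineraries in a finite \<open>PiE\<close>.\<close>

definition itinerary :: "nat \<Rightarrow> nat \<Rightarrow> real \<Rightarrow> nat \<Rightarrow> int" where
  "itinerary k m y = (\<lambda>j\<in>{..<m}. int (card (cuts k \<inter> {..<(f ^^ (j * k)) y})))"

lemma cut_count_diff:
  assumes "p \<le> q"
  shows "card (cuts k \<inter> {..<q}) = card (cuts k \<inter> {..<p}) + card (cuts k \<inter> {p..<q})"
proof -
  have "cuts k \<inter> {..<q} = (cuts k \<inter> {..<p}) \<union> (cuts k \<inter> {p..<q})" using assms by auto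
  then show ?thesis using finite_cuts by (simp only:) (rule card_Un_disjoint, auto)
qed

text \<open>Block by block: as long as there is no cut between the points, their images bound the
  image interval, and equal counts at both ends leave no cut of order \<open>k\<close> inside
  it.\<close>

lemma itinerary_eq_imp_uncut:
  assumes "y \<in> {a..b}" "y' \<in> {a..b}" "y < y'" "itinerary k m y = itinerary k m y'"
  shows "cuts (m * k) \<inter> {y<..<y'} = {}"
proof -
  have eq: "card (cuts k \<inter> {..<(f ^^ (j * k)) y}) = card (cuts k \<inter> {..<(f ^^ (j * k)) y'})" if "j < m" for j
    using fun_cong[OF assms(4), of j] that by (simp add: itinerary_def)
  have "cuts (i * k) \<inter> {y<..<y'} = {}" if "i \<le> m" for i
    using that
  proof (induction i)
    case 0
    then show ?case by (simp add: cuts_0)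
  next
    case (Suc i)
    then have un: "cuts (i * k) \<inter> {y<..<y'} = {}" and "i < m" by auto
    have "a \<le> y" "y' \<le> b" using assms by auto
    obtain p q where pq: "p < q" "a \<le> p" "q \<le> b"
      "(p = (f ^^ (i * k)) y \<and> q = (f ^^ (i * k)) y') \<or> (p = (f ^^ (i * k)) y' \<and> q = (f ^^ (i * k)) y)"
      and im: "(f ^^ (i * k)) ` {y..y'} = {p..q}" "(f ^^ (i * k)) ` {y<..<y'} = {p<..<q}"
      and "\<forall>n. laps (i * k + n) y y' = laps n p q"
      by (rule uncut_image[OF \<open>a \<le> y\<close> assms(3) \<open>y' \<le> b\<close> un])
    have "card (cuts k \<inter> {..<p}) = card (cuts k \<inter> {..<q})" using eq[OF \<open>i < m\<close>] pq(4) by auto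
    then have "card (cuts k \<inter> {p..<q}) = 0" using cut_count_diff[of p q k] pq(1) by simp
    then have no: "cuts k \<inter> {p..<q} = {}" using finite_cuts by simp
    have "(f ^^ (i * k)) x \<notin> cuts k" if "x \<in> {y<..<y'}" for x
    proof -
      have "(f ^^ (i * k)) x \<in> {p<..<q}" using that im(2) by blast
      then have "(f ^^ (i * k)) x \<in> {p..<q}" by simp
      then show ?thesis using no by blast
    qed
    moreover have "cuts (Suc i * k) = cuts (i * k) \<union> {x \<in> {a..b}. (f ^^ (i * k)) x \<in> cuts k}"
      using cuts_add[of "i * k" k] by (simp add: add.commute)
    ultimately show ?case using un by blast
  qed
  then show ?thesis by simp
qed

text \<open>An interval no longer than \<open>\<epsilon>\<close> contains at most one cut of order
  \<open>k\<close>, so \<open>\<epsilon>\<close>-close points have counts that differ by at most 1.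
  These three possible values per block are the origin of the constant 3.\<close>

lemma itinerary_close:
  assumes gap: "\<And>p q. p \<in> cuts k \<Longrightarrow> q \<in> cuts k \<Longrightarrow> p < q \<Longrightarrow> \<epsilon> < q - p" and "k > 0"
    and close: "\<And>i. i < m * k \<Longrightarrow> dist ((f ^^ i) x) ((f ^^ i) y) \<le> \<epsilon>"
  shows "itinerary k m y \<in> PiE {..<m} (\<lambda>j. {itinerary k m x j - 1..itinerary k m x j + 1})"
proof -
  have le1: "card (cuts k \<inter> {p..<q}) \<le> 1" if "p \<le> q" "q - p \<le> \<epsilon>" for p q
  proof (rule ccontr)
    assume "\<not> ?thesis"
    then obtain s t where "s \<in> cuts k \<inter> {p..<q}" "t \<in> cuts k \<inter> {p..<q}" "s \<noteq> t"
      using finite_cuts[of k] by (metis card_le_Suc0_iff_eq finite_Int One_nat_def)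
    then have "s \<in> cuts k" "t \<in> cuts k" "s \<noteq> t" "\<bar>s - t\<bar> < \<epsilon>" using that by auto
    then show False using gap[of s t] gap[of t s] by (cases s t rule: linorder_cases) auto
  qed
  have diff: "card (cuts k \<inter> {..<q}) \<le> card (cuts k \<inter> {..<p}) + 1 \<and> card (cuts k \<inter> {..<p}) \<le> card (cuts k \<inter> {..<q}) + 1"
    if "\<bar>p - q\<bar> \<le> \<epsilon>" for p q
  proof (cases "p \<le> q")
    case True
    then show ?thesis using cut_count_diff[of p q k] le1[of p q] that by linarith
  next
    case False
    then show ?thesis using cut_count_diff[of q p k] le1[of q p] that by linarith
  qed
  show ?thesis
  proof (rule PiE_I)
    fix j assume j: "j \<in> {..<m}"
    then have "j * k < m * k" using \<open>k > 0\<close> by simp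
    then have "\<bar>(f ^^ (j * k)) x - (f ^^ (j * k)) y\<bar> \<le> \<epsilon>" using close by (simp add: dist_real_def)
    from diff[OF this] show "itinerary k m y j \<in> {itinerary k m x j - 1..itinerary k m x j + 1}"
      using j by (simp add: itinerary_def)
  qed (auto simp: itinerary_def)
qed

text \<open>Each Bowen ball of radius below the gaps of \<open>cuts k\<close> meets at most \<open>3\<^sup>m\<close> laps of \<open>f\<^sup>m\<^sup>k\<close>.\<close>

lemma separated_set_lower_bound:
  assumes "k > 0"
  obtains \<epsilon> where "\<epsilon> > 0"
    "\<And>m. \<exists>E. E \<subseteq> {a..b} \<and> finite E \<and> separated f (m * k) \<epsilon> E \<and> growth ^ (m * k) \<le> real (card E) * 3 ^ m"
proof -
  obtain \<psi> where \<psi>: "slope_function growth \<psi>" "\<psi> a = 0" "\<psi> b = 1" by (rule growth_slope_function_exists)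
  obtain \<epsilon> where \<epsilon>: "\<epsilon> > 0" "\<And>p q. p \<in> cuts k \<Longrightarrow> q \<in> cuts k \<Longrightarrow> p < q \<Longrightarrow> \<epsilon> < q - p"
    using finite_gap[OF finite_cuts[of k]] by blast
  \<comment> \<open>The cardinality bound guarantees that a separated set of maximal cardinality
    exists.\<close>
  obtain K where K: "\<And>n E. E \<subseteq> {a..b} \<Longrightarrow> finite E \<Longrightarrow> separated f n \<epsilon> E \<Longrightarrow> real (card E) \<le> K * growth ^ n"
    using card_separated_le_slope[OF \<psi> growth_gt_1 \<epsilon>(1)] by blast
  have "\<exists>E. E \<subseteq> {a..b} \<and> finite E \<and> separated f (m * k) \<epsilon> E \<and> growth ^ (m * k) \<le> real (card E) * 3 ^ m" for m
  proof -
    let ?P = "\<lambda>E. E \<subseteq> {a..b} \<and> finite E \<and> separated f (m * k) \<epsilon> E"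
    have "?P {}" by (simp add: separated_def)
    moreover have "\<forall>E. ?P E \<longrightarrow> card E < Suc (nat \<lfloor>K * growth ^ (m * k)\<rfloor>)"
      using K by (simp add: le_nat_floor less_Suc_eq_le)
    ultimately have "\<exists>E. ?P E \<and> (\<forall>E'. ?P E' \<longrightarrow> card E' \<le> card E)"
      by (rule Lattices_Big.ex_has_greatest_nat)
    then obtain E where E: "?P E" "\<And>E'. ?P E' \<Longrightarrow> card E' \<le> card E" by blast
    \<comment> \<open>A point far from all of \<open>E\<close> could be added to \<open>E\<close>,
      against maximality; hence the Bowen balls around \<open>E\<close> cover
      \<open>{a..b}\<close>.\<close>
    have span: "\<exists>x\<in>E. \<forall>i<m * k. dist ((f ^^ i) x) ((f ^^ i) y) \<le> \<epsilon>" if y: "y \<in> {a..b}" for y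
    proof (cases "y \<in> E")
      case True
      then show ?thesis using \<epsilon>(1) by (intro bexI[of _ y]) auto
    next
      case False
      show ?thesis
      proof (rule ccontr)
        assume "\<not> ?thesis"
        then have sep: "\<exists>i<m * k. \<epsilon> < dist ((f ^^ i) x) ((f ^^ i) y)" if "x \<in> E" for x
          using that by (metis not_le)
        have sep': "\<exists>i<m * k. \<epsilon> < dist ((f ^^ i) y) ((f ^^ i) x)" if "x \<in> E" for x
          using sep[OF that] by (simp only: dist_commute)
        have "separated f (m * k) \<epsilon> (insert y E)"
          using E(1) sep sep' unfolding separated_def by blast
        then have "card (insert y E) \<le> card E" using E y by blast
        then show False using False E(1) by simp
      qed
    qed
    obtain Y where Y: "Y \<subseteq> {a<..<b}" "finite Y" "card Y = laps (m * k) a b"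
      "\<And>y y'. y \<in> Y \<Longrightarrow> y' \<in> Y \<Longrightarrow> y < y' \<Longrightarrow> cuts (m * k) \<inter> {y<..<y'} \<noteq> {}"
      using lap_representatives[of "m * k"] by blast
    have YI: "y \<in> {a..b}" if "y \<in> Y" for y using Y(1) that by fastforce
    have inj: "inj_on (itinerary k m) Y"
    proof (rule linorder_inj_onI)
      fix x y assume "x < y" "x \<in> Y" "y \<in> Y"
      then show "itinerary k m x \<noteq> itinerary k m y"
        using itinerary_eq_imp_uncut[of x y k m] YI Y(4) by blast
    qed (rule linorder_linear)
    define B where "B = (\<lambda>x. PiE {..<m} (\<lambda>j. {itinerary k m x j - 1..itinerary k m x j + 1}))"
    have B: "finite (B x)" "card (B x) = 3 ^ m" for x
      by (auto simp: B_def card_PiE intro!: finite_PiE)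
    have "itinerary k m ` Y \<subseteq> (\<Union>x\<in>E. B x)"
    proof (rule image_subsetI)
      fix y assume "y \<in> Y"
      then obtain x where "x \<in> E" "\<And>i. i < m * k \<Longrightarrow> dist ((f ^^ i) x) ((f ^^ i) y) \<le> \<epsilon>"
        using span YI by blast
      then show "itinerary k m y \<in> (\<Union>x\<in>E. B x)"
        using itinerary_close[OF \<epsilon>(2) \<open>k > 0\<close>, of m x y] unfolding B_def by blast
    qed
    then have "card (itinerary k m ` Y) \<le> card (\<Union>x\<in>E. B x)"
      using E(1) B(1) by (intro card_mono) auto
    also have "\<dots> \<le> (\<Sum>x\<in>E. card (B x))" using E(1) by (intro card_UN_le) auto
    also have "\<dots> = card E * 3 ^ m" by (simp add: B)
    finally have "laps (m * k) a b \<le> card E * 3 ^ m" using Y(3) card_image[OF inj] by simp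
    then have "real (laps (m * k) a b) \<le> real (card E * 3 ^ m)" by (rule of_nat_mono)
    then have "real (laps (m * k) a b) \<le> real (card E) * 3 ^ m" by simp
    then have "growth ^ (m * k) \<le> real (card E) * 3 ^ m" using growth_power_le[of "m * k"] by linarith
    then show ?thesis using E(1) by blast
  qed
  then show ?thesis using that \<epsilon>(1) by blast
qed

lemma topological_entropy_ge:
  assumes "k > 0"
  shows "ereal (ln growth - ln 3 / real k) \<le> topological_entropy {a..b} f"
proof -
  obtain \<epsilon> where \<epsilon>: "\<epsilon> > 0"
    "\<And>m. \<exists>E. E \<subseteq> {a..b} \<and> finite E \<and> separated f (m * k) \<epsilon> E \<and> growth ^ (m * k) \<le> real (card E) * 3 ^ m"
    using separated_set_lower_bound[OF assms] by blast
  define u where "u = (\<lambda>n. SUP E\<in>{E. E \<subseteq> {a..b} \<and> finite E \<and> separated f n \<epsilon> E}. ereal (ln (real (card E)) / real n))"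
  \<comment> \<open>\<open>Suc m\<close> keeps the order positive, since division by 0 gives
    0.\<close>
  have u: "ereal (ln growth - ln 3 / real k) \<le> u (Suc m * k)" for m
  proof -
    obtain E where E: "E \<subseteq> {a..b}" "finite E" "separated f (Suc m * k) \<epsilon> E"
      "growth ^ (Suc m * k) \<le> real (card E) * 3 ^ Suc m" using \<epsilon>(2) by blast
    have "0 < growth ^ (Suc m * k)" using growth_gt_1 by simp
    then have "0 < real (card E) * 3 ^ Suc m" using E(4) by linarith
    then have "0 < real (card E)" by (simp add: zero_less_mult_iff)
    have "real (Suc m * k) * ln growth = ln (growth ^ (Suc m * k))" using growth_gt_1 by (simp add: ln_realpow)
    also have "\<dots> \<le> ln (real (card E) * 3 ^ Suc m)"
      using E(4) \<open>0 < growth ^ (Suc m * k)\<close> by (simp only: ln_mono)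
    also have "\<dots> = ln (real (card E)) + real (Suc m) * ln 3"
      using \<open>0 < real (card E)\<close> by (simp add: ln_mult ln_realpow algebra_simps)
    finally have "ln growth * real (Suc m * k) - real (Suc m) * ln 3 \<le> ln (real (card E))" by (simp add: mult.commute)
    then have "(ln growth * real (Suc m * k) - real (Suc m) * ln 3) / real (Suc m * k) \<le> ln (real (card E)) / real (Suc m * k)"
      by (rule divide_right_mono) simp
    also have "(ln growth * real (Suc m * k) - real (Suc m) * ln 3) / real (Suc m * k) = ln growth - ln 3 / real k"
      using \<open>k > 0\<close> unfolding of_nat_mult by (simp add: diff_divide_distrib del: of_nat_Suc)
    finally have "ereal (ln growth - ln 3 / real k) \<le> ereal (ln (real (card E)) / real (Suc m * k))" by simp
    also have "\<dots> \<le> u (Suc m * k)" unfolding u_def using E by (intro SUP_upper) auto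
    finally show ?thesis .
  qed
  have "strict_mono (\<lambda>m. Suc m * k)" using \<open>k > 0\<close> by (simp add: strict_mono_def)
  then have "limsup (u \<circ> (\<lambda>m. Suc m * k)) \<le> limsup u" by (rule limsup_subseq_mono)
  moreover have "ereal (ln growth - ln 3 / real k) \<le> limsup (u \<circ> (\<lambda>m. Suc m * k))"
    using u by (intro le_Limsup) (auto intro!: always_eventually simp del: mult_Suc)
  moreover have "limsup u \<le> topological_entropy {a..b} f"
    unfolding topological_entropy_def u_def using \<epsilon>(1) by (intro SUP_upper) auto
  ultimately show ?thesis by order
qed

lemma topological_entropy_eq: "topological_entropy {a..b} f = ereal (ln growth)"
proof (rule antisym)
  obtain \<psi> where "slope_function growth \<psi>" "\<psi> a = 0" "\<psi> b = 1" by (rule growth_slope_function_exists)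
  then show "topological_entropy {a..b} f \<le> ereal (ln growth)"
    using growth_gt_1 by (rule topological_entropy_le_slope)
  have "(\<lambda>k. ln growth - ln 3 / real k) \<longlonglongrightarrow> ln growth - 0"
    by (intro tendsto_diff tendsto_const lim_const_over_n)
  then have "(\<lambda>k. ereal (ln growth - ln 3 / real k)) \<longlonglongrightarrow> ereal (ln growth)" by simp
  then show "ereal (ln growth) \<le> topological_entropy {a..b} f"
    by (rule LIMSEQ_le_const2) (use topological_entropy_ge in \<open>auto intro!: exI[of _ 1]\<close>)
qed

subsection \<open>Uniqueness of slope functions\<close>

text \<open>A lap of order \<open>n\<close> has an image whose \<open>\<psi>\<close>-length is
  \<open>c ^ n\<close> times its own, with at most length divided by \<open>\<delta>\<close> plus 1
  cuts of order \<open>k\<close> inside. One more for passing from cuts to laps gives the 2.\<close>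

lemma laps_add_le_slope:
  assumes \<psi>: "slope_function c \<psi>" and "\<delta> > 0"
    and gap: "\<And>p q. p \<in> cuts k \<Longrightarrow> q \<in> cuts k \<Longrightarrow> p < q \<Longrightarrow> \<delta> \<le> \<psi> q - \<psi> p"
    and uv: "a \<le> u" "u < v" "v \<le> b"
  shows "real (laps (n + k) u v) \<le> 2 * real (laps n u v) + c ^ n * (\<psi> v - \<psi> u) / \<delta>"
proof -
  have "a \<le> u \<longrightarrow> v \<le> b \<longrightarrow> real (laps (n + k) u v) \<le> 2 * real (laps n u v) + c ^ n * (\<psi> v - \<psi> u) / \<delta>"
    using finite_cuts[of n] \<open>u < v\<close>
  proof (induction rule: cut_induct)
    case (uncut x y)
    show ?case
    proof (intro impI)
      assume xy: "a \<le> x" "y \<le> b"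
      obtain p q where pq: "p < q" "a \<le> p" "q \<le> b"
        "(p = (f ^^ n) x \<and> q = (f ^^ n) y) \<or> (p = (f ^^ n) y \<and> q = (f ^^ n) x)"
        and im: "(f ^^ n) ` {x..y} = {p..q}" "(f ^^ n) ` {x<..<y} = {p<..<q}"
        and laps_eq: "\<forall>m. laps (n + m) x y = laps m p q"
        by (rule uncut_image[OF xy(1) uncut(2) xy(2) uncut(4)])
      define X where "X = cuts k \<inter> {p<..<q}"
      have le: "\<psi> s \<le> \<psi> t" if "s \<in> {p..q}" "t \<in> {p..q}" "s \<le> t" for s t
        using slope_functionD(2)[OF \<psi>, of s t] that pq(2,3) by auto
      have len: "\<psi> q - \<psi> p = c ^ n * (\<psi> y - \<psi> x)"
        using slope_function_uncut[OF \<psi> xy(1) uncut(2) xy(2) uncut(4)] le[of p q] pq(1,4) by auto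
      have fin: "finite X" using finite_cuts by (simp add: X_def)
      have gapX: "\<delta> \<le> \<psi> t - \<psi> s" if "s \<in> X" "t \<in> X" "s < t" for s t
        using gap[of s t] that by (simp add: X_def)
      have less_iff: "s < t" if "s \<in> X" "t \<in> X" "\<psi> s < \<psi> t" for s t
        using le[of t s] that by (force simp: X_def not_less)
      have inj: "inj_on \<psi> X"
      proof (rule linorder_inj_onI)
        fix s t assume "s < t" "s \<in> X" "t \<in> X"
        then show "\<psi> s \<noteq> \<psi> t" using gapX[of s t] \<open>\<delta> > 0\<close> by auto
      qed (rule linorder_linear)
      have "real (card (\<psi> ` X)) \<le> (\<psi> q - \<psi> p) / \<delta> + 1"
      proof (rule card_separated_le)
        show "\<psi> ` X \<subseteq> {\<psi> p..\<psi> q}" using le pq(1) by (auto simp: X_def)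
        show "\<psi> p \<le> \<psi> q" using le[of p q] pq(1) by simp
        fix s t assume "s \<in> \<psi> ` X" "t \<in> \<psi> ` X" "s < t"
        then show "\<delta> \<le> t - s" using gapX less_iff by blast
      qed (use fin \<open>\<delta> > 0\<close> in auto)
      then have "real (laps k p q) \<le> (\<psi> q - \<psi> p) / \<delta> + 2"
        using card_image[OF inj] by (simp add: laps_def X_def)
      then show "real (laps (n + k) x y) \<le> 2 * real (laps n x y) + c ^ n * (\<psi> y - \<psi> x) / \<delta>"
        using laps_eq laps_uncut[OF uncut(4)] len by simp
    qed
  next
    case (split x w y)
    have "w \<in> cuts (n + k)" using split(5) by (simp add: cuts_add)
    then have "laps (n + k) x y = laps (n + k) x w + laps (n + k) w y" "laps n x y = laps n x w + laps n w y"
      using laps_split split(2,3,5) by blast+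
    moreover have "c ^ n * (\<psi> y - \<psi> x) / \<delta> = c ^ n * (\<psi> w - \<psi> x) / \<delta> + c ^ n * (\<psi> y - \<psi> w) / \<delta>"
      by (simp add: algebra_simps diff_divide_distrib)
    ultimately show ?case using split by auto
  qed
  then show ?thesis using uv by simp
qed

text \<open>A lap whose image has \<open>\<psi>\<close>-length at least \<open>\<delta>\<close> has
  image \<open>\<phi>\<close>-length at least \<open>\<eta>\<close>, hence at least
  \<open>\<eta>\<close> times its \<open>\<psi>\<close>-length, which is at most 1; both lengths
  scale by \<open>c ^ n\<close>. Each other lap forfeits at most \<open>\<delta> / c ^ n\<close> of
  \<open>\<psi>\<close>-length.\<close>

lemma slope_function_lower_bound_laps:
  assumes \<psi>: "slope_function c \<psi>" "\<psi> a = 0" "\<psi> b = 1" and \<phi>: "slope_function c \<phi>" and "c > 1"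
    and "\<eta> > 0" "\<delta> > 0"
    and big: "\<And>p q. a \<le> p \<Longrightarrow> p < q \<Longrightarrow> q \<le> b \<Longrightarrow> \<delta> \<le> \<psi> q - \<psi> p \<Longrightarrow> \<eta> \<le> \<phi> q - \<phi> p"
    and uv: "a \<le> u" "u < v" "v \<le> b"
  shows "\<eta> * ((\<psi> v - \<psi> u) - \<delta> * real (laps n u v) / c ^ n) \<le> \<phi> v - \<phi> u"
proof -
  have "a \<le> u \<longrightarrow> v \<le> b \<longrightarrow> \<eta> * ((\<psi> v - \<psi> u) - \<delta> * real (laps n u v) / c ^ n) \<le> \<phi> v - \<phi> u"
    using finite_cuts[of n] \<open>u < v\<close>
  proof (induction rule: cut_induct)
    case (uncut x y)
    show ?case
    proof (intro impI)
      assume xy: "a \<le> x" "y \<le> b"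
      obtain p q where pq: "p < q" "a \<le> p" "q \<le> b"
        "(p = (f ^^ n) x \<and> q = (f ^^ n) y) \<or> (p = (f ^^ n) y \<and> q = (f ^^ n) x)"
        and im: "(f ^^ n) ` {x..y} = {p..q}" "(f ^^ n) ` {x<..<y} = {p<..<q}"
        and laps_eq: "\<forall>m. laps (n + m) x y = laps m p q"
        by (rule uncut_image[OF xy(1) uncut(2) xy(2) uncut(4)])
      have len: "\<theta> q - \<theta> p = c ^ n * (\<theta> y - \<theta> x)" if "slope_function c \<theta>" for \<theta>
        using slope_function_uncut[OF that xy(1) uncut(2) xy(2) uncut(4)] 
          slope_functionD(2)[OF that, of p q] pq by auto
      have c: "c ^ n > 0" using \<open>c > 1\<close> by simp
      show "\<eta> * ((\<psi> y - \<psi> x) - \<delta> * real (laps n x y) / c ^ n) \<le> \<phi> y - \<phi> x"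
      proof (cases "\<delta> \<le> \<psi> q - \<psi> p")
        case True
        have "\<psi> q - \<psi> p \<le> 1"
          using slope_functionD(2)[OF \<psi>(1), of a p] slope_functionD(2)[OF \<psi>(1), of q b] pq \<psi>(2,3) by simp
        then have "c ^ n * (\<psi> y - \<psi> x) \<le> 1" using len[OF \<psi>(1)] by simp
        then have "\<eta> * (c ^ n * (\<psi> y - \<psi> x)) \<le> \<eta>" using \<open>\<eta> > 0\<close> by simp
        also have "\<eta> \<le> c ^ n * (\<phi> y - \<phi> x)" using big[OF pq(2,1,3) True] len[OF \<phi>] by simp
        finally have "c ^ n * (\<eta> * (\<psi> y - \<psi> x)) \<le> c ^ n * (\<phi> y - \<phi> x)" by (simp add: mult.left_commute)
        then have "\<eta> * (\<psi> y - \<psi> x) \<le> \<phi> y - \<phi> x" using c by simp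
        moreover have "0 \<le> \<eta> * (\<delta> * real (laps n x y) / c ^ n)" using c \<open>\<eta> > 0\<close> \<open>\<delta> > 0\<close> by simp
        ultimately show ?thesis by (simp add: right_diff_distrib)
      next
        case False
        then have "c ^ n * (\<psi> y - \<psi> x) \<le> \<delta>" using len[OF \<psi>(1)] by simp
        then have "(\<psi> y - \<psi> x) \<le> \<delta> / c ^ n" using c by (simp add: pos_le_divide_eq mult.commute)
        then have "\<eta> * ((\<psi> y - \<psi> x) - \<delta> * real (laps n x y) / c ^ n) \<le> 0"
          using laps_uncut[OF uncut(4)] \<open>\<eta> > 0\<close> by (simp add: mult_le_0_iff)
        moreover have "0 \<le> \<phi> y - \<phi> x" using slope_functionD(2)[OF \<phi>, of x y] xy uncut(2) by simp
        ultimately show ?thesis by linarith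
      qed
    qed
  next
    case (split x w y)
    have "laps n x y = laps n x w + laps n w y" using laps_split split(2,3,5) by blast
    then have "\<eta> * ((\<psi> y - \<psi> x) - \<delta> * real (laps n x y) / c ^ n) =
      \<eta> * ((\<psi> w - \<psi> x) - \<delta> * real (laps n x w) / c ^ n) + \<eta> * ((\<psi> y - \<psi> w) - \<delta> * real (laps n w y) / c ^ n)"
      by (simp add: algebra_simps add_divide_distrib)
    then show ?case using split by auto
  qed
  then show ?thesis using uv by simp
qed

text \<open>The order \<open>n\<close> may depend on the interval, but the laps then number at most
  a fixed multiple of \<open>c ^ n\<close> times its \<open>\<psi>\<close>-length. So at most half
  of that length is lost to laps with short images, uniformly in the interval.\<close>

lemma slope_functions_comparable:
  assumes \<psi>: "slope_function c \<psi>" "\<psi> a = 0" "\<psi> b = 1" and \<phi>: "slope_function c \<phi>" "\<phi> a < \<phi> b" and "c > 1"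
  obtains \<kappa> where "\<kappa> > 0" "\<And>u v. a \<le> u \<Longrightarrow> u < v \<Longrightarrow> v \<le> b \<Longrightarrow> \<kappa> * (\<psi> v - \<psi> u) \<le> \<phi> v - \<phi> u"
proof -
  have strict: "\<psi> u < \<psi> v" if "a \<le> u" "u < v" "v \<le> b" for u v
    using strict_mono_onD[OF slope_function_strict_mono[OF \<psi>(1)], of u v] that \<psi> by auto
  \<comment> \<open>With \<open>c ^ k > 4\<close> the factor 2 of \<open>laps_add_le_slope\<close>
    becomes less than 1/2 after normalisation by \<open>c ^ k\<close>.\<close>
  obtain k where k: "4 < c ^ k" using real_arch_pow[OF \<open>c > 1\<close>] by blast
  obtain \<delta> where \<delta>: "\<delta> > 0" "\<And>s t. s \<in> \<psi> ` cuts k \<Longrightarrow> t \<in> \<psi> ` cuts k \<Longrightarrow> s < t \<Longrightarrow> \<delta> < t - s"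
    using finite_gap[of "\<psi> ` cuts k"] finite_cuts by blast
  have gap: "\<delta> \<le> \<psi> q - \<psi> p" if "p \<in> cuts k" "q \<in> cuts k" "p < q" for p q
  proof -
    have "a \<le> p" "q \<le> b" using that by (auto simp: cuts_def)
    then show ?thesis using \<delta>(2)[of "\<psi> p" "\<psi> q"] strict[of p q] that by simp
  qed
  have laps_bound: "\<exists>n. real (laps n u v) / c ^ n \<le> (\<psi> v - \<psi> u) / \<delta>" if uv: "a \<le> u" "u < v" "v \<le> b" for u v
  proof -
    define l where "l = \<psi> v - \<psi> u"
    have "l > 0" using strict[OF uv] by (simp add: l_def)
    \<comment> \<open>The normalised recursion is dominated by
      \<open>x / 2 + l / (4 * \<delta>)\<close>, whose fixed point is
      \<open>l / (2 * \<delta>)\<close>; the deviation from it halves at every step.\<close>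
    have "real (laps (m * k) u v) / c ^ (m * k) \<le> (1 / 2) ^ m + l / (2 * \<delta>)" for m
    proof (induction m)
      case 0
      then show ?case using \<open>l > 0\<close> \<delta>(1) laps_uncut[of 0 u v] by (simp add: cuts_0)
    next
      case (Suc m)
      define n where "n = m * k"
      have c: "c ^ n > 0" "c ^ k > 0" using \<open>c > 1\<close> by auto
      have "real (laps (n + k) u v) / c ^ (n + k) \<le> (2 * real (laps n u v) + c ^ n * l / \<delta>) / c ^ (n + k)"
        unfolding l_def using \<open>c > 1\<close>
        by (intro divide_right_mono laps_add_le_slope[OF \<psi>(1) \<delta>(1) gap uv]) auto
      also have "\<dots> = (2 * (real (laps n u v) / c ^ n) + l / \<delta>) / c ^ k"
        using \<open>c > 1\<close> by (simp add: power_add add_divide_distrib)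
      also have "\<dots> \<le> (2 * (real (laps n u v) / c ^ n) + l / \<delta>) / 4"
        using k c \<open>l > 0\<close> \<delta>(1) by (intro divide_left_mono) auto
      also have "\<dots> \<le> (2 * ((1 / 2) ^ m + l / (2 * \<delta>)) + l / \<delta>) / 4"
        using Suc by (simp add: n_def)
      also have "\<dots> = (1 / 2) ^ Suc m + l / (2 * \<delta>)" by (simp add: field_simps)
      finally show ?case by (simp add: n_def add.commute)
    qed
    moreover obtain m where "(1 / 2) ^ m < l / (2 * \<delta>)"
      using real_arch_pow_inv[of "l / (2 * \<delta>)" "1 / 2"] \<open>l > 0\<close> \<delta>(1) by auto
    ultimately have "real (laps (m * k) u v) / c ^ (m * k) \<le> l / (2 * \<delta>) + l / (2 * \<delta>)"
      by (meson add_mono less_imp_le order_trans order_refl)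
    also have "\<dots> = l / \<delta>" by simp
    finally show ?thesis unfolding l_def by blast
  qed
  have "uniformly_continuous_on {a..b} \<psi>"
    using slope_functionD(1)[OF \<psi>(1)] by (intro compact_uniformly_continuous) auto
  then obtain \<epsilon> where \<epsilon>: "\<epsilon> > 0"
    "\<And>x y. x \<in> {a..b} \<Longrightarrow> y \<in> {a..b} \<Longrightarrow> dist y x < \<epsilon> \<Longrightarrow> dist (\<psi> y) (\<psi> x) < \<delta> / 2"
    unfolding uniformly_continuous_on_def using \<delta>(1) by (meson half_gt_zero)
  obtain \<eta> where \<eta>: "\<eta> > 0"
    "\<And>x y. x \<in> {a..b} \<Longrightarrow> y \<in> {a..b} \<Longrightarrow> \<epsilon> \<le> \<bar>x - y\<bar> \<Longrightarrow> \<eta> \<le> \<bar>\<phi> x - \<phi> y\<bar>"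
    using slope_function_uniformly_expands[OF \<phi> \<epsilon>(1)] by blast
  \<comment> \<open>The threshold is \<open>\<delta> / 2\<close>: with at most
    \<open>l * c ^ n / \<delta>\<close> laps, the loss is then at most half of the length
    \<open>l\<close>.\<close>
  have big: "\<eta> \<le> \<phi> q - \<phi> p" if pq: "a \<le> p" "p < q" "q \<le> b" "\<delta> / 2 \<le> \<psi> q - \<psi> p" for p q
  proof -
    have "\<not> dist (\<psi> q) (\<psi> p) < \<delta> / 2" using pq(4) unfolding dist_real_def by linarith
    then have "\<not> dist q p < \<epsilon>" using \<epsilon>(2)[of p q] pq(1-3) by auto
    then have "\<eta> \<le> \<bar>\<phi> q - \<phi> p\<bar>" using \<eta>(2)[of q p] pq by (simp add: dist_real_def)
    then show ?thesis using slope_functionD(2)[OF \<phi>(1), of p q] pq by simp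
  qed
  show ?thesis
  proof
    show "\<eta> / 2 > 0" using \<eta>(1) by simp
    fix u v assume uv: "a \<le> u" "u < v" "v \<le> b"
    obtain n where n: "real (laps n u v) / c ^ n \<le> (\<psi> v - \<psi> u) / \<delta>" using laps_bound[OF uv] by blast
    have "\<delta> / 2 * real (laps n u v) / c ^ n = \<delta> / 2 * (real (laps n u v) / c ^ n)" by simp
    also have "\<dots> \<le> \<delta> / 2 * ((\<psi> v - \<psi> u) / \<delta>)" using n \<delta>(1) by (intro mult_left_mono) auto
    also have "\<dots> = (\<psi> v - \<psi> u) / 2" using \<delta>(1) by simp
    finally have "\<eta> * ((\<psi> v - \<psi> u) / 2) \<le> \<eta> * ((\<psi> v - \<psi> u) - \<delta> / 2 * real (laps n u v) / c ^ n)"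
      using \<eta>(1) by (intro mult_left_mono) auto
    also have "\<dots> \<le> \<phi> v - \<phi> u"
      using \<delta>(1) by (intro slope_function_lower_bound_laps[OF \<psi> \<phi>(1) \<open>c > 1\<close> \<eta>(1) _ big uv]) auto
    finally show "\<eta> / 2 * (\<psi> v - \<psi> u) \<le> \<phi> v - \<phi> u" by simp
  qed
qed

text \<open>Subtracting the largest multiple of \<open>\<psi>\<close> that keeps \<open>\<theta>\<close> monotone leaves a slope function whose
  increments are not bounded below by those of \<open>\<psi>\<close>, hence a constant.\<close>

lemma slope_function_unique:
  assumes \<psi>: "slope_function c \<psi>" "\<psi> a = 0" "\<psi> b = 1" and \<theta>: "slope_function c \<theta>" "\<theta> a = 0" "\<theta> b = 1"
    and "c > 1" and x: "x \<in> {a..b}"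
  shows "\<theta> x = \<psi> x"
proof -
  have strict: "\<psi> u < \<psi> v" if "a \<le> u" "u < v" "v \<le> b" for u v
    using strict_mono_onD[OF slope_function_strict_mono[OF \<psi>(1)], of u v] that \<psi> by auto
  define I where "I = {(u, v). a \<le> u \<and> u < v \<and> v \<le> b}"
  define r where "r = (\<lambda>(u, v). (\<theta> v - \<theta> u) / (\<psi> v - \<psi> u))"
  define m where "m = (INF p\<in>I. r p)"
  have "(a, b) \<in> I" using less by (simp add: I_def)
  have "0 \<le> r p" if "p \<in> I" for p
    using that strict slope_functionD(2)[OF \<theta>(1)] by (auto simp: I_def r_def less_imp_le)
  then have "bdd_below (r ` I)" by (intro bdd_belowI[of _ 0]) auto
  then have m: "m \<le> r p" if "p \<in> I" for p unfolding m_def using that by (rule cINF_lower)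
  have m_le: "m * (\<psi> v - \<psi> u) \<le> \<theta> v - \<theta> u" if "a \<le> u" "u \<le> v" "v \<le> b" for u v
  proof (cases "u = v")
    case False
    then show ?thesis using m[of "(u, v)"] strict[of u v] that by (simp add: I_def r_def field_simps)
  qed simp
  define \<phi> where "\<phi> = (\<lambda>x. \<theta> x - m * \<psi> x)"
  have mono: "\<phi> u \<le> \<phi> v" if "a \<le> u" "u \<le> v" "v \<le> b" for u v
    using m_le[OF that] by (simp add: \<phi>_def algebra_simps)
  have \<phi>: "slope_function c \<phi>"
    unfolding slope_function_def
  proof (intro conjI allI impI)
    show "continuous_on {a..b} \<phi>"
      unfolding \<phi>_def using slope_functionD(1)[OF \<psi>(1)] slope_functionD(1)[OF \<theta>(1)]
      by (intro continuous_intros)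
    show "mono_on {a..b} \<phi>" using mono by (simp add: mono_on_def)
    fix u v assume uv: "a \<le> u" "u < v" "v \<le> b" "T \<inter> {u<..<v} = {}"
    have fI: "f u \<in> {a..b}" "f v \<in> {a..b}" using uv iter_in[of u 1] iter_in[of v 1] by auto
    \<comment> \<open>\<open>\<psi>\<close>, \<open>\<theta>\<close> and \<open>\<phi>\<close> are
      all monotone, so their increments from \<open>f u\<close> to \<open>f v\<close> have
      compatible signs. Once the order of \<open>f u\<close> and \<open>f v\<close> is fixed, the
      equations are linear and can be subtracted.\<close>
    note eqs = slope_functionD(3)[OF \<psi>(1) uv] slope_functionD(3)[OF \<theta>(1) uv]
    show "\<bar>\<phi> (f v) - \<phi> (f u)\<bar> = c * (\<phi> v - \<phi> u)"
    proof (cases "f u \<le> f v")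
      case True
      then have "\<psi> (f u) \<le> \<psi> (f v)" "\<theta> (f u) \<le> \<theta> (f v)" "\<phi> (f u) \<le> \<phi> (f v)"
        using fI slope_functionD(2)[OF \<psi>(1)] slope_functionD(2)[OF \<theta>(1)] mono by auto
      then have e: "\<psi> (f v) - \<psi> (f u) = c * (\<psi> v - \<psi> u)" "\<theta> (f v) - \<theta> (f u) = c * (\<theta> v - \<theta> u)"
        and "\<bar>\<phi> (f v) - \<phi> (f u)\<bar> = (\<theta> (f v) - \<theta> (f u)) - m * (\<psi> (f v) - \<psi> (f u))"
        using eqs by (auto simp: \<phi>_def algebra_simps)
      then show ?thesis unfolding e by (simp add: \<phi>_def algebra_simps)
    next
      case False
      then have "\<psi> (f v) \<le> \<psi> (f u)" "\<theta> (f v) \<le> \<theta> (f u)" "\<phi> (f v) \<le> \<phi> (f u)"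
        using fI slope_functionD(2)[OF \<psi>(1)] slope_functionD(2)[OF \<theta>(1)] mono by auto
      then have e: "\<psi> (f u) - \<psi> (f v) = c * (\<psi> v - \<psi> u)" "\<theta> (f u) - \<theta> (f v) = c * (\<theta> v - \<theta> u)"
        and "\<bar>\<phi> (f v) - \<phi> (f u)\<bar> = (\<theta> (f u) - \<theta> (f v)) - m * (\<psi> (f u) - \<psi> (f v))"
        using eqs by (auto simp: \<phi>_def algebra_simps)
      then show ?thesis unfolding e by (simp add: \<phi>_def algebra_simps)
    qed
  qed
  have "\<not> \<phi> a < \<phi> b"
  proof
    assume "\<phi> a < \<phi> b"
    then obtain \<kappa> where \<kappa>: "\<kappa> > 0"
      "\<And>u v. a \<le> u \<Longrightarrow> u < v \<Longrightarrow> v \<le> b \<Longrightarrow> \<kappa> * (\<psi> v - \<psi> u) \<le> \<phi> v - \<phi> u"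
      using slope_functions_comparable[OF \<psi> \<phi> _ \<open>c > 1\<close>] by blast
    have "m + \<kappa> \<le> r p" if p: "p \<in> I" for p
    proof -
      obtain u v where uv: "p = (u, v)" "a \<le> u" "u < v" "v \<le> b" using p by (auto simp: I_def)
      have "(m + \<kappa>) * (\<psi> v - \<psi> u) \<le> \<theta> v - \<theta> u"
        using \<kappa>(2)[OF uv(2-4)] by (simp add: \<phi>_def algebra_simps)
      then show ?thesis using strict[OF uv(2-4)] uv(1) by (simp add: r_def pos_le_divide_eq)
    qed
    then have "m + \<kappa> \<le> m" unfolding m_def using \<open>(a, b) \<in> I\<close> by (intro cINF_greatest) auto
    then show False using \<kappa>(1) by simp
  qed
  then have eq: "\<phi> a = \<phi> b" using mono[of a b] less by simp
  then have "m = 1" using \<psi>(2,3) \<theta>(2,3) by (simp add: \<phi>_def)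
  moreover have "\<phi> x = \<phi> a" using mono[of a x] mono[of x b] eq x by auto
  ultimately show ?thesis using \<psi>(2) \<theta>(2) by (simp add: \<phi>_def)
qed

end

subsection \<open>Constant slope\<close>

text \<open>If two pieces met \<open>{u<..<v}\<close>, the infimum of the right one would lie in it.
  Pieces may omit their endpoints, so only the open interval is captured.\<close>

lemma interval_division_cut:
  assumes P: "interval_division {c..d} P" and uv: "c \<le> u" "u < v" "v \<le> d" and cut: "Inf ` P \<inter> {u<..<v} = {}"
  obtains J where "J \<in> P" "{u<..<v} \<subseteq> J"
proof -
  have part: "partition_on {c..d} P" and intv: "\<And>J. J \<in> P \<Longrightarrow> is_interval J"
    using P by (auto simp: interval_division_def)
  have sub: "J \<subseteq> {c..d}" if "J \<in> P" for J using partition_onD1[OF part] that by blast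
  have cover: "\<exists>J\<in>P. x \<in> J" if "x \<in> {u<..<v}" for x
    using partition_onD1[OF part] that uv by auto
  have same: "J = K" if "J \<in> P" "K \<in> P" "s \<in> J" "t \<in> K" "s < t" "u < s" "t < v" for J K s t
  proof (rule ccontr)
    assume "J \<noteq> K"
    then have "J \<inter> K = {}" using partition_onD2[OF part] that(1,2) by (auto simp: disjoint_def)
    have "s \<le> y" if "y \<in> K" for y
    proof (rule ccontr)
      assume "\<not> s \<le> y"
      then have "s \<in> K"
        using mem_is_interval_1_I[OF intv[OF \<open>K \<in> P\<close>] \<open>y \<in> K\<close> \<open>t \<in> K\<close>, of s] \<open>s < t\<close> by simp
      then show False using \<open>J \<inter> K = {}\<close> \<open>s \<in> J\<close> by blast
    qed
    then have "s \<le> Inf K" using \<open>t \<in> K\<close> by (intro cInf_greatest) auto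
    moreover have "Inf K \<le> t"
      using sub[OF \<open>K \<in> P\<close>] \<open>t \<in> K\<close> by (intro cInf_lower bdd_belowI[of _ c]) auto
    ultimately have "Inf K \<in> {u<..<v}" using that by simp
    then show False using cut \<open>K \<in> P\<close> by blast
  qed
  obtain J where J: "J \<in> P" "(u + v) / 2 \<in> J" using cover[of "(u + v) / 2"] uv by auto
  have "x \<in> J" if x: "x \<in> {u<..<v}" for x
  proof -
    obtain K where K: "K \<in> P" "x \<in> K" using cover[OF x] by blast
    show ?thesis
    proof (cases x "(u + v) / 2" rule: linorder_cases)
      case less
      then show ?thesis using same[OF K(1) J(1) K(2) J(2) less] x uv K(2) by simp
    next
      case greater
      then show ?thesis using same[OF J(1) K(1) J(2) K(2) greater] x uv K(2) by simp
    next
      case equal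
      then show ?thesis using J(2) by (simp only:)
    qed
  qed
  then show ?thesis using that J(1) by blast
qed

lemma interval_division_Un:
  assumes "interval_division A P" "interval_division B Q" "A \<inter> B = {}"
  shows "interval_division (A \<union> B) (P \<union> Q)"
proof -
  have P: "finite P" "\<Union>P = A" "disjoint P" "{} \<notin> P" "\<And>J. J \<in> P \<Longrightarrow> is_interval J"
    and Q: "finite Q" "\<Union>Q = B" "disjoint Q" "{} \<notin> Q" "\<And>J. J \<in> Q \<Longrightarrow> is_interval J"
    using assms(1,2) by (auto simp: interval_division_def partition_on_def)
  have "disjoint (P \<union> Q)"
    using P(2,3) Q(2,3) assms(3) by (intro disjoint_union) auto
  then show ?thesis using P Q by (auto simp: interval_division_def partition_on_def)
qed

lemma interval_division_single: "is_interval A \<Longrightarrow> A \<noteq> {} \<Longrightarrow> interval_division A {A}"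
  by (simp add: interval_division_def partition_on_space)

text \<open>Half-open pieces glue without overlap; the right endpoint \<open>d\<close> is added as a
  piece of its own.\<close>

lemma piecewise_affine_if_uncut_affine:
  assumes "finite C" "c < d"
    and aff: "\<And>u v. c \<le> u \<Longrightarrow> u < v \<Longrightarrow> v \<le> d \<Longrightarrow> C \<inter> {u<..<v} = {} \<Longrightarrow> \<exists>k l. \<forall>x\<in>{u..v}. g x = k * x + l"
  shows "piecewise_affine {c..d} g"
proof -
  have "c \<le> c \<longrightarrow> d \<le> d \<longrightarrow> (\<exists>P. interval_division {c..<d} P \<and> (\<forall>J\<in>P. \<exists>k l. \<forall>x\<in>J. g x = k * x + l))"
    using assms(1,2)
  proof (induction rule: cut_induct[where P = "\<lambda>u v. c \<le> u \<longrightarrow> v \<le> d \<longrightarrow>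
      (\<exists>P. interval_division {u..<v} P \<and> (\<forall>J\<in>P. \<exists>k l. \<forall>x\<in>J. g x = k * x + l))"])
    case (uncut u v)
    show ?case
    proof (intro impI exI[of _ "{{u..<v}}"] conjI)
      show "interval_division {u..<v} {{u..<v}}"
        using uncut by (intro interval_division_single) auto
      obtain k l where "\<forall>x\<in>{u..v}. g x = k * x + l" using aff[of u v] uncut by auto
      then show "\<forall>J\<in>{{u..<v}}. \<exists>k l. \<forall>x\<in>J. g x = k * x + l" by (intro ballI exI[of _ k] exI[of _ l]) auto
    qed
  next
    case (split u w v)
    show ?case
    proof (intro impI)
      assume "c \<le> u" "v \<le> d"
      then obtain P Q where P: "interval_division {u..<w} P" "\<forall>J\<in>P. \<exists>k l. \<forall>x\<in>J. g x = k * x + l"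
        and Q: "interval_division {w..<v} Q" "\<forall>J\<in>Q. \<exists>k l. \<forall>x\<in>J. g x = k * x + l"
        using split by auto
      have "{u..<v} = {u..<w} \<union> {w..<v}" using split by auto
      then have "interval_division {u..<v} (P \<union> Q)"
        using interval_division_Un[OF P(1) Q(1)] by auto
      then show "\<exists>P. interval_division {u..<v} P \<and> (\<forall>J\<in>P. \<exists>k l. \<forall>x\<in>J. g x = k * x + l)"
        using P(2) Q(2) by blast
    qed
  qed
  then obtain P where P: "interval_division {c..<d} P" "\<forall>J\<in>P. \<exists>k l. \<forall>x\<in>J. g x = k * x + l" by auto
  have "is_interval {d}" using is_interval_cc[of d d] by simp
  moreover have "{c..d} = {c..<d} \<union> {d}" using \<open>c < d\<close> by auto
  ultimately have "interval_division {c..d} (P \<union> {{d}})"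
    using interval_division_Un[OF P(1) interval_division_single[of "{d}"]] by simp
  moreover have "\<exists>k l. \<forall>x\<in>{d}. g x = k * x + l" by (intro exI[of _ 0] exI[of _ "g d"]) simp
  ultimately show ?thesis unfolding piecewise_affine_def using P(2) by blast
qed

lemma ex_uncut_right:
  fixes C :: "real set"
  assumes "finite C" "x < d"
  obtains y where "x < y" "y \<le> d" "C \<inter> {x<..<y} = {}"
proof -
  define y where "y = Min (insert d {c \<in> C. x < c})"
  have "x < y" using assms by (simp add: y_def)
  moreover have "y \<le> d" using assms by (simp add: y_def)
  moreover have "y \<le> c" if "c \<in> C" "x < c" for c using assms that by (auto simp: y_def intro!: Min_le)
  ultimately show ?thesis using that[of y] by fastforce
qed

lemma ex_uncut_left:
  fixes C :: "real set"
  assumes "finite C" "d < x"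
  obtains y where "y < x" "d \<le> y" "C \<inter> {y<..<x} = {}"
proof -
  define y where "y = Max (insert d {c \<in> C. c < x})"
  have "y < x" using assms by (simp add: y_def)
  moreover have "d \<le> y" using assms by (simp add: y_def)
  moreover have "c \<le> y" if "c \<in> C" "c < x" for c using assms that by (auto simp: y_def intro!: Max_ge)
  ultimately show ?thesis using that[of y] by fastforce
qed

text \<open>The absolute difference quotient is constant on \<open>{u..v}\<close>, and an interval
  on one side of \<open>x\<close> suffices. This covers endpoints and cut points as well.\<close>

lemma has_real_derivative_abs_eq:
  assumes D: "(g has_real_derivative D) (at x within S)" and "u < v" "{u..v} \<subseteq> S" "x \<in> {u..v}"
    and slope: "\<And>s. s \<in> {u..v} \<Longrightarrow> \<bar>g s - g x\<bar> = \<beta> * \<bar>s - x\<bar>"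
  shows "\<bar>D\<bar> = \<beta>"
proof -
  have "(g has_real_derivative D) (at x within {u..v})" by (rule DERIV_subset[OF D \<open>{u..v} \<subseteq> S\<close>])
  then have "((\<lambda>s. (g s - g x) / (s - x)) \<longlongrightarrow> D) (at x within {u..v})" by (simp add: has_field_derivative_iff)
  then have lim: "((\<lambda>s. \<bar>(g s - g x) / (s - x)\<bar>) \<longlongrightarrow> \<bar>D\<bar>) (at x within {u..v})" by (rule tendsto_rabs)
  have "\<forall>\<^sub>F s in at x within {u..v}. \<bar>(g s - g x) / (s - x)\<bar> = \<beta>"
    using slope by (simp add: eventually_at_filter)
  then have "((\<lambda>s. \<bar>(g s - g x) / (s - x)\<bar>) \<longlongrightarrow> \<beta>) (at x within {u..v})" by (rule tendsto_eventually)
  moreover have "at x within {u..v} \<noteq> bot"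
    using trivial_limit_within[of x "{u..v}"] islimpt_Icc[OF \<open>u < v\<close>, of x] \<open>x \<in> {u..v}\<close> by simp
  ultimately show ?thesis using tendsto_unique lim by blast
qed

lemma constant_slope_if_uncut:
  assumes "finite C" and "continuous_on {0..1} g"
    and slope: "\<And>u v. 0 \<le> u \<Longrightarrow> u < v \<Longrightarrow> v \<le> 1 \<Longrightarrow> C \<inter> {u<..<v} = {} \<Longrightarrow> \<bar>g v - g u\<bar> = \<beta> * (v - u)"
    and "\<beta> > 0"
  shows "constant_slope {0..1} g \<beta>"
  unfolding constant_slope_def
proof (intro conjI ballI allI impI)
  show "piecewise_affine {0..1} g"
  proof (rule piecewise_affine_if_uncut_affine[OF \<open>finite C\<close>])
    fix u v :: real assume uv: "0 \<le> u" "u < v" "v \<le> 1" "C \<inter> {u<..<v} = {}"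
    have sl: "\<bar>g t - g s\<bar> = \<beta> * (t - s)" if "u \<le> s" "s < t" "t \<le> v" for s t
    proof -
      have "C \<inter> {s<..<t} = {}" using uv(4) that by fastforce
      then show ?thesis using slope[of s t] uv that by auto
    qed
    have inj: "inj_on g {u..v}"
    proof (rule linorder_inj_onI)
      fix s t assume "s < t" "s \<in> {u..v}" "t \<in> {u..v}"
      then have "\<bar>g t - g s\<bar> > 0" using sl[of s t] \<open>\<beta> > 0\<close> by simp
      then show "g s \<noteq> g t" by auto
    qed (rule linorder_linear)
    have "continuous_on {u..v} g" by (rule continuous_on_subset[OF assms(2)]) (use uv in auto)
    then have "strict_mono_on {u..v} g \<or> strict_antimono_on {u..v} g"
      using inj injective_eq_monotone_map[of "{u..v}" g] by (simp add: is_interval_cc)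
    then show "\<exists>k l. \<forall>x\<in>{u..v}. g x = k * x + l"
    proof
      assume m: "strict_mono_on {u..v} g"
      have "g x = \<beta> * x + (g u - \<beta> * u)" if x: "x \<in> {u..v}" for x
      proof (cases "x = u")
        case False
        then have "g u < g x" using strict_mono_onD[OF m, of u x] x uv by auto
        then show ?thesis using sl[of u x] False x by (simp add: algebra_simps)
      qed simp
      then show ?thesis by blast
    next
      assume m: "strict_antimono_on {u..v} g"
      have "g x = - \<beta> * x + (g u + \<beta> * u)" if x: "x \<in> {u..v}" for x
      proof (cases "x = u")
        case False
        then have "g x < g u" using monotone_onD[OF m, of u x] x uv by auto
        then show ?thesis using sl[of u x] False x by (simp add: algebra_simps)
      qed simp
      then show ?thesis by blast
    qed
  qed simp
next
  fix x D :: real assume x: "x \<in> {0..1}" and D: "(g has_real_derivative D) (at x within {0..1})"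
  show "\<bar>D\<bar> = \<beta>"
  proof (cases "x < 1")
    case True
    then obtain y where y: "x < y" "y \<le> 1" "C \<inter> {x<..<y} = {}" using ex_uncut_right[OF \<open>finite C\<close>] by blast
    show ?thesis
    proof (rule has_real_derivative_abs_eq[OF D \<open>x < y\<close>])
      fix s assume s: "s \<in> {x..y}"
      have "C \<inter> {x<..<s} = {}" using y(3) s by fastforce
      then show "\<bar>g s - g x\<bar> = \<beta> * \<bar>s - x\<bar>" using slope[of x s] s x y by (cases "s = x") auto
    qed (use x y in auto)
  next
    case False
    then have "0 < x" "x = 1" using x by auto
    then obtain y where y: "y < x" "0 \<le> y" "C \<inter> {y<..<x} = {}" using ex_uncut_left[OF \<open>finite C\<close>] by blast
    show ?thesis
    proof (rule has_real_derivative_abs_eq[OF D \<open>y < x\<close>])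
      fix s assume s: "s \<in> {y..x}"
      have "C \<inter> {s<..<x} = {}" using y(3) s by fastforce
      then show "\<bar>g s - g x\<bar> = \<beta> * \<bar>s - x\<bar>"
        using slope[of s x] s x y by (cases "s = x") (auto simp: abs_minus_commute)
    qed (use x y in auto)
  qed
qed

text \<open>The slope of a piece is read off at the midpoint, where the derivative exists;
  continuity extends the affine formula to both ends.\<close>

lemma constant_slope_uncut:
  assumes g: "constant_slope {0..1} g \<beta>" and c: "continuous_on {0..1} g"
  obtains C where "finite C"
    "\<And>u v. 0 \<le> u \<Longrightarrow> u < v \<Longrightarrow> v \<le> 1 \<Longrightarrow> C \<inter> {u<..<v} = {} \<Longrightarrow> \<bar>g v - g u\<bar> = \<beta> * (v - u)"
proof -
  obtain P where P: "interval_division {0..1} P" "\<forall>J\<in>P. \<exists>k l. \<forall>x\<in>J. g x = k * x + l"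
    using g unfolding constant_slope_def piecewise_affine_def by blast
  show ?thesis
  proof
    show "finite (Inf ` P)" using P(1) by (simp add: interval_division_def)
    fix u v :: real assume uv: "0 \<le> u" "u < v" "v \<le> 1" "Inf ` P \<inter> {u<..<v} = {}"
    obtain J where J: "J \<in> P" "{u<..<v} \<subseteq> J" by (rule interval_division_cut[OF P(1) uv])
    then obtain k l where kl: "\<And>x. x \<in> {u<..<v} \<Longrightarrow> g x = k * x + l" using P(2) by blast
    define m where "m = (u + v) / 2"
    have m: "m \<in> {u<..<v}" using uv by (simp add: m_def)
    have "((\<lambda>x. k * x + l) has_real_derivative k) (at m)" by (auto intro!: derivative_eq_intros)
    then have "(g has_real_derivative k) (at m)"
      by (rule DERIV_cong_ev[OF refl _ refl, THEN iffD1, rotated])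
        (use m kl in \<open>auto intro!: eventually_nhds_in_open[of "{u<..<v}", THEN eventually_mono]\<close>)
    then have "(g has_real_derivative k) (at m within {0..1})" by (rule has_field_derivative_at_within)
    then have k: "\<bar>k\<bar> = \<beta>" using g m uv unfolding constant_slope_def by auto
    have cl: "closure {u<..<v} = {u..v}" using uv(2) by simp
    have "continuous_on {u..v} (\<lambda>x. g x - (k * x + l))"
      using continuous_on_subset[OF c, of "{u..v}"] uv by (intro continuous_intros) auto
    then have "g x - (k * x + l) = 0" if "x \<in> {u..v}" for x
      using continuous_constant_on_closure[of "{u<..<v}" "\<lambda>x. g x - (k * x + l)" 0 x] kl that cl by auto
    from this[of u] this[of v] have "g u = k * u + l" "g v = k * v + l" using uv by auto
    then have "g v - g u = k * (v - u)" by (simp add: algebra_simps)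
    then show "\<bar>g v - g u\<bar> = \<beta> * (v - u)" using k uv by (simp add: abs_mult)
  qed
qed

section \<open>From piecewise monotone maps to cut sets\<close>

lemma mono_on_closed_interval:
  fixes f :: "real \<Rightarrow> real"
  assumes "u < v" and c: "continuous_on {u..v} f" and m: "mono_on {u<..<v} f"
  shows "mono_on {u..v} f"
proof -
  have 1: "f x \<le> f y" if "x \<in> {u..y}" "u < y" "y < v" for x y
  proof (rule continuous_le_on_closure[of "{u<..<y}" f])
    show "continuous_on (closure {u<..<y}) f" using c that by (simp add: continuous_on_subset)
    show "x \<in> closure {u<..<y}" using that by simp
    show "f z \<le> f y" if "z \<in> {u<..<y}" for z using mono_onD[OF m, of z y] that \<open>y < v\<close> by auto
  qed
  have 2: "f x \<le> f z" if "z \<in> {x..v}" "u \<le> x" "x < v" for x z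
  proof (rule continuous_ge_on_closure[of "{x<..<v}" f])
    show "continuous_on (closure {x<..<v}) f" using c that by (simp add: continuous_on_subset)
    show "z \<in> closure {x<..<v}" using that by simp
    show "f x \<le> f y" if "y \<in> {x<..<v}" for y using 1[of x y] that \<open>u \<le> x\<close> by auto
  qed
  show ?thesis
  proof (rule mono_onI)
    fix x z assume "x \<in> {u..v}" "z \<in> {u..v}" "x \<le> z"
    then show "f x \<le> f z" using 2[of z x] by (cases "x < v") auto
  qed
qed

context transitive_interval_map
begin

text \<open>A monotone function with equal values at two points is constant between them, which
  \<open>nonconstant_iter\<close> forbids.\<close>

lemma mono_imp_inj_on:
  assumes uv: "a \<le> u" "u < v" "v \<le> b" and m: "mono_on {u<..<v} f \<or> antimono_on {u<..<v} f"
  shows "inj_on f {u..v}"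
proof -
  have c: "continuous_on {u..v} f" by (rule continuous_on_subset[OF cont]) (use uv in auto)
  have const: False if "x < y" "x \<in> {u..v}" "y \<in> {u..v}" "\<And>z. z \<in> {x..y} \<Longrightarrow> f z = f x" for x y
    using nonconstant_iter[of x y 1] that uv by (metis atLeastAtMost_iff funpow_0 funpow_simps_right(2) One_nat_def o_apply order_trans)
  have "f x \<noteq> f y" if xy: "x < y" "x \<in> {u..v}" "y \<in> {u..v}" for x y
  proof
    assume eq: "f x = f y"
    have "f z = f x" if z: "z \<in> {x..y}" for z
      using m
    proof
      assume "mono_on {u<..<v} f"
      then have m': "mono_on {u..v} f" by (rule mono_on_closed_interval[OF uv(2) c])
      show ?thesis using mono_onD[OF m', of x z] mono_onD[OF m', of z y] eq xy z by auto
    next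
      assume "antimono_on {u<..<v} f"
      then have "mono_on {u<..<v} (\<lambda>x. - f x)" by (auto simp: monotone_on_def)
      then have m': "mono_on {u..v} (\<lambda>x. - f x)"
        by (rule mono_on_closed_interval[OF uv(2) continuous_on_minus[OF c]])
      show ?thesis using mono_onD[OF m', of x z] mono_onD[OF m', of z y] eq xy z by auto
    qed
    then show False using const xy by blast
  qed
  then show ?thesis by (intro linorder_inj_onI) auto
qed

lemma piecewise_monotone_imp_cut:
  assumes "piecewise_monotone {a..b} f"
  obtains T where "cut_interval_map a b f T"
proof -
  obtain P where P: "interval_division {a..b} P" "\<forall>J\<in>P. mono_on J f \<or> antimono_on J f"
    using assms unfolding piecewise_monotone_def by blast
  have "cut_interval_map a b f (Inf ` P)"
  proof
    show "finite (Inf ` P)" using P(1) by (simp add: interval_division_def)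
    fix u v assume uv: "a \<le> u" "u < v" "v \<le> b" "Inf ` P \<inter> {u<..<v} = {}"
    obtain J where J: "J \<in> P" "{u<..<v} \<subseteq> J" by (rule interval_division_cut[OF P(1) uv])
    then have "mono_on {u<..<v} f \<or> antimono_on {u<..<v} f"
      using P(2) monotone_on_subset by blast
    then show "inj_on f {u..v}" by (rule mono_imp_inj_on[OF uv(1-3)])
  qed
  then show ?thesis by (rule that)
qed

end

section \<open>Conjugacies and slope functions\<close>

lemma cut_interval_map_superset:
  assumes "cut_interval_map a b f T" "T \<subseteq> T'" "finite T'"
  shows "cut_interval_map a b f T'"
proof -
  interpret cut_interval_map a b f T by fact
  show ?thesis
  proof
    fix u v assume "a \<le> u" "u < v" "v \<le> b" "T' \<inter> {u<..<v} = {}"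
    then show "inj_on f {u..v}" using assms(2) by (intro inj_uncut) auto
  qed fact
qed

text \<open>The break points of \<open>g\<close> are pulled back by \<open>\<psi>\<close> and joined
  to \<open>T\<close>; continuity of \<open>g\<close> is inherited from \<open>f\<close>. Allowing
  all larger \<open>T'\<close> lets two conjugacies share one cut set.\<close>

lemma conjugacy_slope_function:
  assumes cut: "cut_interval_map a b f T" and g: "constant_slope {0..1} g \<beta>"
    and \<psi>: "increasing_homeomorphism {a..b} {0..1} \<psi>" "conjugate_via {a..b} f g \<psi>"
  shows "\<psi> a = 0 \<and> \<psi> b = 1 \<and> (\<exists>C. finite C \<and>
    (\<forall>T'. T \<union> C \<subseteq> T' \<longrightarrow> finite T' \<longrightarrow> cut_interval_map.slope_function a b f T' \<beta> \<psi>))"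
proof -
  interpret cut_interval_map a b f T by fact
  obtain \<phi> where hom: "homeomorphism {a..b} {0..1} \<psi> \<phi>" and sm: "strict_mono_on {a..b} \<psi>"
    using \<psi>(1) unfolding increasing_homeomorphism_def by blast
  have conj: "\<psi> (f x) = g (\<psi> x)" if "x \<in> {a..b}" for x using \<psi>(2) that by (simp add: conjugate_via_def)
  have im: "\<psi> ` {a..b} = {0..1}" "\<phi> ` {0..1} = {a..b}" and inv: "\<And>x. x \<in> {a..b} \<Longrightarrow> \<phi> (\<psi> x) = x"
      "\<And>s. s \<in> {0..1} \<Longrightarrow> \<psi> (\<phi> s) = s" and c\<psi>: "continuous_on {a..b} \<psi>" and c\<phi>: "continuous_on {0..1} \<phi>"
    using hom by (auto simp: homeomorphism_def)
  have mono: "\<psi> x \<le> \<psi> y" if "x \<in> {a..b}" "y \<in> {a..b}" "x \<le> y" for x y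
    using strict_mono_onD[OF sm, of x y] that by (cases "x = y") auto
  have \<psi>I: "\<psi> x \<in> {0..1}" if "x \<in> {a..b}" for x using im(1) that by blast
  have \<phi>I: "\<phi> s \<in> {a..b}" if "s \<in> {0..1}" for s using im(2) that by blast
  have ends: "\<psi> a = 0" "\<psi> b = 1"
  proof -
    have "\<psi> a \<le> \<psi> (\<phi> 0)" "\<psi> (\<phi> 1) \<le> \<psi> b" using \<phi>I[of 0] \<phi>I[of 1] less by (auto intro!: mono)
    then show "\<psi> a = 0" "\<psi> b = 1" using inv(2)[of 0] inv(2)[of 1] \<psi>I[of a] \<psi>I[of b] less by auto
  qed
  have "continuous_on {0..1} (\<lambda>s. \<psi> (f (\<phi> s)))"
  proof (rule continuous_on_compose2[OF c\<psi>])
    show "continuous_on {0..1} (\<lambda>s. f (\<phi> s))" by (rule continuous_on_compose2[OF cont c\<phi>]) (use im in auto)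
    show "(\<lambda>s. f (\<phi> s)) ` {0..1} \<subseteq> {a..b}" using \<phi>I iter_in[of _ 1] by (simp add: image_subset_iff)
  qed
  moreover have "\<psi> (f (\<phi> s)) = g s" if "s \<in> {0..1}" for s using conj[OF \<phi>I[OF that]] inv(2)[OF that] by simp
  ultimately have "continuous_on {0..1} g" by (rule continuous_on_eq)
  then obtain C where C: "finite C"
    "\<And>u v. 0 \<le> u \<Longrightarrow> u < v \<Longrightarrow> v \<le> 1 \<Longrightarrow> C \<inter> {u<..<v} = {} \<Longrightarrow> \<bar>g v - g u\<bar> = \<beta> * (v - u)"
    using constant_slope_uncut[OF g] by blast
  show ?thesis
  proof (intro conjI exI[of _ "\<phi> ` (C \<inter> {0..1})"] allI impI)
    show "finite (\<phi> ` (C \<inter> {0..1}))" using C(1) by simp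
    fix T' assume T': "T \<union> \<phi> ` (C \<inter> {0..1}) \<subseteq> T'" "finite T'"
    interpret T': cut_interval_map a b f T'
      by (rule cut_interval_map_superset[OF cut]) (use T' in auto)
    show "T'.slope_function \<beta> \<psi>"
      unfolding T'.slope_function_def
    proof (intro conjI allI impI)
      show "continuous_on {a..b} \<psi>" by (rule c\<psi>)
      show "mono_on {a..b} \<psi>" using sm by (rule strict_mono_on_imp_mono_on)
      fix u v assume uv: "a \<le> u" "u < v" "v \<le> b" "T' \<inter> {u<..<v} = {}"
      then have I: "u \<in> {a..b}" "v \<in> {a..b}" by auto
      have "C \<inter> {\<psi> u<..<\<psi> v} = {}"
      proof -
        have False if s: "s \<in> C" "\<psi> u < s" "s < \<psi> v" for s
        proof -
          have "s \<in> {0..1}" using s \<psi>I[OF I(1)] \<psi>I[OF I(2)] by auto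
          then have "\<phi> s \<in> T'" "\<phi> s \<in> {a..b}" "\<psi> (\<phi> s) = s" using T' s inv \<phi>I by auto
          moreover have "u < \<phi> s" "\<phi> s < v"
            using mono[of "\<phi> s" u] mono[of v "\<phi> s"] I calculation s by (auto simp: not_le[symmetric])
          ultimately show False using uv(4) by auto
        qed
        then show ?thesis by auto
      qed
      moreover have "\<psi> u < \<psi> v" using strict_mono_onD[OF sm I uv(2)] .
      ultimately show "\<bar>\<psi> (f v) - \<psi> (f u)\<bar> = \<beta> * (\<psi> v - \<psi> u)"
        using C(2)[of "\<psi> u" "\<psi> v"] \<psi>I[OF I(1)] \<psi>I[OF I(2)] conj I by simp
    qed
  qed (fact ends)+
qed

context cut_interval_map
begin

lemma slope_function_conjugacy:
  assumes \<psi>: "slope_function c \<psi>" "\<psi> a = 0" "\<psi> b = 1" and "c > 0"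
  obtains g where "g \<in> {0..1} \<rightarrow>\<^sub>E {0..1}" "constant_slope {0..1} g c"
    "increasing_homeomorphism {a..b} {0..1} \<psi>" "conjugate_via {a..b} f g \<psi>"
proof -
  note c\<psi> = slope_functionD(1)[OF \<psi>(1)]
  have sm: "strict_mono_on {a..b} \<psi>" by (rule slope_function_strict_mono[OF \<psi>(1)]) (simp add: \<psi>)
  then have inj: "inj_on \<psi> {a..b}" by (rule strict_mono_on_imp_inj_on)
  have im: "\<psi> ` {a..b} = {0..1}"
  proof (intro equalityI subsetI)
    fix s assume "s \<in> \<psi> ` {a..b}"
    then show "s \<in> {0..1}"
      using slope_functionD(2)[OF \<psi>(1), of a] slope_functionD(2)[OF \<psi>(1), of _ b] \<psi>(2,3) by force
  next
    fix s :: real assume "s \<in> {0..1}"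
    then show "s \<in> \<psi> ` {a..b}" using IVT'[of \<psi> a s b] c\<psi> \<psi>(2,3) less by auto
  qed
  obtain \<phi> where hom: "homeomorphism {a..b} {0..1} \<psi> \<phi>"
    using homeomorphism_compact[OF _ c\<psi> im inj] by auto
  have im\<phi>: "\<phi> ` {0..1} = {a..b}" and inv: "\<And>x. x \<in> {a..b} \<Longrightarrow> \<phi> (\<psi> x) = x"
      "\<And>s. s \<in> {0..1} \<Longrightarrow> \<psi> (\<phi> s) = s" and c\<phi>: "continuous_on {0..1} \<phi>"
    using hom by (auto simp: homeomorphism_def)
  have \<psi>I: "\<psi> x \<in> {0..1}" if "x \<in> {a..b}" for x using im that by blast
  have \<phi>I: "\<phi> s \<in> {a..b}" if "s \<in> {0..1}" for s using im\<phi> that by blast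
  have \<phi>_less: "\<phi> s < \<phi> t" if "s \<in> {0..1}" "t \<in> {0..1}" "s < t" for s t
    using slope_functionD(2)[OF \<psi>(1), of "\<phi> t" "\<phi> s"] inv(2) that \<phi>I by (force simp: not_le[symmetric])
  define g where "g = (\<lambda>s\<in>{0..1}. \<psi> (f (\<phi> s)))"
  have g: "g s = \<psi> (f (\<phi> s))" if "s \<in> {0..1}" for s using that by (simp add: g_def)
  have fI: "f x \<in> {a..b}" if "x \<in> {a..b}" for x using iter_in[OF that, of 1] by simp
  have cg: "continuous_on {0..1} g"
  proof -
    have "continuous_on {0..1} (\<lambda>s. \<psi> (f (\<phi> s)))"
    proof (rule continuous_on_compose2[OF c\<psi>])
      show "continuous_on {0..1} (\<lambda>s. f (\<phi> s))" by (rule continuous_on_compose2[OF cont c\<phi>]) (use im\<phi> in auto)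
      show "(\<lambda>s. f (\<phi> s)) ` {0..1} \<subseteq> {a..b}" using \<phi>I fI by (simp add: image_subset_iff)
    qed
    then show ?thesis using g continuous_on_cong[of "{0..1}" "{0..1}" g] by auto
  qed
  show ?thesis
  proof
    show "g \<in> {0..1} \<rightarrow>\<^sub>E {0..1}" using \<psi>I fI \<phi>I by (auto simp: g_def)
    show "increasing_homeomorphism {a..b} {0..1} \<psi>"
      using hom sm unfolding increasing_homeomorphism_def by blast
    show "conjugate_via {a..b} f g \<psi>"
      unfolding conjugate_via_def using g \<psi>I inv(1) by auto
    show "constant_slope {0..1} g c"
    proof (rule constant_slope_if_uncut[OF _ cg _ \<open>c > 0\<close>])
      show "finite (\<psi> ` T)" using finite_T by simp
      fix u v :: real assume uv: "0 \<le> u" "u < v" "v \<le> 1" "\<psi> ` T \<inter> {u<..<v} = {}"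
      then have I: "u \<in> {0..1}" "v \<in> {0..1}" by auto
      have "T \<inter> {\<phi> u<..<\<phi> v} = {}"
      proof -
        have False if t: "t \<in> T" "\<phi> u < t" "t < \<phi> v" for t
        proof -
          have "t \<in> {a..b}" using t \<phi>I[OF I(1)] \<phi>I[OF I(2)] by auto
          then have "\<psi> (\<phi> u) < \<psi> t" "\<psi> t < \<psi> (\<phi> v)"
            using strict_mono_onD[OF sm] t \<phi>I I by blast+
          then have "\<psi> t \<in> {u<..<v}" using inv(2) I by simp
          then show False using uv(4) t(1) by blast
        qed
        then show ?thesis by auto
      qed
      then have "\<bar>\<psi> (f (\<phi> v)) - \<psi> (f (\<phi> u))\<bar> = c * (\<psi> (\<phi> v) - \<psi> (\<phi> u))"
        using slope_functionD(3)[OF \<psi>(1), of "\<phi> u" "\<phi> v"] \<phi>_less[OF I uv(2)] \<phi>I[OF I(1)] \<phi>I[OF I(2)] by simp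
      then show "\<bar>g v - g u\<bar> = c * (v - u)" using g inv(2) I by simp
    qed
  qed
qed

end

section \<open>Existence and uniqueness of the constant slope model\<close>

theorem corollary8p3:
  fixes a b \<beta> :: real and f :: "real \<Rightarrow> real"
  assumes "a < b"
    and "f \<in> {a..b} \<rightarrow> {a..b}"
    and "continuous_on {a..b} f"
    and "transitive_map {a..b} f"
    and "piecewise_monotone {a..b} f"
    and "\<beta> > 0"
    and "topological_entropy {a..b} f = ereal (ln \<beta>)"
  shows "\<exists>!g. g \<in> {0..1} \<rightarrow>\<^sub>E {0..1} \<and> constant_slope {0..1} g \<beta> \<and>
           (\<exists>\<psi>. increasing_homeomorphism {a..b} {0..1} \<psi> \<and> conjugate_via {a..b} f g \<psi>)"
proof -
  interpret transitive_interval_map a b f by unfold_locales (fact assms)+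
  obtain T where cut: "cut_interval_map a b f T" by (rule piecewise_monotone_imp_cut[OF assms(5)])
  interpret cut_interval_map a b f T by (rule cut)
  have "ln growth = ln \<beta>" using topological_entropy_eq assms(7) by simp
  \<comment> \<open>Both numbers are positive, so \<open>ln\<close> cancels; this turns the entropy
    hypothesis into a statement about laps.\<close>
  then have \<beta>: "\<beta> = growth" "\<beta> > 1" using growth_gt_1 \<open>\<beta> > 0\<close> by auto
  obtain \<psi> where \<psi>: "slope_function growth \<psi>" "\<psi> a = 0" "\<psi> b = 1" by (rule growth_slope_function_exists)
  show ?thesis
  proof (rule ex_ex1I)
    have "growth > 0" using growth_gt_1 by simp
    obtain g where "g \<in> {0..1} \<rightarrow>\<^sub>E {0..1}" "constant_slope {0..1} g growth"
        "increasing_homeomorphism {a..b} {0..1} \<psi>" "conjugate_via {a..b} f g \<psi>"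
      by (rule slope_function_conjugacy[OF \<psi> \<open>growth > 0\<close>])
    then show "\<exists>g. g \<in> {0..1} \<rightarrow>\<^sub>E {0..1} \<and> constant_slope {0..1} g \<beta> \<and>
        (\<exists>\<psi>. increasing_homeomorphism {a..b} {0..1} \<psi> \<and> conjugate_via {a..b} f g \<psi>)"
      unfolding \<beta>(1) by blast
  next
    fix g h
    assume g: "g \<in> {0..1} \<rightarrow>\<^sub>E {0..1} \<and> constant_slope {0..1} g \<beta> \<and>
        (\<exists>\<psi>. increasing_homeomorphism {a..b} {0..1} \<psi> \<and> conjugate_via {a..b} f g \<psi>)"
      and h: "h \<in> {0..1} \<rightarrow>\<^sub>E {0..1} \<and> constant_slope {0..1} h \<beta> \<and>
        (\<exists>\<psi>. increasing_homeomorphism {a..b} {0..1} \<psi> \<and> conjugate_via {a..b} f h \<psi>)"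
    obtain \<psi> where \<psi>: "increasing_homeomorphism {a..b} {0..1} \<psi>" "conjugate_via {a..b} f g \<psi>" using g by blast
    obtain \<theta> where \<theta>: "increasing_homeomorphism {a..b} {0..1} \<theta>" "conjugate_via {a..b} f h \<theta>" using h by blast
    obtain C where C: "finite C" "\<psi> a = 0" "\<psi> b = 1"
      "\<forall>T'. T \<union> C \<subseteq> T' \<longrightarrow> finite T' \<longrightarrow> cut_interval_map.slope_function a b f T' \<beta> \<psi>"
      using conjugacy_slope_function[OF cut conjunct1[OF conjunct2[OF g]] \<psi>] by blast
    obtain D where D: "finite D" "\<theta> a = 0" "\<theta> b = 1"
      "\<forall>T'. T \<union> D \<subseteq> T' \<longrightarrow> finite T' \<longrightarrow> cut_interval_map.slope_function a b f T' \<beta> \<theta>"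
      using conjugacy_slope_function[OF cut conjunct1[OF conjunct2[OF h]] \<theta>] by blast
    \<comment> \<open>With the pulled-back break points of both maps added, \<open>\<psi>\<close>
      and \<open>\<theta>\<close> are slope functions for the same cut set.\<close>
    interpret T': cut_interval_map a b f "T \<union> C \<union> D"
      by (rule cut_interval_map_superset[OF cut]) (use finite_T C(1) D(1) in auto)
    have eq: "\<theta> x = \<psi> x" if "x \<in> {a..b}" for x
    proof (rule T'.slope_function_unique[OF _ C(2,3) _ D(2,3) \<beta>(2) that])
      show "T'.slope_function \<beta> \<psi>" by (rule C(4)[rule_format]) (use finite_T C(1) D(1) in auto)
      show "T'.slope_function \<beta> \<theta>" by (rule D(4)[rule_format]) (use finite_T C(1) D(1) in auto)
    qed
    \<comment> \<open>The conjugacies coincide and are onto \<open>{0..1}\<close>, so they determine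
      both maps there; extensionality makes this equality.\<close>
    have "g s = h s" if "s \<in> {0..1}" for s
    proof -
      obtain \<phi> where "homeomorphism {a..b} {0..1} \<psi> \<phi>"
        using \<psi>(1) unfolding increasing_homeomorphism_def by blast
      then have "s \<in> \<psi> ` {a..b}" using that by (simp add: homeomorphism_image1)
      then obtain x where x: "s = \<psi> x" "x \<in> {a..b}" by (rule imageE)
      have "f x \<in> {a..b}" using iter_in[OF x(2), of 1] by simp
      moreover have "g s = \<psi> (f x)" "h s = \<theta> (f x)"
        using \<psi>(2) \<theta>(2) eq[OF x(2)] x unfolding conjugate_via_def by simp_all
      ultimately show ?thesis using eq by simp
    qed
    then show "g = h" by (rule PiE_ext[OF conjunct1[OF g] conjunct1[OF h]])
  qed
qed

end
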